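(* Let $\Gamma$ be a standard commutative group or unitary ring, let $\mathcal{F}$ be a measurable lamination (admitting a regular measurable atlas), and let $\{U,V\}$ be a covering of $\mathcal{F}$ by two measurable open sets. Then the inclusion map $i:(V,U\cap V)\to(\mathcal{F},U)$ induces an isomorphism $$H^*_{\mathrm{MT}}(\mathcal{F},U,\Gamma)\cong H^*_{\mathrm{MT}}(V,U\cap V,\Gamma).$$ Equivalently, if $U\subset\mathcal{F}$ is a measurable open set and $Z\subset U$ is measurable and closed, then the inclusion induces an isomorphism $H^*_{\mathrm{MT}}(\mathcal{F},U,\Gamma)\cong H^*_{\mathrm{MT}}(\mathcal{F}\setminus Z,U\setminus Z,\Gamma)$.
   Context: An MT-space is a set equipped with a $\sigma$-algebra and a topology (the $\sigma$-algebra need not be the Borel $\sigma$-algebra of the topology). Measure-theoretic terms refer to the $\sigma$-algebra, topological terms to the topology. An MT-map is a measurable continuous map; an MT-isomorphism is a measurable isomorphism that is also a homeomorphism. Measurable subsets are MT-spaces with the induced structures. A standard Borel space is a measurable space isomorphic to a Borel subset of a Polish space. For a Polish space $P$ and a standard Borel space $T$, $P\times T$ is an MT-space with the $\sigma$-algebra generated by products of Borel sets and the product of the topology of $P$ with the discrete topology on $T$. A measurable chart on an MT-space $X$ is an MT-isomorphism $\varphi:U\to P\times T$, where $U\subset X$ is open and measurable, $T$ is a standard Borel space and $P$ is a locally compact, connected, locally path connected Polish space ($P,T$ depend on the chart); its plaques are the sets $\varphi^{-1}(P\times\{t\})$. A measurable atlas is a countable family of measurable charts whose domains cover $X$. A measurable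 lamination is an MT-space admitting a measurable atlas; its leaves are its connected components. A measurable atlas is regular if for each of its charts $(U,\varphi)$ there is a measurable chart $(W,\psi)$ such that the closure of each plaque of $U$ is compact, $\overline U\subset W$, $\overline U$ is measurable and $\varphi=\psi|_U$, and if for every two charts of the atlas each plaque of the first meets at most one plaque of the second. $\Gamma$ is an abelian group or unitary ring that is also a standard Borel space with measurable operations and inverse. A measurable singular $n$-simplex on $X$ is an MT-map $\sigma:\Delta^n\times T\to X$ with $T$ standard Borel and $\Delta^n$ the canonical $n$-simplex. A usual singular $n$-cochain $\omega$ on the topological space $X$ (a $\Gamma$-valued function on continuous maps $\Delta^n\to X$) is measurable if $t\mapsto\omega(\sigma|_{\Delta^n\times\{t\}})$ is a measurable map $T\to\Gamma$ for every measurable singular $n$-simplex $\sigma:\Delta^n\times T\to X$. Measurable cochains form a subcomplex $C^*_{\mathrm{MT}}(X,\Gamma)$ of the usual singular cochain complex, with cohomology $H^*_{\mathrm{MT}}(X,\Gamma)$. For $U\subset X$ measurable, $C^*_{\mathrm{MT}}(X,U,\Gamma)$ is the kernel of the restriction $C^*_{\mathrm{MT}}(X,\Gamma)\to C^*_{\mathrm{MT}}(U,\Gamma)$, i.e. the measurable cochains vanishing on all singular simplices contained in $U$; its cohomology is $H^*_{\mathrm{MT}}(X,U,\Gamma)$. *)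

theory Defs
  imports "HOL-Analysis.Analysis" "HOL-Homology.Homology"
begin

section \<open>Polish and standard Borel spaces\<close>

text \<open>
  A Polish space has at most continuum many points, so it is homeomorphic to a space whose
  points are real numbers (with a topology unrelated to that of the real line). The
  quantifiers over all Polish or all standard Borel spaces below therefore range over
  \<^typ>\<open>real topology\<close> and \<^typ>\<open>real measure\<close>. Of a measure only the underlying
  measurable space is used.
\<close>

definition polish_space :: "'b topology \<Rightarrow> bool" where
  "polish_space P \<longleftrightarrow> completely_metrizable_space P \<and> separable_space P"

definition borel_of_topology :: "'b topology \<Rightarrow> 'b measure" where
  "borel_of_topology P = sigma (topspace P) {S. openin P S}"

definition measurable_isomorphism :: "'b measure \<Rightarrow> 'c measure \<Rightarrow> ('b \<Rightarrow> 'c) \<Rightarrow> bool" where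
  "measurable_isomorphism M N f \<longleftrightarrow>
     f \<in> M \<rightarrow>\<^sub>M N \<and> bij_betw f (space M) (space N) \<and> inv_into (space M) f \<in> N \<rightarrow>\<^sub>M M"

definition standard_borel_space :: "'b measure \<Rightarrow> bool" where
  "standard_borel_space M \<longleftrightarrow>
     (\<exists>(P :: real topology) B f. polish_space P \<and> B \<in> sets (borel_of_topology P) \<and>
        measurable_isomorphism M (restrict_space (borel_of_topology P) B) f)"

lemma polish_space_real_copy:
  assumes "polish_space (P :: 'b topology)"
  shows "\<exists>Q :: real topology. polish_space Q \<and> P homeomorphic_space Q"
proof -
  obtain S d where md: "Metric_space S d" and P: "P = Metric_space.mtopology S d"
    using assms unfolding polish_space_def completely_metrizable_space_def by blast
  interpret Metric_space S d by (rule md)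
  obtain C where C: "countable C" "C \<subseteq> S" "mtopology closure_of C = S"
    using assms unfolding polish_space_def separable_space_def P by auto
  define I where "I = C \<times> (\<rat> :: real set)"
  have I: "countable I"
    unfolding I_def using C(1) by (simp add: countable_rat)
  define g where "g x = to_nat_on I ` {(c, q). (c, q) \<in> I \<and> d c x < q}" for x
  have "inj_on g S"
  proof (rule inj_onI, rule ccontr)
    fix x y assume xy: "x \<in> S" "y \<in> S" "g x = g y" "x \<noteq> y"
    have "d x y > 0" using xy by simp
    then have "d x y / 2 > 0" by simp
    moreover have "x \<in> mtopology closure_of C" using C xy by simp
    ultimately obtain c where c: "c \<in> C" "c \<in> mball x (d x y / 2)"
      unfolding metric_closure_of by blast
    then have cS: "c \<in> S" and cx: "d c x < d x y / 2"
      by (auto simp: commute)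
    obtain q where q: "q \<in> \<rat>" "d c x < q" "q < d x y / 2"
      using Rats_dense_in_real[OF cx] by blast
    have "(c, q) \<in> {(c, q). (c, q) \<in> I \<and> d c x < q}"
      using c q by (simp add: I_def)
    then have "to_nat_on I (c, q) \<in> g y"
      using xy(3) unfolding g_def by blast
    then obtain c' q' where cq': "(c', q') \<in> I" "d c' y < q'" "to_nat_on I (c', q') = to_nat_on I (c, q)"
      unfolding g_def by auto
    moreover have "(c, q) \<in> I" using c q by (simp add: I_def)
    ultimately have "(c', q') = (c, q)"
      using I by (metis from_nat_into_to_nat_on)
    then have "d c y < q" using cq' by simp
    then show False
      using triangle[OF xy(1) cS xy(2)] commute[of c x] q by simp
  qed
  moreover obtain h :: "nat set \<Rightarrow> real" where "inj h"
    using eqpoll_imp_lepoll[OF nat_sets_eqpoll_reals] unfolding lepoll_def by blast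
  ultimately have inj: "inj_on (h \<circ> g) S"
    by (simp add: comp_inj_on inj_on_subset)
  define f where "f = h \<circ> g"
  define k where "k = inv_into S f"
  have kf: "k (f x) = x" if "x \<in> S" for x
    using inv_into_f_f[OF inj that] by (simp add: k_def f_def)
  define Q where "Q = pullback_topology (f ` S) k P"
  have tP: "topspace P = S" by (simp add: P)
  have tQ: "topspace Q = f ` S"
    unfolding Q_def topspace_pullback_topology tP using kf by auto
  have k: "continuous_map Q P k"
    unfolding Q_def using continuous_map_pullback[OF continuous_map_id, of "f ` S" k P] by simp
  have f: "continuous_map P Q f"
    unfolding Q_def
  proof (rule continuous_map_pullback')
    show "continuous_map P P (k \<circ> f)"
      by (rule continuous_map_eq[OF continuous_map_id]) (simp add: tP kf)
    show "topspace P \<subseteq> f -` f ` S" using tP by auto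
  qed
  have "homeomorphic_maps P Q f k"
    unfolding homeomorphic_maps_def using f k kf tP tQ by auto
  then have hom: "P homeomorphic_space Q"
    unfolding homeomorphic_space_def by blast
  have "separable_space Q"
    using separable_space_continuous_map_image[OF _ f] assms tP tQ
    by (simp add: polish_space_def)
  then have "polish_space Q"
    using assms homeomorphic_completely_metrizable_space[OF hom] by (simp add: polish_space_def)
  with hom show ?thesis by blast
qed

section \<open>MT-spaces\<close>

record 'a mt_space =
  mt_meas :: "'a measure"
  mt_topo :: "'a topology"

definition mt_space :: "'a mt_space \<Rightarrow> bool" where
  "mt_space X \<longleftrightarrow> space (mt_meas X) = topspace (mt_topo X)"

definition mt_map :: "'a mt_space \<Rightarrow> 'b mt_space \<Rightarrow> ('a \<Rightarrow> 'b) \<Rightarrow> bool" where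
  "mt_map X Y f \<longleftrightarrow> f \<in> mt_meas X \<rightarrow>\<^sub>M mt_meas Y \<and> continuous_map (mt_topo X) (mt_topo Y) f"

definition mt_isomorphism :: "'a mt_space \<Rightarrow> 'b mt_space \<Rightarrow> ('a \<Rightarrow> 'b) \<Rightarrow> bool" where
  "mt_isomorphism X Y f \<longleftrightarrow>
     measurable_isomorphism (mt_meas X) (mt_meas Y) f \<and> homeomorphic_map (mt_topo X) (mt_topo Y) f"

definition mt_subspace :: "'a mt_space \<Rightarrow> 'a set \<Rightarrow> 'a mt_space" where
  "mt_subspace X S = \<lparr>mt_meas = restrict_space (mt_meas X) S, mt_topo = subtopology (mt_topo X) S\<rparr>"

definition mt_product :: "'b topology \<Rightarrow> 'c measure \<Rightarrow> ('b \<times> 'c) mt_space" where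
  "mt_product P T =
     \<lparr>mt_meas = borel_of_topology P \<Otimes>\<^sub>M T,
      mt_topo = prod_topology P (discrete_topology (space T))\<rparr>"

section \<open>Measurable laminations\<close>

record 'a mt_chart =
  chart_dom :: "'a set"
  chart_map :: "'a \<Rightarrow> real \<times> real"
  chart_plaque :: "real topology"
  chart_transversal :: "real measure"

definition measurable_chart :: "'a mt_space \<Rightarrow> 'a mt_chart \<Rightarrow> bool" where
  "measurable_chart X c \<longleftrightarrow>
     openin (mt_topo X) (chart_dom c) \<and> chart_dom c \<in> sets (mt_meas X) \<and>
     standard_borel_space (chart_transversal c) \<and>
     polish_space (chart_plaque c) \<and> locally_compact_space (chart_plaque c) \<and>
     connected_space (chart_plaque c) \<and> locally_path_connected_space (chart_plaque c) \<and>
     mt_isomorphism (mt_subspace X (chart_dom c))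
       (mt_product (chart_plaque c) (chart_transversal c)) (chart_map c)"

definition plaques :: "'a mt_chart \<Rightarrow> 'a set set" where
  "plaques c =
     {{x \<in> chart_dom c. chart_map c x \<in> topspace (chart_plaque c) \<times> {t}} | t.
        t \<in> space (chart_transversal c)}"

definition measurable_atlas :: "'a mt_space \<Rightarrow> 'a mt_chart set \<Rightarrow> bool" where
  "measurable_atlas X A \<longleftrightarrow>
     countable A \<and> (\<forall>c\<in>A. measurable_chart X c) \<and> (\<Union>c\<in>A. chart_dom c) = topspace (mt_topo X)"

definition measurable_lamination :: "'a mt_space \<Rightarrow> bool" where
  "measurable_lamination X \<longleftrightarrow> mt_space X \<and> (\<exists>A. measurable_atlas X A)"

text \<open>
  The last condition on \<open>d\<close> says that the chart map of \<open>c\<close> is the restriction of that of \<open>d\<close>,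
  so the product \<open>P \<times> T\<close> of \<open>c\<close> is literally a subset of that of \<open>d\<close>.
\<close>

definition regular_measurable_atlas :: "'a mt_space \<Rightarrow> 'a mt_chart set \<Rightarrow> bool" where
  "regular_measurable_atlas X A \<longleftrightarrow>
     measurable_atlas X A \<and>
     (\<forall>c\<in>A. \<exists>d. measurable_chart X d \<and>
        (\<forall>p\<in>plaques c. compactin (mt_topo X) (mt_topo X closure_of p)) \<and>
        mt_topo X closure_of chart_dom c \<subseteq> chart_dom d \<and>
        mt_topo X closure_of chart_dom c \<in> sets (mt_meas X) \<and>
        (\<forall>x\<in>chart_dom c. chart_map c x = chart_map d x)) \<and>
     (\<forall>c\<in>A. \<forall>d\<in>A. \<forall>p\<in>plaques c. \<forall>q\<in>plaques d. \<forall>q'\<in>plaques d.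
        p \<inter> q \<noteq> {} \<and> p \<inter> q' \<noteq> {} \<longrightarrow> q = q')"

section \<open>Coefficients\<close>

definition standard_comm_group :: "('g, 'm) monoid_scheme \<Rightarrow> 'g measure \<Rightarrow> bool" where
  "standard_comm_group G M \<longleftrightarrow>
     comm_group G \<and> space M = carrier G \<and> standard_borel_space M \<and>
     (\<lambda>(a, b). a \<otimes>\<^bsub>G\<^esub> b) \<in> M \<Otimes>\<^sub>M M \<rightarrow>\<^sub>M M \<and>
     (\<lambda>a. inv\<^bsub>G\<^esub> a) \<in> M \<rightarrow>\<^sub>M M"

definition standard_ring :: "('g, 'm) ring_scheme \<Rightarrow> 'g measure \<Rightarrow> bool" where
  "standard_ring R M \<longleftrightarrow>
     ring R \<and> space M = carrier R \<and> standard_borel_space M \<and>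
     (\<lambda>(a, b). a \<oplus>\<^bsub>R\<^esub> b) \<in> M \<Otimes>\<^sub>M M \<rightarrow>\<^sub>M M \<and>
     (\<lambda>a. \<ominus>\<^bsub>R\<^esub> a) \<in> M \<rightarrow>\<^sub>M M \<and>
     (\<lambda>(a, b). a \<otimes>\<^bsub>R\<^esub> b) \<in> M \<Otimes>\<^sub>M M \<rightarrow>\<^sub>M M"

section \<open>Measurable singular cohomology\<close>

text \<open>
  The coefficient group is written multiplicatively, as in \<^theory>\<open>HOL-Algebra.Group\<close>.
  For a ring \<open>R\<close> one takes \<^term>\<open>add_monoid R\<close>.
\<close>

abbreviation standard_simplex_topology :: "nat \<Rightarrow> (nat \<Rightarrow> real) topology" where
  "standard_simplex_topology n \<equiv> subtopology (powertop_real UNIV) (standard_simplex n)"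

definition measurable_singular_simplex ::
    "nat \<Rightarrow> real measure \<Rightarrow> 'a mt_space \<Rightarrow> ((nat \<Rightarrow> real) \<times> real \<Rightarrow> 'a) \<Rightarrow> bool" where
  "measurable_singular_simplex n T X \<sigma> \<longleftrightarrow>
     standard_borel_space T \<and> mt_map (mt_product (standard_simplex_topology n) T) X \<sigma>"

definition singular_cochain_group ::
    "nat \<Rightarrow> 'a topology \<Rightarrow> ('g, 'm) monoid_scheme \<Rightarrow> (((nat \<Rightarrow> real) \<Rightarrow> 'a) \<Rightarrow> 'g) monoid" where
  "singular_cochain_group n X G = product_group (singular_simplex_set n X) (\<lambda>_. G)"

definition coboundary ::
    "nat \<Rightarrow> 'a topology \<Rightarrow> ('g, 'm) monoid_scheme \<Rightarrow>
     (((nat \<Rightarrow> real) \<Rightarrow> 'a) \<Rightarrow> 'g) \<Rightarrow> (((nat \<Rightarrow> real) \<Rightarrow> 'a) \<Rightarrow> 'g)" where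
  "coboundary n X G \<omega> =
     (\<lambda>\<sigma>\<in>singular_simplex_set (Suc n) X.
        \<Otimes>\<^bsub>G\<^esub>k\<in>{..Suc n}.
          (if even k then \<omega> (singular_face (Suc n) k \<sigma>)
           else inv\<^bsub>G\<^esub> \<omega> (singular_face (Suc n) k \<sigma>)))"

definition measurable_cochains ::
    "nat \<Rightarrow> 'a mt_space \<Rightarrow> ('g, 'm) monoid_scheme \<Rightarrow> 'g measure \<Rightarrow>
     (((nat \<Rightarrow> real) \<Rightarrow> 'a) \<Rightarrow> 'g) set" where
  "measurable_cochains n X G M =
     {\<omega> \<in> carrier (singular_cochain_group n (mt_topo X) G).
        \<forall>T \<sigma>. measurable_singular_simplex n T X \<sigma> \<longrightarrow>
          (\<lambda>t. \<omega> (\<lambda>x\<in>standard_simplex n. \<sigma> (x, t))) \<in> T \<rightarrow>\<^sub>M M}"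

definition rel_measurable_cochains ::
    "nat \<Rightarrow> 'a mt_space \<Rightarrow> 'a set \<Rightarrow> ('g, 'm) monoid_scheme \<Rightarrow> 'g measure \<Rightarrow>
     (((nat \<Rightarrow> real) \<Rightarrow> 'a) \<Rightarrow> 'g) set" where
  "rel_measurable_cochains n X U G M =
     {\<omega> \<in> measurable_cochains n X G M.
        \<forall>\<sigma>\<in>singular_simplex_set n (subtopology (mt_topo X) U). \<omega> \<sigma> = \<one>\<^bsub>G\<^esub>}"

definition rel_measurable_cocycles ::
    "nat \<Rightarrow> 'a mt_space \<Rightarrow> 'a set \<Rightarrow> ('g, 'm) monoid_scheme \<Rightarrow> 'g measure \<Rightarrow>
     (((nat \<Rightarrow> real) \<Rightarrow> 'a) \<Rightarrow> 'g) set" where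
  "rel_measurable_cocycles n X U G M =
     {\<omega> \<in> rel_measurable_cochains n X U G M.
        coboundary n (mt_topo X) G \<omega> = \<one>\<^bsub>singular_cochain_group (Suc n) (mt_topo X) G\<^esub>}"

definition rel_measurable_coboundaries ::
    "nat \<Rightarrow> 'a mt_space \<Rightarrow> 'a set \<Rightarrow> ('g, 'm) monoid_scheme \<Rightarrow> 'g measure \<Rightarrow>
     (((nat \<Rightarrow> real) \<Rightarrow> 'a) \<Rightarrow> 'g) set" where
  "rel_measurable_coboundaries n X U G M =
     (case n of
        0 \<Rightarrow> {\<one>\<^bsub>singular_cochain_group 0 (mt_topo X) G\<^esub>}
      | Suc m \<Rightarrow> coboundary m (mt_topo X) G ` rel_measurable_cochains m X U G M)"

definition rel_measurable_cohomology ::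
    "nat \<Rightarrow> 'a mt_space \<Rightarrow> 'a set \<Rightarrow> ('g, 'm) monoid_scheme \<Rightarrow> 'g measure \<Rightarrow>
     (((nat \<Rightarrow> real) \<Rightarrow> 'a) \<Rightarrow> 'g) set monoid" where
  "rel_measurable_cohomology n X U G M =
     (singular_cochain_group n (mt_topo X) G)\<lparr>carrier := rel_measurable_cocycles n X U G M\<rparr>
       Mod rel_measurable_coboundaries n X U G M"

definition cohomology_class ::
    "nat \<Rightarrow> 'a mt_space \<Rightarrow> 'a set \<Rightarrow> ('g, 'm) monoid_scheme \<Rightarrow> 'g measure \<Rightarrow>
     (((nat \<Rightarrow> real) \<Rightarrow> 'a) \<Rightarrow> 'g) \<Rightarrow> (((nat \<Rightarrow> real) \<Rightarrow> 'a) \<Rightarrow> 'g) set" where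
  "cohomology_class n X U G M \<omega> =
     rel_measurable_coboundaries n X U G M #>\<^bsub>singular_cochain_group n (mt_topo X) G\<^esub> \<omega>"

definition cochain_pullback ::
    "nat \<Rightarrow> 'a topology \<Rightarrow> ('a \<Rightarrow> 'b) \<Rightarrow>
     (((nat \<Rightarrow> real) \<Rightarrow> 'b) \<Rightarrow> 'g) \<Rightarrow> (((nat \<Rightarrow> real) \<Rightarrow> 'a) \<Rightarrow> 'g)" where
  "cochain_pullback n X f \<omega> = (\<lambda>\<sigma>\<in>singular_simplex_set n X. \<omega> (simplex_map n f \<sigma>))"

text \<open>
  The map in cohomology induced by a map of pairs from \<open>(X, A)\<close> to some \<open>(Y, B)\<close>, where \<open>c\<close>
  is a class of \<open>(Y, B)\<close>. All members of \<open>c\<close> have cohomologous pullbacks.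
\<close>

definition cohomology_pullback ::
    "nat \<Rightarrow> 'a mt_space \<Rightarrow> 'a set \<Rightarrow> ('g, 'm) monoid_scheme \<Rightarrow> 'g measure \<Rightarrow> ('a \<Rightarrow> 'b) \<Rightarrow>
     (((nat \<Rightarrow> real) \<Rightarrow> 'b) \<Rightarrow> 'g) set \<Rightarrow> (((nat \<Rightarrow> real) \<Rightarrow> 'a) \<Rightarrow> 'g) set" where
  "cohomology_pullback n X A G M f c =
     the_elem ((\<lambda>\<omega>. cohomology_class n X A G M (cochain_pullback n (mt_topo X) f \<omega>)) ` c)"

text \<open>For a ring of coefficients, the scalar actions on cohomology classes.\<close>

definition cohomology_lscale ::
    "nat \<Rightarrow> 'a mt_space \<Rightarrow> 'a set \<Rightarrow> ('g, 'm) ring_scheme \<Rightarrow> 'g measure \<Rightarrow> 'g \<Rightarrow>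
     (((nat \<Rightarrow> real) \<Rightarrow> 'a) \<Rightarrow> 'g) set \<Rightarrow> (((nat \<Rightarrow> real) \<Rightarrow> 'a) \<Rightarrow> 'g) set" where
  "cohomology_lscale n X U R M r c =
     the_elem ((\<lambda>\<omega>. cohomology_class n X U (add_monoid R) M
       (\<lambda>\<sigma>\<in>singular_simplex_set n (mt_topo X). r \<otimes>\<^bsub>R\<^esub> \<omega> \<sigma>)) ` c)"

definition cohomology_rscale ::
    "nat \<Rightarrow> 'a mt_space \<Rightarrow> 'a set \<Rightarrow> ('g, 'm) ring_scheme \<Rightarrow> 'g measure \<Rightarrow> 'g \<Rightarrow>
     (((nat \<Rightarrow> real) \<Rightarrow> 'a) \<Rightarrow> 'g) set \<Rightarrow> (((nat \<Rightarrow> real) \<Rightarrow> 'a) \<Rightarrow> 'g) set" where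
  "cohomology_rscale n X U R M r c =
     the_elem ((\<lambda>\<omega>. cohomology_class n X U (add_monoid R) M
       (\<lambda>\<sigma>\<in>singular_simplex_set n (mt_topo X). \<omega> \<sigma> \<otimes>\<^bsub>R\<^esub> r)) ` c)"

text \<open>Isomorphisms of cohomology groups that commute with both scalar actions.\<close>

definition ring_coefficient_iso ::
    "nat \<Rightarrow> 'b mt_space \<Rightarrow> 'b set \<Rightarrow> 'a mt_space \<Rightarrow> 'a set \<Rightarrow> ('g, 'm) ring_scheme \<Rightarrow> 'g measure \<Rightarrow>
     ((((nat \<Rightarrow> real) \<Rightarrow> 'b) \<Rightarrow> 'g) set \<Rightarrow> (((nat \<Rightarrow> real) \<Rightarrow> 'a) \<Rightarrow> 'g) set) set" where
  "ring_coefficient_iso n Y B X A R M =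
     {h \<in> iso (rel_measurable_cohomology n Y B (add_monoid R) M)
              (rel_measurable_cohomology n X A (add_monoid R) M).
        \<forall>r\<in>carrier R. \<forall>c\<in>carrier (rel_measurable_cohomology n Y B (add_monoid R) M).
          h (cohomology_lscale n Y B R M r c) = cohomology_lscale n X A R M r (h c) \<and>
          h (cohomology_rscale n Y B R M r c) = cohomology_rscale n X A R M r (h c)}"

end

theory Submission
  imports Defs
begin

text \<open>
  Classical excision replaces a singular simplex by an iterated barycentric subdivision that is
  subordinate to the cover \<open>{U, V}\<close>. The number of subdivisions depends on the simplex, and in a
  measurable family \<open>\<sigma>\<^sub>t\<close> it must depend measurably on \<open>t\<close>, so one has to know that
  \<open>{t. \<sigma>\<^sub>t \<subseteq> V}\<close> is measurable. This set consists of the \<open>t\<close> for which the section at \<open>t\<close> of the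
  Borel set \<open>\<sigma>\<^sup>-\<^sup>1(V) \<subseteq> \<Delta> \<times> T\<close> is all of \<open>\<Delta>\<close>. The sections are open, so by the theorem of Kunugui
  and Novikov \<open>\<sigma>\<^sup>-\<^sup>1(V)\<close> is a countable union of rectangles with open first and Borel second side,
  and compactness of \<open>\<Delta>\<close> finishes the argument.

  On cochains, restriction to \<open>V\<close> is a surjective cochain map, because extending a relative
  measurable cochain of \<open>(V, U \<inter> V)\<close> by the neutral element gives a measurable cochain of the
  whole space. Its kernel consists of the measurable cochains that vanish on the simplices in
  \<open>U\<close> and on those in \<open>V\<close>. The subdivision homotopy contracts this kernel, so the restriction
  induces isomorphisms in cohomology.
\<close>

section \<open>Analytic sets in Polish spaces\<close>

text \<open>That some point of \<sigma>(-, t) lies outside \<open>V\<close> is a condition obtained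
  by projecting a Borel set along the simplex, so a priori the set of such t is only analytic. Borel
  measurability has to come from separation theorems, and these need a workable notion of analytic
  set; this is why the proof opens in Baire space. A second obstacle is that a simplex and its faces
  have different subdivision levels, so subdividing each simplex to its own level does not commute
  with boundaries. For a cochain in the kernel the values of the homotopy stabilize: beyond the
  level of a simplex every further summand consists of small simplices, where the cochain is
  neutral. A simplex and all its faces can thus be compared at one common level. Finally, the
  extension of a cocycle by the neutral element need not be a cocycle. Its coboundary lies in the
  kernel, and the contraction yields a correction in the kernel, invisible after restriction. This
  takes the place of a long exact sequence.\<close>

lemma open_baire_iff:
  fixes W :: "(nat \<Rightarrow> nat) set"
  shows "open W \<longleftrightarrow> (\<forall>y\<in>W. \<exists>k. \<forall>z. (\<forall>i<k. z i = y i) \<longrightarrow> z \<in> W)"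
proof
  assume W: "open W"
  show "\<forall>y\<in>W. \<exists>k. \<forall>z. (\<forall>i<k. z i = y i) \<longrightarrow> z \<in> W"
  proof
    fix y assume "y \<in> W"
    have "openin (product_topology (\<lambda>_. euclidean) UNIV) W"
      using W by (simp add: open_fun_def)
    then obtain X where X: "y \<in> (\<Pi>\<^sub>E i\<in>UNIV. X i)" "finite {i. X i \<noteq> topspace euclidean}"
        "(\<Pi>\<^sub>E i\<in>UNIV. X i) \<subseteq> W"
      using product_topology_open_contains_basis[of "\<lambda>_. euclidean" UNIV W y] \<open>y \<in> W\<close> by auto
    from X(2) obtain k where k: "\<forall>i\<in>{i. X i \<noteq> topspace euclidean}. i < k"
      using finite_nat_set_iff_bounded by blast
    have "z \<in> W" if "\<forall>i<k. z i = y i" for z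
    proof -
      have "z i \<in> X i" for i
        using k that X(1) by (cases "i < k") auto
      then show ?thesis using X(3) by auto
    qed
    then show "\<exists>k. \<forall>z. (\<forall>i<k. z i = y i) \<longrightarrow> z \<in> W" by blast
  qed
next
  assume R: "\<forall>y\<in>W. \<exists>k. \<forall>z. (\<forall>i<k. z i = y i) \<longrightarrow> z \<in> W"
  show "open W"
  proof (subst openin_subopen[of euclidean W, simplified], intro ballI)
    fix y assume "y \<in> W"
    then obtain k where k: "\<And>z. (\<forall>i<k. z i = y i) \<Longrightarrow> z \<in> W" using R by blast
    have "open (Pi\<^sub>E UNIV (\<lambda>i. if i < k then {y i} else UNIV))"
      by (rule open_PiE) (auto intro: finite_subset[of _ "{..<k}"] simp: open_discrete)
    moreover have "y \<in> Pi\<^sub>E UNIV (\<lambda>i. if i < k then {y i} else UNIV)" by auto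
    moreover have "Pi\<^sub>E UNIV (\<lambda>i. if i < k then {y i} else UNIV) \<subseteq> W"
    proof
      fix z assume z: "z \<in> Pi\<^sub>E UNIV (\<lambda>i. if i < k then {y i} else UNIV)"
      have "z i = y i" if "i < k" for i
        using z that by (auto simp: PiE_iff dest: spec[of _ i])
      then show "z \<in> W" using k by blast
    qed
    ultimately show "\<exists>T. open T \<and> y \<in> T \<and> T \<subseteq> W" by blast
  qed
qed

lemma closed_baire_iff:
  fixes S :: "(nat \<Rightarrow> nat) set"
  shows "closed S \<longleftrightarrow> (\<forall>y. y \<notin> S \<longrightarrow> (\<exists>k. \<forall>z. (\<forall>i<k. z i = y i) \<longrightarrow> z \<notin> S))"
  unfolding closed_def open_baire_iff by auto

lemma continuous_map_baire_iff:
  fixes S :: "(nat \<Rightarrow> nat) set"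
  shows "continuous_map (top_of_set S) X f \<longleftrightarrow>
    f \<in> S \<rightarrow> topspace X \<and>
    (\<forall>W y. openin X W \<and> y \<in> S \<and> f y \<in> W \<longrightarrow>
       (\<exists>k. \<forall>z\<in>S. (\<forall>i<k. z i = y i) \<longrightarrow> f z \<in> W))" (is "?L \<longleftrightarrow> ?R")
proof
  assume L: ?L
  have "\<exists>k. \<forall>z\<in>S. (\<forall>i<k. z i = y i) \<longrightarrow> f z \<in> W" if W: "openin X W" "y \<in> S" "f y \<in> W" for W y
  proof -
    have "openin (top_of_set S) {x \<in> S. f x \<in> W}"
      using L W by (auto simp: continuous_map_def)
    then obtain V where V: "open V" "{x \<in> S. f x \<in> W} = S \<inter> V"
      by (auto simp: openin_open)
    then have "y \<in> V" using W by auto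
    then obtain k where "\<forall>z. (\<forall>i<k. z i = y i) \<longrightarrow> z \<in> V"
      using V(1) unfolding open_baire_iff by blast
    then show ?thesis using V(2) by blast
  qed
  then show ?R using L by (auto simp: continuous_map_def)
next
  assume R: ?R
  have "openin (top_of_set S) {x \<in> S. f x \<in> W}" if W: "openin X W" for W
  proof -
    \<comment> \<open>\<open>S\<close> need not be open, so an open set of the whole space with the
      right trace on \<open>S\<close> is wanted: the union of the prefix cylinders around points of
      \<open>S\<close> on which \<open>f\<close> maps \<open>S\<close> into
      \<open>W\<close>.\<close>
    define V where "V = {z. \<exists>y\<in>S. \<exists>k. f y \<in> W \<and> (\<forall>z\<in>S. (\<forall>i<k. z i = y i) \<longrightarrow> f z \<in> W) \<and> (\<forall>i<k. z i = y i)}"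
    have "open V"
      unfolding open_baire_iff V_def by (auto; metis)
    moreover have "{x \<in> S. f x \<in> W} = S \<inter> V"
    proof (intro equalityI subsetI)
      fix x assume "x \<in> {x \<in> S. f x \<in> W}"
      then show "x \<in> S \<inter> V" using R W unfolding V_def by blast
    next
      fix x assume "x \<in> S \<inter> V"
      then show "x \<in> {x \<in> S. f x \<in> W}" unfolding V_def by auto
    qed
    ultimately show ?thesis by (auto simp: openin_open)
  qed
  then show ?L using R by (auto simp: continuous_map_def)
qed

lemma closed_baireD:
  fixes S :: "(nat \<Rightarrow> nat) set"
  assumes "closed S" "y \<notin> S"
  obtains k where "\<And>z. (\<And>i. i < k \<Longrightarrow> z i = y i) \<Longrightarrow> z \<notin> S"
  using assms unfolding closed_baire_iff by blast

lemma continuous_map_baireD: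
  fixes S :: "(nat \<Rightarrow> nat) set"
  assumes "continuous_map (top_of_set S) X f" "openin X W" "y \<in> S" "f y \<in> W"
  shows "\<exists>k. \<forall>z\<in>S. (\<forall>i<k. z i = y i) \<longrightarrow> f z \<in> W"
proof -
  have "\<forall>W y. openin X W \<and> y \<in> S \<and> f y \<in> W \<longrightarrow>
      (\<exists>k. \<forall>z\<in>S. (\<forall>i<k. z i = y i) \<longrightarrow> f z \<in> W)"
    using assms(1) unfolding continuous_map_baire_iff by (rule conjunct2)
  from this[THEN spec, THEN spec, THEN mp, OF conjI, OF assms(2) conjI, OF assms(3,4)] show ?thesis .
qed

section \<open>Analytic sets and their closure properties\<close>

text \<open>Closed subsets of Baire space serve as domains rather than Baire space itself. The empty
  set is then no exception, and domains cut out by equations between continuous maps into a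
  Hausdorff space remain admissible.\<close>

definition analytic_in :: "'a topology \<Rightarrow> 'a set \<Rightarrow> bool" where
  "analytic_in X A \<longleftrightarrow>
     (\<exists>(S :: (nat \<Rightarrow> nat) set) f. closed S \<and> continuous_map (top_of_set S) X f \<and> A = f ` S)"

lemma analytic_in_subset_topspace: "analytic_in X A \<Longrightarrow> A \<subseteq> topspace X"
  unfolding analytic_in_def by (auto simp: continuous_map_def Pi_iff)

lemma analytic_in_empty [simp]: "analytic_in X {}"
proof -
  have "continuous_map (top_of_set ({} :: (nat \<Rightarrow> nat) set)) X (\<lambda>_. undefined)"
    by simp
  then show ?thesis unfolding analytic_in_def by (metis closed_empty image_empty)
qed

lemma analytic_in_continuous_map_image:
  assumes "analytic_in X A" "continuous_map X Y g"
  shows "analytic_in Y (g ` A)"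
proof -
  obtain S :: "(nat \<Rightarrow> nat) set" and f where "closed S" "continuous_map (top_of_set S) X f" "A = f ` S"
    using assms(1) unfolding analytic_in_def by blast
  then have "continuous_map (top_of_set S) Y (g \<circ> f)" "g ` A = (g \<circ> f) ` S"
    using assms(2) by (auto intro: continuous_map_compose)
  with \<open>closed S\<close> show ?thesis unfolding analytic_in_def by blast
qed

lemma analytic_in_Int_closedin:
  assumes "analytic_in X A" "closedin X C"
  shows "analytic_in X (A \<inter> C)"
proof -
  obtain S :: "(nat \<Rightarrow> nat) set" and f where S: "closed S" "continuous_map (top_of_set S) X f" "A = f ` S"
    using assms(1) unfolding analytic_in_def by blast
  have "closedin (top_of_set S) {y \<in> topspace (top_of_set S). f y \<in> C}"
    using S(2) assms(2) by (rule closedin_continuous_map_preimage)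
  then have "closed {y \<in> S. f y \<in> C}"
    using S(1) closedin_closed_trans by auto
  moreover have "continuous_map (top_of_set {y \<in> S. f y \<in> C}) X f"
    using S(2) by (rule continuous_map_from_subtopology_mono) auto
  moreover have "A \<inter> C = f ` {y \<in> S. f y \<in> C}" using S(3) by auto
  ultimately show ?thesis unfolding analytic_in_def by blast
qed

text \<open>The first coordinate chooses the index \<open>n\<close> and the tail is a parameter for
  \<open>A n\<close>. In this way the disjoint union of the closed domains becomes one closed subset
  of Baire space, since a prefix of length 1 already determines the index.\<close>

lemma analytic_in_UN:
  fixes A :: "nat \<Rightarrow> 'a set"
  assumes "\<And>n. analytic_in X (A n)"
  shows "analytic_in X (\<Union>n. A n)"
proof -
  obtain S f where S: "\<And>n. closed (S n :: (nat \<Rightarrow> nat) set)"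
      "\<And>n. continuous_map (top_of_set (S n)) X (f n)" "\<And>n. A n = f n ` S n"
    using assms unfolding analytic_in_def by metis
  define S' where "S' = {y :: nat \<Rightarrow> nat. (\<lambda>i. y (Suc i)) \<in> S (y 0)}"
  define g where "g y = f (y 0) (\<lambda>i. y (Suc i))" for y :: "nat \<Rightarrow> nat"
  have "closed S'"
    unfolding closed_baire_iff
  proof (intro allI impI)
    fix y assume "y \<notin> S'"
    then obtain k where k: "\<And>z. (\<And>i. i < k \<Longrightarrow> z i = y (Suc i)) \<Longrightarrow> z \<notin> S (y 0)"
      using closed_baireD[OF S(1)[of "y 0"], of "\<lambda>i. y (Suc i)"] unfolding S'_def by blast
    have "z \<notin> S'" if "\<forall>i<Suc k. z i = y i" for z
    proof -
      have "z 0 = y 0" "\<forall>i<k. z (Suc i) = y (Suc i)" using that by auto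
      then show ?thesis using k[of "\<lambda>i. z (Suc i)"] by (simp add: S'_def)
    qed
    then show "\<exists>k. \<forall>z. (\<forall>i<k. z i = y i) \<longrightarrow> z \<notin> S'" by blast
  qed
  moreover have "continuous_map (top_of_set S') X g"
    unfolding continuous_map_baire_iff
  proof (intro conjI allI impI)
    show "g \<in> S' \<rightarrow> topspace X"
      using S(2) by (auto simp: S'_def g_def continuous_map_def Pi_iff)
    fix W y assume W: "openin X W \<and> y \<in> S' \<and> g y \<in> W"
    then have "(\<lambda>i. y (Suc i)) \<in> S (y 0)" "f (y 0) (\<lambda>i. y (Suc i)) \<in> W" "openin X W"
      by (auto simp: S'_def g_def)
    from continuous_map_baireD[OF S(2)[of "y 0"], OF this(3,1,2)]
    obtain k where k: "\<forall>z\<in>S (y 0). (\<forall>i<k. z i = y (Suc i)) \<longrightarrow> f (y 0) z \<in> W"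
      by (rule exE)
    have "g z \<in> W" if "z \<in> S'" "\<forall>i<Suc k. z i = y i" for z
    proof -
      have "z 0 = y 0" "\<forall>i<k. z (Suc i) = y (Suc i)" using that by auto
      then show ?thesis using k[rule_format, of "\<lambda>i. z (Suc i)"] that(1) by (simp add: S'_def g_def)
    qed
    then show "\<exists>k. \<forall>z\<in>S'. (\<forall>i<k. z i = y i) \<longrightarrow> g z \<in> W" by blast
  qed
  moreover have "(\<Union>n. A n) = g ` S'"
  proof (intro equalityI subsetI)
    fix x assume "x \<in> (\<Union>n. A n)"
    then obtain n z where "z \<in> S n" "x = f n z" using S(3) by auto
    then have "x = g (case_nat n z)" "case_nat n z \<in> S'" by (auto simp: g_def S'_def)
    then show "x \<in> g ` S'" by blast
  next
    fix x assume "x \<in> g ` S'"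
    then show "x \<in> (\<Union>n. A n)" using S(3) by (auto simp: g_def S'_def)
  qed
  ultimately show ?thesis unfolding analytic_in_def by blast
qed

lemma analytic_in_Un:
  assumes "analytic_in X A" "analytic_in X B"
  shows "analytic_in X (A \<union> B)"
proof -
  have "(\<Union>n::nat. if n = 0 then A else B) = A \<union> B" by (force split: if_splits)
  then show ?thesis
    using analytic_in_UN[of X "\<lambda>n. if n = 0 then A else B"] assms by auto
qed

text \<open>Gives continuity of reading off row \<open>n\<close> from a coded double sequence:
  finitely many entries of the row depend only on a finite prefix of the code.\<close>

lemma ex_bound_prod_encode: "\<exists>K. \<forall>i<k. prod_encode (n, i) < K"
  by (intro exI[of _ "Suc (Max ((\<lambda>i. prod_encode (n, i)) ` {..<k}))"]) (auto simp: less_Suc_eq_le)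

text \<open>One sequence codes a parameter for every \<open>A n\<close> at once, and the domain is
  the fibre product: the tuples whose images all coincide. A failure of membership in
  \<open>S n\<close> shows on a finite prefix, and so does a difference of two images, because
  distinct points of a Hausdorff space have disjoint neighbourhoods. Hence the domain is
  closed.\<close>

lemma analytic_in_INT:
  fixes A :: "nat \<Rightarrow> 'a set"
  assumes X: "Hausdorff_space X" and "\<And>n. analytic_in X (A n)"
  shows "analytic_in X (\<Inter>n. A n)"
proof -
  obtain S f where S: "\<And>n. closed (S n :: (nat \<Rightarrow> nat) set)"
      "\<And>n. continuous_map (top_of_set (S n)) X (f n)" "\<And>n. A n = f n ` S n"
    using assms unfolding analytic_in_def by metis
  define r where "r n y = (\<lambda>i. y (prod_encode (n, i)) :: nat)" for n y
  have r: "\<exists>K. \<forall>z. (\<forall>i<K. z i = y i) \<longrightarrow> (\<forall>i<k. r n z i = r n y i)" for n y k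
    using ex_bound_prod_encode[of k n] unfolding r_def by metis
  have nb: "\<exists>K. \<forall>z. (\<forall>i<K. z i = y i) \<longrightarrow> r n z \<in> S n \<longrightarrow> f n (r n z) \<in> W"
    if W: "openin X W" "r n y \<in> S n" "f n (r n y) \<in> W" for n y W
  proof -
    obtain k where k: "\<forall>z\<in>S n. (\<forall>i<k. z i = r n y i) \<longrightarrow> f n z \<in> W"
      using continuous_map_baireD[OF S(2)[of n], OF W] by (rule exE)
    obtain K where K: "\<forall>z. (\<forall>i<K. z i = y i) \<longrightarrow> (\<forall>i<k. r n z i = r n y i)"
      using r[where n = n and y = y and k = k] by (rule exE)
    have "f n (r n z) \<in> W" if z: "\<forall>i<K. z i = y i" "r n z \<in> S n" for z
      using bspec[OF k z(2)] K[THEN spec, THEN mp, OF z(1)] by (rule mp)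
    then show ?thesis by (intro exI allI impI)
  qed
  define S' where "S' = {y. \<forall>n. r n y \<in> S n \<and> f n (r n y) = f 0 (r 0 y)}"
  have "closed S'"
    unfolding closed_baire_iff
  proof (intro allI impI)
    fix y assume "y \<notin> S'"
    show "\<exists>k. \<forall>z. (\<forall>i<k. z i = y i) \<longrightarrow> z \<notin> S'"
    proof (cases "\<forall>n. r n y \<in> S n")
      case False
      then obtain n where n: "r n y \<notin> S n" by blast
      then obtain k where k: "\<And>z. (\<And>i. i < k \<Longrightarrow> z i = r n y i) \<Longrightarrow> z \<notin> S n"
        using closed_baireD[OF S(1)] by blast
      obtain K where "\<forall>z. (\<forall>i<K. z i = y i) \<longrightarrow> (\<forall>i<k. r n z i = r n y i)"
          using r[where n = n and y = y and k = k] by (rule exE)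
      then have "\<forall>z. (\<forall>i<K. z i = y i) \<longrightarrow> z \<notin> S'" using k unfolding S'_def by blast
      then show ?thesis by blast
    next
      case True
      with \<open>y \<notin> S'\<close> obtain n where n: "f n (r n y) \<noteq> f 0 (r 0 y)"
        unfolding S'_def by blast
      have "f n (r n y) \<in> topspace X" "f 0 (r 0 y) \<in> topspace X"
        using True S(2) by (auto simp: continuous_map_def Pi_iff)
      then obtain W W' where W: "openin X W" "openin X W'" "f n (r n y) \<in> W" "f 0 (r 0 y) \<in> W'" "disjnt W W'"
        using X n unfolding Hausdorff_space_def by meson
      obtain K where K: "\<forall>z. (\<forall>i<K. z i = y i) \<longrightarrow> r n z \<in> S n \<longrightarrow> f n (r n z) \<in> W"
        using nb[of W n y, OF W(1) True[rule_format] W(3)] by (rule exE)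
      obtain K' where K': "\<forall>z. (\<forall>i<K'. z i = y i) \<longrightarrow> r 0 z \<in> S 0 \<longrightarrow> f 0 (r 0 z) \<in> W'"
        using nb[of W' 0 y, OF W(2) True[rule_format] W(4)] by (rule exE)
      have "z \<notin> S'" if "\<forall>i<max K K'. z i = y i" for z
      proof
        assume "z \<in> S'"
        then have "r n z \<in> S n" "r 0 z \<in> S 0" "f n (r n z) = f 0 (r 0 z)" unfolding S'_def by blast+
        then show False using K[rule_format, of z] K'[rule_format, of z] that W(5) by (auto simp: disjnt_iff)
      qed
      then show ?thesis by blast
    qed
  qed
  moreover have "continuous_map (top_of_set S') X (\<lambda>y. f 0 (r 0 y))"
    unfolding continuous_map_baire_iff
  proof (intro conjI allI impI)
    show "(\<lambda>y. f 0 (r 0 y)) \<in> S' \<rightarrow> topspace X"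
      using S(2) by (auto simp: S'_def continuous_map_def Pi_iff)
    fix W y assume "openin X W \<and> y \<in> S' \<and> f 0 (r 0 y) \<in> W"
    then have "openin X W" "r 0 y \<in> S 0" "f 0 (r 0 y) \<in> W" unfolding S'_def by blast+
    from nb[OF this] show "\<exists>k. \<forall>z\<in>S'. (\<forall>i<k. z i = y i) \<longrightarrow> f 0 (r 0 z) \<in> W"
      unfolding S'_def by blast
  qed
  moreover have "(\<Inter>n. A n) = (\<lambda>y. f 0 (r 0 y)) ` S'"
  proof (intro equalityI subsetI)
    fix x assume "x \<in> (\<Inter>n. A n)"
    then have "\<forall>n. \<exists>z. z \<in> S n \<and> x = f n z" using S(3) by blast
    then obtain z where z: "\<And>n. z n \<in> S n" "\<And>n. x = f n (z n)" by metis
    define y where "y j = (case prod_decode j of (n, i) \<Rightarrow> z n i)" for j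
    have y: "r n y = z n" for n by (auto simp: r_def y_def)
    then have "y \<in> S'" using z(1) by (simp add: S'_def z(2)[symmetric])
    then show "x \<in> (\<lambda>y. f 0 (r 0 y)) ` S'"
      using z(2)[of 0] by (intro image_eqI[of _ _ y]) (simp_all add: y)
  next
    fix x assume "x \<in> (\<lambda>y. f 0 (r 0 y)) ` S'"
    then obtain y where y: "x = f 0 (r 0 y)" "y \<in> S'" by blast
    have *: "r n y \<in> S n \<and> f n (r n y) = f 0 (r 0 y)" for n
      using y(2) unfolding S'_def mem_Collect_eq by (rule spec)
    have "x \<in> A n" for n
      unfolding S(3) by (rule image_eqI[OF _ conjunct1[OF *]]) (rule trans[OF y(1) conjunct2[OF *, symmetric]])
    then show "x \<in> (\<Inter>n. A n)" by blast
  qed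
  ultimately show ?thesis unfolding analytic_in_def by blast
qed

lemma analytic_in_Int:
  assumes "Hausdorff_space X" "analytic_in X A" "analytic_in X B"
  shows "analytic_in X (A \<inter> B)"
proof -
  have "(\<Inter>n::nat. if n = 0 then A else B) = A \<inter> B" by (force split: if_splits)
  then show ?thesis
    using analytic_in_INT[of X "\<lambda>n. if n = 0 then A else B"] assms by auto
qed

lemma analytic_in_Times:
  assumes "analytic_in X A" "analytic_in Y B"
  shows "analytic_in (prod_topology X Y) (A \<times> B)"
proof -
  obtain S :: "(nat \<Rightarrow> nat) set" and f where S: "closed S" "continuous_map (top_of_set S) X f" "A = f ` S"
    using assms(1) unfolding analytic_in_def by blast
  obtain T :: "(nat \<Rightarrow> nat) set" and g where T: "closed T" "continuous_map (top_of_set T) Y g" "B = g ` T"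
    using assms(2) unfolding analytic_in_def by blast
  \<comment> \<open>Even and odd entries of one sequence carry the two parameters.\<close>
  define e where "e y = (\<lambda>i. y (2 * i) :: nat)" for y :: "nat \<Rightarrow> nat"
  define d where "d y = (\<lambda>i. y (2 * i + 1) :: nat)" for y :: "nat \<Rightarrow> nat"
  define S' where "S' = {y. e y \<in> S \<and> d y \<in> T}"
  have e: "continuous_on UNIV e" and d: "continuous_on UNIV d"
    unfolding e_def d_def
    by (intro continuous_on_coordinatewise_then_product continuous_on_product_coordinates)+
  have "S' = e -` S \<inter> d -` T" unfolding S'_def by auto
  then have "closed S'"
    using closed_vimage[OF S(1) e] closed_vimage[OF T(1) d] by auto
  moreover have "continuous_map (top_of_set S') (prod_topology X Y) (\<lambda>y. (f (e y), g (d y)))"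
  proof -
    have "continuous_map (top_of_set S') (top_of_set S) e"
         "continuous_map (top_of_set S') (top_of_set T) d"
      using e d by (auto simp: S'_def intro: continuous_on_subset)
    from this(1)[THEN continuous_map_compose, OF S(2)] this(2)[THEN continuous_map_compose, OF T(2)]
    show ?thesis by (simp add: continuous_map_paired comp_def)
  qed
  moreover have "A \<times> B = (\<lambda>y. (f (e y), g (d y))) ` S'"
  proof (intro equalityI subsetI)
    fix p assume "p \<in> A \<times> B"
    then obtain s t where st: "p = (f s, g t)" "s \<in> S" "t \<in> T" using S(3) T(3) by auto
    define y where "y i = (if even i then s (i div 2) else t (i div 2))" for i
    have "e y = s" "d y = t" by (auto simp: e_def d_def y_def)
    then show "p \<in> (\<lambda>y. (f (e y), g (d y))) ` S'" using st by (force simp: S'_def)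
  qed (auto simp: S'_def S(3) T(3))
  ultimately show ?thesis unfolding analytic_in_def by blast
qed


section \<open>Polish spaces and their Borel sets are analytic\<close>

text \<open>A point is named by a sequence of indices into a countable dense set that converges to
  it at a prescribed rate. The rate is a condition on two entries at a time, so the set of names is
  closed; and entry \<open>k\<close> fixes the limit up to 2 * (1/2)^k, so the limit map is
  continuous.\<close>

lemma polish_space_imp_analytic_in:
  assumes "polish_space X"
  shows "analytic_in X (topspace X)"
proof (cases "topspace X = {}")
  case False
  obtain M d where md: "Metric_space M d" "Metric_space.mcomplete M d" and X: "X = Metric_space.mtopology M d"
    using assms unfolding polish_space_def completely_metrizable_space_def by blast
  interpret Metric_space M d by (rule md)
  obtain C where C: "countable C" "C \<subseteq> M" "mtopology closure_of C = M"
    using assms unfolding polish_space_def separable_space_def X by auto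
  have "C \<noteq> {}" using C(3) False X by auto
  define a where "a = from_nat_into C"
  have a: "a n \<in> M" for n using from_nat_into[OF \<open>C \<noteq> {}\<close>] C(2) by (auto simp: a_def)
  have dense: "\<exists>n. d (a n) x < e" if "x \<in> M" "e > 0" for x e
  proof -
    have "x \<in> mtopology closure_of C" using that C(3) by simp
    then obtain c where c: "c \<in> C" "c \<in> mball x e"
      using \<open>e > 0\<close> unfolding metric_closure_of by blast
    obtain n where "c = a n"
      using c(1) C(1) unfolding a_def by (metis from_nat_into_to_nat_on)
    then show ?thesis using c by (auto simp: commute)
  qed
  define S where "S = {y. \<forall>k m. k \<le> m \<longrightarrow> d (a (y k)) (a (y m)) \<le> (1/2)^k}"
  have "closed S"
    unfolding closed_baire_iff
  proof (intro allI impI)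
    fix y assume "y \<notin> S"
    then obtain k m where km: "k \<le> m" "\<not> d (a (y k)) (a (y m)) \<le> (1/2)^k" by (auto simp: S_def)
    have "z \<notin> S" if z: "\<forall>i<Suc m. z i = y i" for z
    proof -
      have "z k = y k" "z m = y m" using z km(1) by auto
      then have "\<not> d (a (z k)) (a (z m)) \<le> (1/2)^k" using km(2) by simp
      then show ?thesis using km(1) unfolding S_def by blast
    qed
    then show "\<exists>k. \<forall>z. (\<forall>i<k. z i = y i) \<longrightarrow> z \<notin> S" by blast
  qed
  have "\<exists>l. limitin mtopology (\<lambda>k. a (y k)) l sequentially" if y: "y \<in> S" for y
  proof -
    have "MCauchy (\<lambda>k. a (y k))"
      unfolding MCauchy_def
    proof (intro conjI allI impI)
      show "range (\<lambda>k. a (y k)) \<subseteq> M" using a by auto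
      fix e :: real assume "e > 0"
      then obtain N where N: "(1/2)^N < e / 2" using real_arch_pow_inv[of "e/2" "1/2"] by auto
      have "d (a (y n)) (a (y n')) < e" if "N \<le> n" "N \<le> n'" for n n'
      proof -
        have "d (a (y N)) (a (y n)) \<le> (1/2)^N" "d (a (y N)) (a (y n')) \<le> (1/2)^N"
          using y that by (auto simp: S_def)
        then show ?thesis
          using triangle[of "a (y n)" "a (y N)" "a (y n')", OF a a a] N commute[of "a (y n)" "a (y N)"] by linarith
      qed
      then show "\<exists>N. \<forall>n n'. N \<le> n \<longrightarrow> N \<le> n' \<longrightarrow> d (a (y n)) (a (y n')) < e" by blast
    qed
    then show ?thesis using md(2) by (auto simp: mcomplete_def)
  qed
  then obtain f where f: "\<And>y. y \<in> S \<Longrightarrow> limitin mtopology (\<lambda>k. a (y k)) (f y) sequentially" by metis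
  have fM: "f y \<in> M" if "y \<in> S" for y
    using f[OF that] by (simp add: limitin_metric)
  \<comment> \<open>One (1/2)^k bounds the distance to a far entry, by definition of
    \<open>S\<close>; the other bounds the distance from that entry to the limit.\<close>
  have bound: "d (a (y k)) (f y) \<le> 2 * (1/2)^k" if y: "y \<in> S" for y k
  proof -
    have "\<forall>\<^sub>F n in sequentially. d (a (y n)) (f y) < (1/2)^k"
      using f[OF y] unfolding limitin_metric by (auto elim!: allE[of _ "(1/2)^k"] eventually_mono)
    then obtain n where n: "n \<ge> k" "d (a (y n)) (f y) < (1/2)^k"
      unfolding eventually_sequentially by (metis nle_le)
    have "d (a (y k)) (a (y n)) \<le> (1/2)^k" using y n(1) by (simp add: S_def)
    then show ?thesis
      using triangle[OF a a fM[OF y], of "y k" "y n"] n(2) by linarith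
  qed
  have "continuous_map (top_of_set S) X f"
    unfolding continuous_map_baire_iff
  proof (intro conjI allI impI)
    show "f \<in> S \<rightarrow> topspace X" using fM X by auto
    fix W y assume W: "openin X W \<and> y \<in> S \<and> f y \<in> W"
    then have y: "y \<in> S" by blast
    from W obtain r where r: "r > 0" "mball (f y) r \<subseteq> W"
      unfolding X openin_mtopology by blast
    \<comment> \<open>Two names that share entry \<open>k\<close> have limits at distance at most 4
      * (1/2)^k.\<close>
    then obtain k where k: "(1/2)^k < r / 4" using real_arch_pow_inv[of "r/4" "1/2"] by auto
    have "f z \<in> W" if z: "z \<in> S" "\<forall>i<Suc k. z i = y i" for z
    proof -
      have "z k = y k" using z by simp
      then have "d (f y) (f z) < r"
        using bound[OF y, of k] bound[OF z(1), of k] k commute[of "f y" "a (y k)"]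
          triangle[OF fM[OF y] a fM[OF z(1)], of "y k"] by simp
      then show ?thesis using r(2) fM[OF y] fM[OF z(1)] by auto
    qed
    then show "\<exists>k. \<forall>z\<in>S. (\<forall>i<k. z i = y i) \<longrightarrow> f z \<in> W" by blast
  qed
  moreover have "topspace X = f ` S"
  proof (intro equalityI subsetI)
    fix x assume "x \<in> topspace X"
    then have x: "x \<in> M" by (simp add: X)
    \<comment> \<open>The extra factor 1/2 leaves room for the triangle inequality through
      \<open>x\<close>, which then gives the rate required by \<open>S\<close>.\<close>
    have "\<exists>n. d (a n) x < (1/2)^k / 2" for k by (rule dense[OF x]) simp
    then obtain y where y: "\<And>k. d (a (y k)) x < (1/2)^k / 2" by metis
    have "y \<in> S"
      unfolding S_def
    proof (intro CollectI allI impI)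
      fix k m :: nat assume "k \<le> m"
      then have "(1/2::real)^m \<le> (1/2)^k" by (simp add: power_decreasing)
      then show "d (a (y k)) (a (y m)) \<le> (1/2)^k"
        using triangle[OF a x a, of "y k" "y m"] y[of k] y[of m] commute[of x "a (y m)"] by linarith
    qed
    moreover have "x = f y"
    proof (rule ccontr)
      assume "x \<noteq> f y"
      then have "d x (f y) > 0" using x fM[OF \<open>y \<in> S\<close>] by simp
      then obtain k where k: "(1/2)^k < d x (f y) / 4"
        using real_arch_pow_inv[of "d x (f y)/4" "1/2"] by auto
      have "(1/2::real)^k > 0" by simp
      then show False
        using triangle[OF x a fM[OF \<open>y \<in> S\<close>], of "y k"] y[of k] bound[OF \<open>y \<in> S\<close>, of k] k
          commute[of x "a (y k)"] by linarith
    qed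
    ultimately show "x \<in> f ` S" by blast
  qed (use fM X in auto)
  ultimately show ?thesis using \<open>closed S\<close> unfolding analytic_in_def by blast
qed simp

lemma polish_space_imp_metrizable: "polish_space X \<Longrightarrow> metrizable_space X"
  by (simp add: polish_space_def completely_metrizable_imp_metrizable_space)

lemma polish_space_imp_Hausdorff: "polish_space X \<Longrightarrow> Hausdorff_space X"
  by (simp add: polish_space_imp_metrizable metrizable_imp_Hausdorff_space)

lemma polish_space_prod_topology:
  assumes "polish_space X" "polish_space Y"
  shows "polish_space (prod_topology X Y)"
proof -
  obtain C D where "countable C" "C \<subseteq> topspace X" "X closure_of C = topspace X"
     "countable D" "D \<subseteq> topspace Y" "Y closure_of D = topspace Y"
    using assms unfolding polish_space_def separable_space_def by blast
  then have "separable_space (prod_topology X Y)"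
    unfolding separable_space_def
    by (intro exI[of _ "C \<times> D"]) (auto simp: closure_of_Times)
  then show ?thesis
    using assms by (simp add: polish_space_def completely_metrizable_space_prod_topology)
qed

lemma polish_space_openin:
  assumes "polish_space X" "openin X W"
  shows "polish_space (subtopology X W)"
  using assms
  by (simp add: polish_space_def completely_metrizable_space_openin separable_space_open_subset)

lemma sets_borel_of_topology: "sets (borel_of_topology X) = sigma_sets (topspace X) {S. openin X S}"
  unfolding borel_of_topology_def by (rule sets_measure_of) (auto dest: openin_subset)

lemma space_borel_of_topology [simp]: "space (borel_of_topology X) = topspace X"
  unfolding borel_of_topology_def by (rule space_measure_of) (auto dest: openin_subset)

lemma openin_sets_borel_of_topology: "openin X S \<Longrightarrow> S \<in> sets (borel_of_topology X)"
  by (auto simp: sets_borel_of_topology)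

lemma continuous_map_imp_measurable:
  assumes "continuous_map X Y f"
  shows "f \<in> borel_of_topology X \<rightarrow>\<^sub>M borel_of_topology Y"
  unfolding borel_of_topology_def[of Y]
proof (rule measurable_measure_of)
  show "{S. openin Y S} \<subseteq> Pow (topspace Y)" by (auto dest: openin_subset)
  show "f \<in> space (borel_of_topology X) \<rightarrow> topspace Y"
    using assms by (auto simp: continuous_map_def)
  fix S assume "S \<in> {S. openin Y S}"
  then have "openin X {x \<in> topspace X. f x \<in> S}" using assms by (auto simp: continuous_map_def)
  moreover have "f -` S \<inter> space (borel_of_topology X) = {x \<in> topspace X. f x \<in> S}" by auto
  ultimately show "f -` S \<inter> space (borel_of_topology X) \<in> sets (borel_of_topology X)"
    by (simp add: openin_sets_borel_of_topology)
qed

text \<open>Analytic sets are not closed under complements in general, so the induction over the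
  generation of the \<sigma>-algebra carries the complement along, and the complement step merely
  swaps the two. Open sets are analytic because they are Polish themselves.\<close>

lemma borel_imp_analytic_in:
  assumes X: "polish_space X" and A: "A \<in> sets (borel_of_topology X)"
  shows "analytic_in X A"
proof -
  have H: "Hausdorff_space X" by (rule polish_space_imp_Hausdorff[OF X])
  have op: "analytic_in X W" if W: "openin X W" for W
  proof -
    have "analytic_in (subtopology X W) (topspace (subtopology X W))"
      using polish_space_openin[OF X W] by (rule polish_space_imp_analytic_in)
    then have "analytic_in X (id ` topspace (subtopology X W))"
      by (rule analytic_in_continuous_map_image) (simp add: continuous_map_from_subtopology)
    then show ?thesis using openin_subset[OF W] by (simp add: Int_absorb1)
  qed
  have "A \<in> sigma_sets (topspace X) {S. openin X S}"
    using A by (simp add: sets_borel_of_topology)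
  then have "analytic_in X A \<and> analytic_in X (topspace X - A)"
  proof induction
    case (Basic a)
    have "analytic_in X (topspace X \<inter> (topspace X - a))"
      using Basic by (intro analytic_in_Int_closedin polish_space_imp_analytic_in[OF X]) auto
    then show ?case using Basic op by (simp add: Int_absorb1)
  next
    case Empty
    then show ?case using X by (simp add: polish_space_imp_analytic_in)
  next
    case (Compl a)
    then show ?case using analytic_in_subset_topspace[of X a] by (simp add: double_diff)
  next
    case (Union a)
    have "topspace X - (\<Union>i. a i) = (\<Inter>i. topspace X - a i)" by auto
    moreover have "analytic_in X (\<Inter>i. topspace X - a i)"
      using Union by (intro analytic_in_INT[OF H]) blast
    ultimately show ?case using Union by (auto intro: analytic_in_UN)
  qed
  then show ?thesis ..
qed

section \<open>The separation theorems of Novikov and Lusin\<close>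

text \<open>If separation fails, it still fails after splitting one of the sets into countably many
  pieces and keeping a suitable piece. Splitting by the coordinates of the parameters one after
  another leads in the limit to one parameter \<open>y n\<close> for each set. The points
  \<open>f n (y n)\<close> cannot all be equal, as the intersection is empty; two different ones
  have disjoint neighbourhoods, and these separate the pieces already at a finite stage.\<close>

lemma novikov_separation:
  fixes A :: "nat \<Rightarrow> 'a set"
  assumes H: "Hausdorff_space X" and A: "\<And>n. analytic_in X (A n)" and empty: "(\<Inter>n. A n) = {}"
  shows "\<exists>B. (\<forall>n. B n \<in> sets (borel_of_topology X) \<and> A n \<subseteq> B n) \<and> (\<Inter>n. B n) = {}"
proof -
  obtain S f where S: "\<And>n. closed (S n :: (nat \<Rightarrow> nat) set)"
      "\<And>n. continuous_map (top_of_set (S n)) X (f n)" "\<And>n. A n = f n ` S n"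
    using A unfolding analytic_in_def by metis
  define sep where "sep P \<longleftrightarrow> (\<exists>B. (\<forall>n. B n \<in> sets (borel_of_topology X) \<and> P n \<subseteq> B n) \<and> (\<Inter>n. B n) = {})"
    for P :: "nat \<Rightarrow> 'a set"
  have top: "topspace X \<in> sets (borel_of_topology X)"
    by (rule openin_sets_borel_of_topology) simp
  \<comment> \<open>Given separators for every piece of slot \<open>k\<close>, unite them in that
    slot and intersect them in all others.\<close>
  have sep_split: "sep P" if P: "\<And>i. sep (P(k := Q i))" "P k = (\<Union>i. Q i)" for P k and Q :: "nat \<Rightarrow> 'a set"
  proof -
    obtain B where B: "\<And>i n. B i n \<in> sets (borel_of_topology X)" "\<And>i n. (P(k := Q i)) n \<subseteq> B i n"
        "\<And>i. (\<Inter>n. B i n) = {}"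
      using P(1) unfolding sep_def by metis
    define B' where "B' n = (if n = k then \<Union>i. B i k else \<Inter>i. B i n)" for n
    have "B' n \<in> sets (borel_of_topology X)" for n
      unfolding B'_def using B(1) by (auto intro!: sets.countable_UN sets.countable_INT)
    moreover have "P n \<subseteq> B' n" for n
    proof (cases "n = k")
      case True
      then show ?thesis using B(2)[of _ k] P(2) unfolding B'_def by fastforce
    next
      case False
      then show ?thesis using B(2)[of _ n] unfolding B'_def by auto
    qed
    moreover have "(\<Inter>n. B' n) = {}"
    proof (rule ccontr)
      assume "(\<Inter>n. B' n) \<noteq> {}"
      then obtain x where x: "\<And>n. x \<in> B' n" by blast
      then obtain i where "x \<in> B i k" using x[of k] unfolding B'_def by auto
      moreover have "x \<in> B i n" if "n \<noteq> k" for n using x[of n] that unfolding B'_def by auto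
      ultimately have "x \<in> B i n" for n by (cases "n = k") auto
      then have "x \<in> (\<Inter>n. B i n)" by blast
      then show False using B(3) by blast
    qed
    ultimately show ?thesis unfolding sep_def by blast
  qed
  \<comment> \<open>Nonseparability survives fixing one coordinate of one of the parametrizing sequences. The
     coordinates \<open>i\<close> of all sequences \<open>n\<close> are fixed in the order of \<open>prod_encode (n, i)\<close>.\<close>
  define cyl where "cyl j x n = {z \<in> S n. \<forall>i. prod_encode (n, i) < j \<longrightarrow> z i = x (prod_encode (n, i))}"
    for j and x :: "nat \<Rightarrow> nat" and n
  define bad where "bad j x \<longleftrightarrow> \<not> sep (\<lambda>n. f n ` cyl j x n)" for j x
  have cyl_cong: "cyl j x = cyl j x'" if "\<And>i. i < j \<Longrightarrow> x i = x' i" for j x x'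
    unfolding cyl_def using that by (intro ext) auto
  have step: "\<exists>v. bad (Suc j) (x(j := v))" if bad: "bad j x" for j x
  proof (rule ccontr)
    assume no: "\<nexists>v. bad (Suc j) (x(j := v))"
    obtain k l where kl: "j = prod_encode (k, l)" by (metis prod_decode_inverse surj_pair)
    have cyl_k: "cyl j x k = (\<Union>v. cyl (Suc j) (x(j := v)) k)"
    proof (intro equalityI subsetI)
      fix z assume "z \<in> cyl j x k"
      then have "z \<in> cyl (Suc j) (x(j := z l)) k"
        unfolding cyl_def by (auto simp: kl less_Suc_eq)
      then show "z \<in> (\<Union>v. cyl (Suc j) (x(j := v)) k)" by blast
    next
      fix z assume "z \<in> (\<Union>v. cyl (Suc j) (x(j := v)) k)"
      then show "z \<in> cyl j x k" unfolding cyl_def by (auto simp: less_Suc_eq split: if_splits)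
    qed
    have cyl_n: "cyl (Suc j) (x(j := v)) n = cyl j x n" if "n \<noteq> k" for n v
      using that unfolding cyl_def by (auto simp: kl less_Suc_eq)
    have "sep ((\<lambda>n. f n ` cyl j x n)(k := f k ` cyl (Suc j) (x(j := v)) k))" for v
    proof -
      have "(\<lambda>n. f n ` cyl j x n)(k := f k ` cyl (Suc j) (x(j := v)) k) = (\<lambda>n. f n ` cyl (Suc j) (x(j := v)) n)"
        by (rule ext) (simp add: cyl_n)
      then show ?thesis using no unfolding bad_def by simp
    qed
    then have "sep (\<lambda>n. f n ` cyl j x n)"
      by (rule sep_split) (simp add: cyl_k image_UN)
    then show False using bad unfolding bad_def by simp
  qed
  have "sep A"
  proof (rule ccontr)
    assume "\<not> sep A"
    have bad0: "bad 0 x" for x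
    proof -
      have "(\<lambda>n. f n ` cyl 0 x n) = A" using S(3) by (auto simp: cyl_def)
      then show ?thesis using \<open>\<not> sep A\<close> unfolding bad_def by simp
    qed
    define nxt where "nxt j x = x(j := SOME v. bad (Suc j) (x(j := v)))" for j x
    define g where "g j = rec_nat (\<lambda>_. 0) nxt j" for j
    have g: "g 0 = (\<lambda>_. 0)" "g (Suc j) = nxt j (g j)" for j by (simp_all add: g_def)
    have bad: "bad j (g j)" for j
    proof (induction j)
      case (Suc j)
      then show ?case unfolding g nxt_def by (rule someI_ex[OF step])
    qed (simp add: bad0)
    \<comment> \<open>Stage \<open>Suc j\<close> fixes coordinate \<open>j\<close> and later stages
      leave it alone, so the diagonal collects the limit.\<close>
    define x where "x j = g (Suc j) j" for j
    have "g (j + m) i = g j i" if "i < j" for i j m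
      using that by (induction m) (auto simp: g nxt_def)
    then have gx: "g j i = x i" if "i < j" for i j
      unfolding x_def using that by (metis Suc_leI le_add_diff_inverse lessI)
    then have bad: "bad j x" for j
      using bad[of j] cyl_cong[of j "g j" x] unfolding bad_def by metis
    define y where "y n i = x (prod_encode (n, i))" for n i
    have nsep: "\<not> (\<forall>n. f n ` cyl j x n \<subseteq> B n)"
      if "\<And>n. B n \<in> sets (borel_of_topology X)" "(\<Inter>n. B n) = {}" for j B
      using bad[of j] that unfolding bad_def sep_def by blast
    have cyl_near: "\<exists>j. \<forall>j'\<ge>j. \<forall>z \<in> cyl j' x n. \<forall>i<k. z i = y n i" for n k
    proof -
      obtain K where "\<forall>i<k. prod_encode (n, i) < K" using ex_bound_prod_encode by blast
      then show ?thesis unfolding cyl_def y_def by (intro exI[of _ K]) auto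
    qed
    have cylS: "cyl j x n \<subseteq> S n" for j n unfolding cyl_def by blast
    have ftop: "f n ` cyl j x n \<subseteq> topspace X" for j n
      using S(2)[of n] cylS[of j n] by (auto simp: continuous_map_def Pi_iff)
    \<comment> \<open>Otherwise closedness of \<open>S n\<close> makes the \<open>n\<close>-th piece
      empty at a finite stage, and the family with the empty set in slot \<open>n\<close> and the
      whole space elsewhere separates.\<close>
    have yS: "y n \<in> S n" for n
    proof (rule ccontr)
      assume "y n \<notin> S n"
      then obtain k where k: "\<And>z. (\<And>i. i < k \<Longrightarrow> z i = y n i) \<Longrightarrow> z \<notin> S n"
        using closed_baireD[OF S(1)[of n]] by blast
      obtain j where j: "\<forall>z \<in> cyl j x n. \<forall>i<k. z i = y n i" using cyl_near by blast
      then have "cyl j x n = {}" using k cylS by blast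
      then have "\<forall>m. f m ` cyl j x m \<subseteq> (if m = n then {} else topspace X)"
        using ftop by auto
      moreover have "(\<Inter>m. if m = n then {} else topspace X) = {}" by auto
      ultimately show False using nsep[of "\<lambda>m. if m = n then {} else topspace X" j] top by auto
    qed
    have "\<not> (\<forall>n. f n (y n) = f 0 (y 0))"
    proof
      assume eq: "\<forall>n. f n (y n) = f 0 (y 0)"
      have "f 0 (y 0) \<in> A n" for n
        using yS[of n] S(3)[of n] eq by (metis image_eqI)
      then show False using empty by blast
    qed
    then obtain n where n: "f n (y n) \<noteq> f 0 (y 0)" by blast
    have "f n (y n) \<in> topspace X" "f 0 (y 0) \<in> topspace X"
      using yS S(2) by (auto simp: continuous_map_def Pi_iff)
    then obtain W W' where W: "openin X W" "openin X W'" "f n (y n) \<in> W" "f 0 (y 0) \<in> W'" "disjnt W W'"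
      using H n unfolding Hausdorff_space_def by meson
    obtain k where k: "\<forall>z\<in>S n. (\<forall>i<k. z i = y n i) \<longrightarrow> f n z \<in> W"
      using continuous_map_baireD[OF S(2)[of n], OF W(1) yS W(3)] by (rule exE)
    obtain k' where k': "\<forall>z\<in>S 0. (\<forall>i<k'. z i = y 0 i) \<longrightarrow> f 0 z \<in> W'"
      using continuous_map_baireD[OF S(2)[of 0], OF W(2) yS W(4)] by (rule exE)
    obtain j where j: "\<forall>j'\<ge>j. \<forall>z \<in> cyl j' x n. \<forall>i<k. z i = y n i" using cyl_near by blast
    obtain j' where j': "\<forall>j''\<ge>j'. \<forall>z \<in> cyl j'' x 0. \<forall>i<k'. z i = y 0 i" using cyl_near by blast
    define J where "J = max j j'"
    have J: "f n ` cyl J x n \<subseteq> W" "f 0 ` cyl J x 0 \<subseteq> W'"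
      using j j' k k' cylS unfolding J_def by (blast intro: max.cobounded1 max.cobounded2)+
    have "n \<noteq> 0" using n by metis
    \<comment> \<open>At stage \<open>J\<close> the pieces in slots \<open>n\<close> and 0 lie in
      the two disjoint open sets; the whole space fills the other slots.\<close>
    let ?B = "\<lambda>m. if m = n then W else if m = 0 then W' else topspace X"
    have "?B n \<inter> ?B 0 = {}" using W(5) \<open>n \<noteq> 0\<close> by (auto simp: disjnt_def)
    then have "(\<Inter>m. ?B m) = {}" by blast
    moreover have "\<forall>m. f m ` cyl J x m \<subseteq> ?B m" using J ftop by auto
    ultimately show False
      using nsep[of ?B J] W top by (auto simp: openin_sets_borel_of_topology)
  qed
  then show ?thesis unfolding sep_def .
qed

text \<open>Novikov's theorem for the sequence \<open>A\<close>, \<open>E\<close>, \<open>E\<close>,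
  ...: the separators with positive index can all be met in any point of \<open>E\<close>, so
  \<open>E\<close> misses the separator with index 0.\<close>

lemma lusin_separation:
  assumes "Hausdorff_space X" "analytic_in X A" "analytic_in X E" "A \<inter> E = {}"
  obtains D where "D \<in> sets (borel_of_topology X)" "A \<subseteq> D" "D \<inter> E = {}"
proof -
  define F where "F n = (if n = 0 then A else E)" for n :: nat
  have F: "F 0 = A" "F (Suc n) = E" for n by (simp_all add: F_def)
  have an: "analytic_in X (F n)" for n using assms by (simp add: F_def)
  have "F 0 \<inter> F 1 = {}" using assms(4) by (simp add: F_def)
  then have "(\<Inter>n. F n) = {}" by blast
  from novikov_separation[OF assms(1) an this]
  obtain B where "(\<forall>n. B n \<in> sets (borel_of_topology X) \<and> F n \<subseteq> B n) \<and> (\<Inter>n. B n) = {}"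
    by (rule exE)
  then have B: "\<And>n. B n \<in> sets (borel_of_topology X)" "\<And>n. F n \<subseteq> B n" "(\<Inter>n. B n) = {}"
    by auto
  have "E \<subseteq> (\<Inter>n\<in>{1..}. B n)"
    using B(2) F(2) by (metis INT_greatest atLeast_iff not0_implies_Suc not_one_le_zero)
  then have "B 0 \<inter> E = {}"
  proof -
    have "x \<notin> B 0" if "x \<in> E" for x
    proof
      assume "x \<in> B 0"
      then have "x \<in> B n" for n
        using that \<open>E \<subseteq> (\<Inter>n\<in>{1..}. B n)\<close> by (cases n) auto
      then show False using B(3) by blast
    qed
    then show ?thesis by blast
  qed
  then show thesis using that[of "B 0"] B(1)[of 0] B(2)[of 0] F(1) by simp
qed


section \<open>Borel sets with open sections over a compact space\<close>

lemma Times_borel_of_topology: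
  assumes "A \<in> sets (borel_of_topology X)" "B \<in> sets (borel_of_topology Y)"
  shows "A \<times> B \<in> sets (borel_of_topology (prod_topology X Y))"
proof -
  let ?Q = "borel_of_topology (prod_topology X Y)"
  have "fst -` A \<inter> space ?Q \<in> sets ?Q" "snd -` B \<inter> space ?Q \<in> sets ?Q"
    using assms
    by (blast intro: measurable_sets[OF continuous_map_imp_measurable[OF continuous_map_fst]]
        measurable_sets[OF continuous_map_imp_measurable[OF continuous_map_snd]])+
  moreover have "A \<times> B = (fst -` A \<inter> space ?Q) \<inter> (snd -` B \<inter> space ?Q)"
    using sets.sets_into_space[OF assms(1)] sets.sets_into_space[OF assms(2)] by auto
  ultimately show ?thesis by (simp only: sets.Int)
qed

text \<open>Two separations are used. Novikov's theorem, applied to the parts of \<open>W\<close>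
  that the single rectangles with coanalytic side leave uncovered, yields Borel sets
  \<open>C n\<close> such that the sets \<open>W - C n\<close> cover \<open>W\<close>. Each of these
  projects to an analytic set disjoint from \<open>E n\<close>, and Lusin's theorem puts a Borel set
  \<open>D n\<close> in between. By compactness a section over \<open>B\<close> is full if and only
  if finitely many \<open>b n\<close> with \<open>t\<close> in \<open>D n\<close> cover
  \<open>K\<close>.\<close>

lemma full_sections_borel:
  assumes K: "polish_space K" "compact_space K" "second_countable K" and P: "polish_space P"
    and B: "B \<in> sets (borel_of_topology P)"
    and W: "W \<in> sets (borel_of_topology (prod_topology K P))" "W \<subseteq> topspace K \<times> B"
    and sec: "\<And>t. t \<in> B \<Longrightarrow> openin K {x \<in> topspace K. (x, t) \<in> W}"
  shows "{t \<in> B. \<forall>x\<in>topspace K. (x, t) \<in> W} \<in> sets (borel_of_topology P)"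
proof -
  let ?Q = "prod_topology K P"
  have Q: "polish_space ?Q" using K(1) P by (rule polish_space_prod_topology)
  note HQ = polish_space_imp_Hausdorff[OF Q] and HP = polish_space_imp_Hausdorff[OF P]
  obtain \<B> where \<B>: "countable \<B>" "\<And>V. V \<in> \<B> \<Longrightarrow> openin K V"
      "\<And>U x. openin K U \<Longrightarrow> x \<in> U \<Longrightarrow> \<exists>V\<in>\<B>. x \<in> V \<and> V \<subseteq> U"
    using K(3) unfolding second_countable_def by metis
  \<comment> \<open>The empty set is inserted because \<open>from_nat_into\<close> enumerates a set
    only if it is nonempty, and the base of an empty space may be empty.\<close>
  define b where "b = from_nat_into (insert {} \<B>)"
  have b: "openin K (b n)" for n
    using from_nat_into[of "insert {} \<B>" n] \<B>(2) by (auto simp: b_def)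
  note bB = openin_sets_borel_of_topology[OF b]
  have PB: "topspace P \<in> sets (borel_of_topology P)"
    by (rule openin_sets_borel_of_topology) simp
  have base: "\<exists>n. x \<in> b n \<and> b n \<subseteq> U" if U: "openin K U" "x \<in> U" for U x
  proof -
    obtain V where "V \<in> \<B>" "x \<in> V" "V \<subseteq> U" using \<B>(3)[OF U] by blast
    moreover then obtain n where "V = b n"
      using \<B>(1) unfolding b_def by (metis countable_insert from_nat_into_to_nat_on insertCI)
    ultimately show ?thesis by blast
  qed
  have BP: "B \<subseteq> topspace P" using sets.sets_into_space[OF B] by simp
  \<comment> \<open>\<open>B - E n\<close> is the coanalytic set of those \<open>t\<close> with \<open>b n \<times> {t} \<subseteq> W\<close>, and the rectangles
     \<open>b n \<times> (B - E n)\<close> cover \<open>W\<close>; separation shrinks these sets to Borel ones.\<close>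
  define E where "E n = snd ` (b n \<times> B - W)" for n
  have E: "analytic_in P (E n)" for n
    unfolding E_def
  proof (rule analytic_in_continuous_map_image)
    show "analytic_in ?Q (b n \<times> B - W)"
      by (intro borel_imp_analytic_in[OF Q] sets.Diff Times_borel_of_topology bB B W(1))
  qed (rule continuous_map_snd)
  \<comment> \<open>This is \<open>W\<close> minus the rectangle
    \<open>b n \<times> (B - E n)\<close>, written as a union that shows it to be analytic.\<close>
  define A where "A n = (W - b n \<times> topspace P) \<union> (W \<inter> topspace K \<times> E n)" for n
  have anA: "analytic_in ?Q (A n)" for n
  proof -
    have "analytic_in ?Q (W - b n \<times> topspace P)"
      by (intro borel_imp_analytic_in[OF Q] sets.Diff Times_borel_of_topology bB PB W(1))
    moreover have "analytic_in ?Q (W \<inter> topspace K \<times> E n)"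
      using W(1) E K(1)
      by (intro analytic_in_Int[OF HQ] borel_imp_analytic_in[OF Q] analytic_in_Times polish_space_imp_analytic_in)
    ultimately show ?thesis unfolding A_def by (rule analytic_in_Un)
  qed
  have "(\<Inter>n. A n) = {}"
  proof (rule ccontr)
    assume "(\<Inter>n. A n) \<noteq> {}"
    then obtain x t where xt: "\<And>n. (x, t) \<in> A n" by fast
    then have "(x, t) \<in> W" unfolding A_def by blast
    then have x: "x \<in> topspace K" and t: "t \<in> B" using W(2) by auto
    obtain n where n: "x \<in> b n" "b n \<subseteq> {x \<in> topspace K. (x, t) \<in> W}"
      using base[OF sec[OF t]] x \<open>(x, t) \<in> W\<close> by blast
    have "t \<in> E n" using xt[of n] n(1) t BP unfolding A_def by auto
    then show False using n(2) unfolding E_def by auto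
  qed
  from novikov_separation[OF HQ anA this]
  obtain C where "(\<forall>n. C n \<in> sets (borel_of_topology ?Q) \<and> A n \<subseteq> C n) \<and> (\<Inter>n. C n) = {}"
    by (rule exE)
  then have C: "\<And>n. C n \<in> sets (borel_of_topology ?Q)" "\<And>n. A n \<subseteq> C n" "(\<Inter>n. C n) = {}"
    by auto
  have S: "\<exists>D. D \<in> sets (borel_of_topology P) \<and> snd ` (W - C n) \<subseteq> D \<and> D \<inter> E n = {}" for n
  proof -
    have "analytic_in P (snd ` (W - C n))"
      by (rule analytic_in_continuous_map_image[OF borel_imp_analytic_in[OF Q] continuous_map_snd])
         (intro sets.Diff W(1) C(1))
    moreover have "snd ` (W - C n) \<inter> E n = {}"
    proof -
      have "t \<notin> E n" if "(x, t) \<in> W - C n" for x t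
        using that C(2)[of n] W(2) unfolding A_def by blast
      then show ?thesis by auto
    qed
    ultimately show ?thesis using lusin_separation[OF HP _ E] by metis
  qed
  define D where
    "D n = (SOME D. D \<in> sets (borel_of_topology P) \<and> snd ` (W - C n) \<subseteq> D \<and> D \<inter> E n = {})" for n
  have "D n \<in> sets (borel_of_topology P) \<and> snd ` (W - C n) \<subseteq> D n \<and> D n \<inter> E n = {}" for n
    unfolding D_def by (rule someI_ex[OF S])
  then have D: "\<And>n. D n \<in> sets (borel_of_topology P)" "\<And>n. snd ` (W - C n) \<subseteq> D n"
      "\<And>n. D n \<inter> E n = {}"
    by auto
  have D_sub: "(x, t) \<in> W" if "t \<in> B" "t \<in> D n" "x \<in> b n" for x t n
    using that D(3)[of n] unfolding E_def by force
  \<comment> \<open>The finite cover found by compactness varies with \<open>t\<close>, but there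
    are only countably many finite index sets, so the union over them stays measurable.\<close>
  define \<F> where "\<F> = {F. finite F \<and> topspace K \<subseteq> (\<Union>n\<in>F. b n)}"
  have "{t \<in> B. \<forall>x\<in>topspace K. (x, t) \<in> W} = (\<Union>F\<in>\<F>. B - (\<Union>n\<in>F. B - D n))"
  proof (intro equalityI subsetI)
    fix t assume t: "t \<in> {t \<in> B. \<forall>x\<in>topspace K. (x, t) \<in> W}"
    let ?N = "{n. t \<in> D n}"
    have cov: "topspace K \<subseteq> \<Union>(b ` ?N)"
    proof
      fix x assume "x \<in> topspace K"
      then have "(x, t) \<in> W" using t by blast
      moreover obtain n where "(x, t) \<notin> C n" using C(3) by blast
      ultimately have "t \<in> D n" "(x, t) \<notin> A n" using D(2)[of n] C(2)[of n] by force+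
      moreover have "x \<in> b n"
        using \<open>(x, t) \<in> W\<close> \<open>(x, t) \<notin> A n\<close> t BP unfolding A_def by auto
      ultimately show "x \<in> \<Union>(b ` ?N)" by blast
    qed
    have "\<exists>\<F>'. finite \<F>' \<and> \<F>' \<subseteq> b ` ?N \<and> topspace K \<subseteq> \<Union>\<F>'"
      by (rule compactinD[OF K(2)[unfolded compact_space_def] _ cov]) (use b in auto)
    then obtain \<F>' where "finite \<F>'" "\<F>' \<subseteq> b ` ?N" "topspace K \<subseteq> \<Union>\<F>'" by blast
    then obtain F where "F \<subseteq> ?N" "finite F" "topspace K \<subseteq> \<Union>(b ` F)"
      by (metis finite_subset_image)
    then have "F \<in> \<F>" "t \<in> B - (\<Union>n\<in>F. B - D n)" using t unfolding \<F>_def by auto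
    then show "t \<in> (\<Union>F\<in>\<F>. B - (\<Union>n\<in>F. B - D n))" by blast
  next
    fix t assume "t \<in> (\<Union>F\<in>\<F>. B - (\<Union>n\<in>F. B - D n))"
    then obtain F where F: "F \<in> \<F>" "t \<in> B" "\<And>n. n \<in> F \<Longrightarrow> t \<in> D n" by blast
    have "(x, t) \<in> W" if x: "x \<in> topspace K" for x
    proof -
      obtain n where "n \<in> F" "x \<in> b n" using F(1) x unfolding \<F>_def by blast
      then show ?thesis using D_sub F by blast
    qed
    then show "t \<in> {t \<in> B. \<forall>x\<in>topspace K. (x, t) \<in> W}" using F by blast
  qed
  moreover have "(\<Union>F\<in>\<F>. B - (\<Union>n\<in>F. B - D n)) \<in> sets (borel_of_topology P)"
  proof (rule sets.countable_UN'')
    show "countable \<F>"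
      by (rule countable_subset[OF _ countable_Collect_finite]) (auto simp: \<F>_def)
    fix F assume "F \<in> \<F>"
    then have "finite F" by (simp add: \<F>_def)
    then show "B - (\<Union>n\<in>F. B - D n) \<in> sets (borel_of_topology P)"
      by (intro sets.Diff sets.finite_UN B D(1))
  qed
  ultimately show ?thesis by simp
qed

text \<open>A Borel isomorphism moves the problem to a Borel subset \<open>B\<close> of a Polish
  space. It only renames the parameter of a section, so the sections stay open.\<close>

lemma full_sections_measurable:
  fixes K :: "'k topology"
  assumes T: "standard_borel_space T"
    and K: "polish_space K" "compact_space K" "second_countable K"
    and W: "W \<in> sets (borel_of_topology K \<Otimes>\<^sub>M T)"
    and sec: "\<And>t. t \<in> space T \<Longrightarrow> openin K {x \<in> topspace K. (x, t) \<in> W}"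
  shows "{t \<in> space T. \<forall>x\<in>topspace K. (x, t) \<in> W} \<in> sets T"
proof -
  obtain P :: "real topology" and B \<phi> where P: "polish_space P" and B: "B \<in> sets (borel_of_topology P)"
    and \<phi>: "measurable_isomorphism T (restrict_space (borel_of_topology P) B) \<phi>"
    using T unfolding standard_borel_space_def by blast
  define \<psi> where "\<psi> = inv_into (space T) \<phi>"
  let ?R = "restrict_space (borel_of_topology P) B"
  have BP: "B \<subseteq> topspace P" using sets.sets_into_space[OF B] by simp
  have spR: "space ?R = B" using BP by (auto simp: space_restrict_space)
  have \<phi>m: "\<phi> \<in> T \<rightarrow>\<^sub>M ?R" and \<psi>m: "\<psi> \<in> ?R \<rightarrow>\<^sub>M T" and bij: "bij_betw \<phi> (space T) B"
    using \<phi> spR unfolding measurable_isomorphism_def \<psi>_def by auto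
  have \<psi>\<phi>: "\<psi> (\<phi> t) = t" if "t \<in> space T" for t
    using bij that unfolding \<psi>_def by (auto simp: bij_betw_def)
  have \<psi>T: "\<psi> p \<in> space T" if "p \<in> B" for p
    using measurable_space[OF \<psi>m] that spR by simp
  let ?Q = "borel_of_topology (prod_topology K P)"
  let ?S = "topspace K \<times> B"
  have S: "?S \<in> sets ?Q"
    by (intro Times_borel_of_topology B openin_sets_borel_of_topology openin_topspace)
  let ?M = "restrict_space ?Q ?S"
  have spM: "space ?M = ?S" using BP by (auto simp: space_restrict_space)
  define h where "h p = (fst p, \<psi> (snd p))" for p :: "'k \<times> real"
  have "h \<in> ?M \<rightarrow>\<^sub>M borel_of_topology K \<Otimes>\<^sub>M T"
    unfolding h_def
  proof (rule measurable_Pair)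
    show "fst \<in> ?M \<rightarrow>\<^sub>M borel_of_topology K"
      by (intro measurable_restrict_space1 continuous_map_imp_measurable continuous_map_fst)
    have "snd \<in> ?M \<rightarrow>\<^sub>M ?R"
      by (intro measurable_restrict_space3 continuous_map_imp_measurable continuous_map_snd) auto
    then show "(\<lambda>p. \<psi> (snd p)) \<in> ?M \<rightarrow>\<^sub>M T" using \<psi>m by (rule measurable_compose)
  qed
  then have "h -` W \<inter> space ?M \<in> sets ?M" using W by (rule measurable_sets)
  moreover define W' where "W' = h -` W \<inter> ?S"
  ultimately have W': "W' \<in> sets ?Q"
    unfolding spM using sets_restrict_space_iff[OF sets.Int[OF S sets.top]] by metis
  have "{p \<in> B. \<forall>x\<in>topspace K. (x, p) \<in> W'} \<in> sets (borel_of_topology P)"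
  proof (rule full_sections_borel[OF K P B W'])
    show "W' \<subseteq> topspace K \<times> B" by (auto simp: W'_def)
    fix p assume p: "p \<in> B"
    have "{x \<in> topspace K. (x, p) \<in> W'} = {x \<in> topspace K. (x, \<psi> p) \<in> W}"
      using p by (auto simp: W'_def h_def)
    then show "openin K {x \<in> topspace K. (x, p) \<in> W'}" using sec[OF \<psi>T[OF p]] by simp
  qed
  then have "{p \<in> B. \<forall>x\<in>topspace K. (x, p) \<in> W'} \<in> sets ?R"
    using sets_restrict_space_iff[OF sets.Int[OF B sets.top]] by auto
  with \<phi>m have "\<phi> -` {p \<in> B. \<forall>x\<in>topspace K. (x, p) \<in> W'} \<inter> space T \<in> sets T"
    by (rule measurable_sets)
  moreover have "\<phi> -` {p \<in> B. \<forall>x\<in>topspace K. (x, p) \<in> W'} \<inter> space T = {t \<in> space T. \<forall>x\<in>topspace K. (x, t) \<in> W}"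
    using bij_betwE[OF bij] \<psi>\<phi> by (auto simp: W'_def h_def)
  ultimately show ?thesis by simp
qed

section \<open>Families of simplices inside an open measurable set\<close>

lemma standard_simplex_topology_polish:
  "polish_space (standard_simplex_topology n)"
  "compact_space (standard_simplex_topology n)"
  "second_countable (standard_simplex_topology n)"
proof -
  have "second_countable (euclidean :: (nat \<Rightarrow> real) topology)"
  proof -
    obtain B :: "(nat \<Rightarrow> real) set set" where "countable B" "\<And>U. U \<in> B \<Longrightarrow> open U" "\<And>S. open S \<Longrightarrow> \<exists>U. U \<subseteq> B \<and> S = \<Union>U"
      using univ_second_countable by metis
    then show ?thesis unfolding second_countable_def
      by (intro exI[of _ B]) (simp, blast)
  qed
  then show sc: "second_countable (standard_simplex_topology n)"
    by (simp add: euclidean_product_topology second_countable_subtopology)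
  have "completely_metrizable_space (standard_simplex_topology n)"
    using closedin_standard_simplex[of n]
    by (intro completely_metrizable_space_closedin)
       (simp_all add: euclidean_product_topology completely_metrizable_space_euclidean)
  then show "polish_space (standard_simplex_topology n)"
    using sc by (simp add: polish_space_def second_countable_imp_separable_space)
  show "compact_space (standard_simplex_topology n)"
    using compactin_standard_simplex by (rule compact_space_subtopology)
qed

lemma continuous_map_simplex_section:
  assumes "measurable_singular_simplex n T X \<sigma>" "t \<in> space T"
  shows "continuous_map (standard_simplex_topology n) (mt_topo X) (\<lambda>x. \<sigma> (x, t))"
proof -
  have "continuous_map (prod_topology (standard_simplex_topology n) (discrete_topology (space T))) (mt_topo X) \<sigma>"
    using assms(1) by (simp add: measurable_singular_simplex_def mt_map_def mt_product_def)
  moreover have "continuous_map (standard_simplex_topology n)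
      (prod_topology (standard_simplex_topology n) (discrete_topology (space T))) (\<lambda>x. (x, t))"
    using assms(2) by (simp add: continuous_map_paired)
  ultimately have "continuous_map (standard_simplex_topology n) (mt_topo X) (\<sigma> \<circ> (\<lambda>x. (x, t)))"
    using continuous_map_compose by blast
  then show ?thesis by (simp add: comp_def)
qed

text \<open>The \<sigma>-algebra and the topology of \<open>X\<close> may be unrelated, so the two
  hypotheses on \<open>V\<close> enter separately: one makes the preimage measurable, the other
  makes its sections open.\<close>

lemma simplex_in_open_measurable:
  assumes \<sigma>: "measurable_singular_simplex n T X \<sigma>"
    and V: "openin (mt_topo X) V" "V \<in> sets (mt_meas X)"
  shows "{t \<in> space T. \<forall>x\<in>standard_simplex n. \<sigma> (x, t) \<in> V} \<in> sets T"
proof -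
  let ?K = "standard_simplex_topology n"
  have m: "\<sigma> \<in> borel_of_topology ?K \<Otimes>\<^sub>M T \<rightarrow>\<^sub>M mt_meas X" and T: "standard_borel_space T"
    using \<sigma> by (auto simp: measurable_singular_simplex_def mt_map_def mt_product_def)
  let ?W = "\<sigma> -` V \<inter> space (borel_of_topology ?K \<Otimes>\<^sub>M T)"
  have W: "?W \<in> sets (borel_of_topology ?K \<Otimes>\<^sub>M T)"
    using m V(2) by (rule measurable_sets)
  have "{t \<in> space T. \<forall>x\<in>topspace ?K. (x, t) \<in> ?W} \<in> sets T"
  proof (rule full_sections_measurable[OF T standard_simplex_topology_polish W])
    fix t assume t: "t \<in> space T"
    have "openin ?K {x \<in> topspace ?K. \<sigma> (x, t) \<in> V}"
      using continuous_map_simplex_section[OF \<sigma> t] V(1) by (auto simp: continuous_map_def)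
    moreover have "{x \<in> topspace ?K. \<sigma> (x, t) \<in> V} = {x \<in> topspace ?K. (x, t) \<in> ?W}"
      using t by (auto simp: space_pair_measure)
    ultimately show "openin ?K {x \<in> topspace ?K. (x, t) \<in> ?W}" by simp
  qed
  moreover have "{t \<in> space T. \<forall>x\<in>topspace ?K. (x, t) \<in> ?W} = {t \<in> space T. \<forall>x\<in>standard_simplex n. \<sigma> (x, t) \<in> V}"
    by (auto simp: space_pair_measure topspace_standard_simplex)
  ultimately show ?thesis by simp
qed

section \<open>Evaluation of cochains on chains\<close>

text \<open>The homomorphism from the free abelian group to \<open>G\<close> that extends \<omega>,
  with \<open>G\<close> written multiplicatively.\<close>

definition chain_eval :: "('g, 'm) monoid_scheme \<Rightarrow> ('b \<Rightarrow> 'g) \<Rightarrow> ('b \<Rightarrow>\<^sub>0 int) \<Rightarrow> 'g" where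
  "chain_eval G \<omega> c = (\<Otimes>\<^bsub>G\<^esub>\<sigma>\<in>Poly_Mapping.keys c. \<omega> \<sigma> [^]\<^bsub>G\<^esub> Poly_Mapping.lookup c \<sigma>)"

context comm_group
begin

lemma chain_eval_superset:
  assumes "finite A" "Poly_Mapping.keys c \<subseteq> A" "\<omega> \<in> A \<rightarrow> carrier G"
  shows "chain_eval G \<omega> c = (\<Otimes>\<sigma>\<in>A. \<omega> \<sigma> [^] Poly_Mapping.lookup c \<sigma>)"
  unfolding chain_eval_def
proof (rule finprod_mono_neutral_cong_left[OF assms(1,2)])
  fix i assume "i \<in> A - Poly_Mapping.keys c"
  then show "\<omega> i [^] Poly_Mapping.lookup c i = \<one>" by (simp add: in_keys_iff)
qed (use assms(3) in auto)

lemma chain_eval_closed [simp]: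
  "\<omega> \<in> Poly_Mapping.keys c \<rightarrow> carrier G \<Longrightarrow> chain_eval G \<omega> c \<in> carrier G"
  unfolding chain_eval_def by (intro finprod_closed) auto

lemma chain_eval_0 [simp]: "chain_eval G \<omega> 0 = \<one>"
  by (simp add: chain_eval_def)

lemma chain_eval_of [simp]: "\<omega> \<sigma> \<in> carrier G \<Longrightarrow> chain_eval G \<omega> (frag_of \<sigma>) = \<omega> \<sigma>"
  by (simp add: chain_eval_def int_pow_1)

lemma chain_eval_add:
  assumes "\<omega> \<in> Poly_Mapping.keys a \<union> Poly_Mapping.keys b \<rightarrow> carrier G"
  shows "chain_eval G \<omega> (a + b) = chain_eval G \<omega> a \<otimes> chain_eval G \<omega> b"
proof -
  let ?A = "Poly_Mapping.keys a \<union> Poly_Mapping.keys b"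
  have \<omega>: "\<omega> \<sigma> \<in> carrier G" if "\<sigma> \<in> ?A" for \<sigma> using assms that by auto
  have "chain_eval G \<omega> (a + b) = (\<Otimes>\<sigma>\<in>?A. \<omega> \<sigma> [^] Poly_Mapping.lookup (a + b) \<sigma>)"
    using assms by (intro chain_eval_superset) (auto simp: keys_add)
  also have "\<dots> = (\<Otimes>\<sigma>\<in>?A. \<omega> \<sigma> [^] Poly_Mapping.lookup a \<sigma> \<otimes> \<omega> \<sigma> [^] Poly_Mapping.lookup b \<sigma>)"
    using \<omega> by (intro finprod_cong') (auto simp: lookup_add int_pow_mult)
  also have "\<dots> = (\<Otimes>\<sigma>\<in>?A. \<omega> \<sigma> [^] Poly_Mapping.lookup a \<sigma>) \<otimes> (\<Otimes>\<sigma>\<in>?A. \<omega> \<sigma> [^] Poly_Mapping.lookup b \<sigma>)"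
    using \<omega> by (intro finprod_multf) auto
  also have "\<dots> = chain_eval G \<omega> a \<otimes> chain_eval G \<omega> b"
    using assms by (subst (1 2) chain_eval_superset[of ?A]) auto
  finally show ?thesis .
qed

lemma chain_eval_minus:
  assumes "\<omega> \<in> Poly_Mapping.keys a \<rightarrow> carrier G"
  shows "chain_eval G \<omega> (- a) = inv (chain_eval G \<omega> a)"
proof -
  have "chain_eval G \<omega> (- a) \<otimes> chain_eval G \<omega> a = chain_eval G \<omega> (- a + a)"
    using assms by (intro chain_eval_add[symmetric]) (auto simp: keys_minus)
  also have "\<dots> = \<one>" by simp
  finally show ?thesis
    using assms by (intro inv_equality[symmetric]) (auto simp: keys_minus)
qed

lemma chain_eval_diff:
  assumes "\<omega> \<in> Poly_Mapping.keys a \<union> Poly_Mapping.keys b \<rightarrow> carrier G"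
  shows "chain_eval G \<omega> (a - b) = chain_eval G \<omega> a \<otimes> inv (chain_eval G \<omega> b)"
  using chain_eval_add[of \<omega> a "- b"] chain_eval_minus[of \<omega> b] assms by (auto simp: keys_minus)

lemma chain_eval_cong:
  assumes "\<omega> \<in> Poly_Mapping.keys c \<rightarrow> carrier G" "\<And>\<sigma>. \<sigma> \<in> Poly_Mapping.keys c \<Longrightarrow> \<omega> \<sigma> = \<eta> \<sigma>"
  shows "chain_eval G \<omega> c = chain_eval G \<eta> c"
  unfolding chain_eval_def
proof (rule finprod_cong'[OF refl])
  show "(\<lambda>\<sigma>. \<eta> \<sigma> [^] Poly_Mapping.lookup c \<sigma>) \<in> Poly_Mapping.keys c \<rightarrow> carrier G"
    using assms by (metis (no_types, lifting) Pi_I' Pi_mem int_pow_closed)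
qed (simp add: assms(2))

lemma chain_eval_one:
  assumes "\<And>\<sigma>. \<sigma> \<in> Poly_Mapping.keys c \<Longrightarrow> \<omega> \<sigma> = \<one>"
  shows "chain_eval G \<omega> c = \<one>"
  unfolding chain_eval_def using assms by (intro finprod_one_eqI) (simp add: int_pow_one)

text \<open>The universal property of free abelian groups, with \<open>h\<close> tested only on 0,
  generators and differences. It spares later identities the rearrangement of finite
  products.\<close>

lemma chain_eval_unique:
  assumes c: "Poly_Mapping.keys c \<subseteq> S" and \<omega>: "\<omega> \<in> S \<rightarrow> carrier G"
    and 0: "h 0 = \<one>"
    and of: "\<And>\<sigma>. \<sigma> \<in> S \<Longrightarrow> h (frag_of \<sigma>) = \<omega> \<sigma>"
    and diff: "\<And>a b. Poly_Mapping.keys a \<subseteq> S \<Longrightarrow> Poly_Mapping.keys b \<subseteq> S \<Longrightarrow> h (a - b) = h a \<otimes> inv (h b)"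
  shows "chain_eval G \<omega> c = h c"
proof -
  have "Poly_Mapping.keys c \<subseteq> S \<and> chain_eval G \<omega> c = h c"
    using c
  proof (induction rule: frag_induction)
    case (one \<sigma>)
    then have "\<omega> \<sigma> \<in> carrier G" using \<omega> by auto
    then show ?case using of[OF one] one by simp
  next
    case (diff a b)
    moreover from this have "\<omega> \<in> Poly_Mapping.keys a \<union> Poly_Mapping.keys b \<rightarrow> carrier G"
      using \<omega> by auto
    ultimately show ?case using assms(5)[of a b] keys_diff[of a b] by (auto simp: chain_eval_diff)
  qed (use 0 in auto)
  then show ?thesis ..
qed

lemma chain_eval_mult:
  fixes c :: "'s \<Rightarrow>\<^sub>0 int"
  assumes "\<omega> \<in> Poly_Mapping.keys c \<rightarrow> carrier G" "\<eta> \<in> Poly_Mapping.keys c \<rightarrow> carrier G"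
  shows "chain_eval G (\<lambda>\<sigma>. \<omega> \<sigma> \<otimes> \<eta> \<sigma>) c = chain_eval G \<omega> c \<otimes> chain_eval G \<eta> c"
proof (rule chain_eval_unique[OF subset_refl])
  fix a b :: "'s \<Rightarrow>\<^sub>0 int"
  assume "Poly_Mapping.keys a \<subseteq> Poly_Mapping.keys c" "Poly_Mapping.keys b \<subseteq> Poly_Mapping.keys c"
  then have *: "\<omega> \<in> Poly_Mapping.keys a \<union> Poly_Mapping.keys b \<rightarrow> carrier G"
      "\<eta> \<in> Poly_Mapping.keys a \<union> Poly_Mapping.keys b \<rightarrow> carrier G"
    using assms by auto
  then have cl: "chain_eval G \<omega> a \<in> carrier G" "chain_eval G \<omega> b \<in> carrier G"
      "chain_eval G \<eta> a \<in> carrier G" "chain_eval G \<eta> b \<in> carrier G"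
    by auto
  show "chain_eval G \<omega> (a - b) \<otimes> chain_eval G \<eta> (a - b) =
      chain_eval G \<omega> a \<otimes> chain_eval G \<eta> a \<otimes> inv (chain_eval G \<omega> b \<otimes> chain_eval G \<eta> b)"
    using * cl by (simp add: chain_eval_diff inv_mult m_ac)
qed (use assms in \<open>auto simp: Pi_iff\<close>)

text \<open>Applied with \<open>e\<close> the inversion of \<open>G\<close>, and with
  \<open>e\<close> a left or right multiplication when the coefficients form a ring.\<close>

lemma chain_eval_hom:
  fixes c :: "'s \<Rightarrow>\<^sub>0 int"
  assumes e: "e \<in> hom G G" and \<omega>: "\<omega> \<in> Poly_Mapping.keys c \<rightarrow> carrier G"
  shows "chain_eval G (\<lambda>\<sigma>. e (\<omega> \<sigma>)) c = e (chain_eval G \<omega> c)"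
proof (rule chain_eval_unique[OF subset_refl])
  interpret e: group_hom G G e using e by unfold_locales
  show "e (chain_eval G \<omega> 0) = \<one>" by simp
  show "(\<lambda>\<sigma>. e (\<omega> \<sigma>)) \<in> Poly_Mapping.keys c \<rightarrow> carrier G" using \<omega> by (auto simp: Pi_iff)
  fix a b :: "'s \<Rightarrow>\<^sub>0 int"
  assume "Poly_Mapping.keys a \<subseteq> Poly_Mapping.keys c" "Poly_Mapping.keys b \<subseteq> Poly_Mapping.keys c"
  then have *: "\<omega> \<in> Poly_Mapping.keys a \<union> Poly_Mapping.keys b \<rightarrow> carrier G" using \<omega> by auto
  then have "chain_eval G \<omega> a \<in> carrier G" "chain_eval G \<omega> b \<in> carrier G" by auto
  then show "e (chain_eval G \<omega> (a - b)) = e (chain_eval G \<omega> a) \<otimes> inv (e (chain_eval G \<omega> b))"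
    using * by (simp add: chain_eval_diff)
qed (use \<omega> in \<open>auto simp: Pi_iff\<close>)

lemma chain_eval_sum:
  assumes "finite I" "\<And>i. i \<in> I \<Longrightarrow> Poly_Mapping.keys (c i) \<subseteq> S" "\<omega> \<in> S \<rightarrow> carrier G"
  shows "chain_eval G \<omega> (\<Sum>i\<in>I. c i) = (\<Otimes>i\<in>I. chain_eval G \<omega> (c i))"
  using assms(1,2)
proof (induction I rule: finite_induct)
  case (insert i I)
  have *: "Poly_Mapping.keys (\<Sum>i\<in>I. c i) \<subseteq> S"
    using insert.prems keys_sum[of c I] by fastforce
  have cl: "chain_eval G \<omega> (c j) \<in> carrier G" if "j \<in> insert i I" for j
    using insert.prems[OF that] assms(3) by (intro chain_eval_closed) auto
  have "chain_eval G \<omega> (c i + (\<Sum>i\<in>I. c i)) = chain_eval G \<omega> (c i) \<otimes> chain_eval G \<omega> (\<Sum>i\<in>I. c i)"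
    using insert.prems[of i] * assms(3) by (intro chain_eval_add) auto
  then show ?case using insert cl by simp
qed simp

end

section \<open>Iterated barycentric subdivision\<close>

abbreviation identity_simplex :: "nat \<Rightarrow> (nat \<Rightarrow> real) \<Rightarrow> nat \<Rightarrow> real" where
  "identity_simplex p \<equiv> restrict id (standard_simplex p)"

text \<open>\<open>subd\<close> is the homotopy between subdivision and identity on simplicial
  chains. Pushing its value on the identity simplex forward along \<open>f\<close> extends it to
  singular chains and makes it natural by construction.\<close>

definition subdivision_homotopy :: "nat \<Rightarrow> 'a chain \<Rightarrow> 'a chain" where
  "subdivision_homotopy p = frag_extend (\<lambda>f. chain_map (Suc p) f (subd p (frag_of (identity_simplex p))))"

lemma subdivision_homotopy_0 [simp]: "subdivision_homotopy p 0 = 0"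
  by (simp add: subdivision_homotopy_def)

lemma subdivision_homotopy_of:
  "subdivision_homotopy p (frag_of f) = chain_map (Suc p) f (subd p (frag_of (identity_simplex p)))"
  by (simp add: subdivision_homotopy_def)

lemma subdivision_homotopy_diff:
  "subdivision_homotopy p (a - b) = subdivision_homotopy p a - subdivision_homotopy p b"
  by (simp add: subdivision_homotopy_def frag_extend_diff)

lemma simplicial_chain_subd_identity:
  "simplicial_chain (Suc p) (standard_simplex p) (subd p (frag_of (identity_simplex p)))"
  by (intro chain_homotopic_simplicial_subdivision2) simp

lemma singular_chain_subd_identity:
  "singular_chain (Suc p) (standard_simplex_topology p) (subd p (frag_of (identity_simplex p)))"
  using simplicial_chain_subd_identity by (rule simplicial_imp_singular_chain)

lemma chain_map_simplex_map:
  assumes "singular_chain q (standard_simplex_topology p) c"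
  shows "chain_map q (simplex_map p g f) c = chain_map q g (chain_map q f c)"
proof -
  have "chain_map q (simplex_map p g f) c = chain_map q (g \<circ> f) c"
    by (rule chain_map_eq[OF assms]) (simp add: simplex_map_def topspace_standard_simplex)
  then show ?thesis by (simp add: chain_map_compose)
qed

lemma subdivision_homotopy_chain_map:
  "subdivision_homotopy p (chain_map p g c) = chain_map (Suc p) g (subdivision_homotopy p c)"
  using subset_UNIV
proof (induction c rule: frag_induction)
  case (one f)
  then show ?case
    by (simp add: subdivision_homotopy_of chain_map_simplex_map singular_chain_subd_identity)
qed (auto simp: subdivision_homotopy_diff chain_map_diff)

lemma singular_chain_subdivision_homotopy:
  assumes "singular_chain p X c"
  shows "singular_chain (Suc p) X (subdivision_homotopy p c)"
  unfolding subdivision_homotopy_def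
proof (rule singular_chain_extend)
  fix f assume "f \<in> Poly_Mapping.keys c"
  then have "continuous_map (standard_simplex_topology p) X f"
    using assms by (auto simp: singular_chain_def singular_simplex_def)
  then show "singular_chain (Suc p) X (chain_map (Suc p) f (subd p (frag_of (identity_simplex p))))"
    using singular_chain_subd_identity by (blast intro: singular_chain_chain_map)
qed

text \<open>\<open>subd\<close> commutes with affine maps, so on affine simplices it already is the
  pushforward of its value on the identity simplex. The case of interest is the boundary of the
  identity simplex.\<close>

lemma chain_map_subd_simplicial:
  assumes "simplicial_chain q (standard_simplex p) c"
  shows "chain_map (Suc q) f (subd q c) = subdivision_homotopy q (chain_map q f c)"
  using assms unfolding simplicial_chain_def
proof (induction rule: frag_induction)
  case (one g)
  then have g: "simplicial_simplex q (standard_simplex p) g" by simp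
  then have gs: "singular_simplex q (standard_simplex_topology p) g"
    by (rule simplicial_imp_singular_simplex)
  have "subd q (frag_of g) = subd q (chain_map q g (frag_of (identity_simplex q)))"
    by (simp only: singular_simplex_chain_map_id[OF gs])
  also have "\<dots> = chain_map (Suc q) g (subd q (frag_of (identity_simplex q)))"
    using g by (intro chain_homotopic_simplicial_subdivision1[symmetric]) auto
  finally show ?case
    by (simp add: subdivision_homotopy_of chain_map_simplex_map singular_chain_subd_identity)
qed (auto simp: subdivision_homotopy_diff chain_map_diff)

text \<open>By naturality the identity simplex decides, and there this is the simplicial homotopy
  formula; \<open>chain_map_subd_simplicial\<close> turns its boundary term into the singular
  one.\<close>

lemma chain_boundary_subdivision_homotopy:
  assumes "singular_chain p X c"
  shows "chain_boundary (Suc p) (subdivision_homotopy p c) =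
    singular_subdivision p c - c - subdivision_homotopy (p - Suc 0) (chain_boundary p c)"
  using assms unfolding singular_chain_def
proof (induction rule: frag_induction)
  case (one f)
  then have f: "singular_simplex p X f" by simp
  let ?i = "frag_of (identity_simplex p)"
  have i: "simplicial_chain p (standard_simplex p) ?i" by simp
  have bi: "simplicial_chain (p - Suc 0) (standard_simplex p) (chain_boundary p ?i)"
    using simplicial_chain_boundary[OF i] by simp
  have fi: "chain_map p f ?i = frag_of f" using f by (rule singular_simplex_chain_map_id)
  have "chain_boundary (Suc p) (subdivision_homotopy p (frag_of f)) =
      chain_map p f (chain_boundary (Suc p) (subd p ?i))"
    using chain_boundary_chain_map[OF singular_chain_subd_identity] by (simp add: subdivision_homotopy_of)
  also have "\<dots> = chain_map p f (simplicial_subdivision p ?i) - chain_map p f ?i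
      - chain_map p f (subd (p - Suc 0) (chain_boundary p ?i))"
    using chain_homotopic_simplicial_subdivision3[OF i] by (simp add: chain_map_diff)
  also have "chain_map p f (simplicial_subdivision p ?i) = singular_subdivision p (frag_of f)"
    by (simp add: singular_subdivision_def)
  also have "chain_map p f (subd (p - Suc 0) (chain_boundary p ?i)) =
      subdivision_homotopy (p - Suc 0) (chain_boundary p (frag_of f))"
  proof (cases p)
    \<comment> \<open>The boundary of a 0-chain is 0 by definition, so both sides vanish.\<close>
    case 0
    then show ?thesis by (simp add: chain_boundary_def)
  next
    case (Suc q)
    have "singular_chain p (standard_simplex_topology p) ?i"
      using i by (rule simplicial_imp_singular_chain)
    then have "chain_boundary p (chain_map p f ?i) = chain_map (p - Suc 0) f (chain_boundary p ?i)"
      by (rule chain_boundary_chain_map)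
    then show ?thesis
      using chain_map_subd_simplicial[OF bi, of f] fi Suc by simp
  qed
  finally show ?case by (simp only: fi)
qed (auto simp: subdivision_homotopy_diff chain_boundary_diff singular_subdivision_diff)

lemma singular_chain_subdivision_power:
  "singular_chain p X c \<Longrightarrow> singular_chain p X ((singular_subdivision p ^^ m) c)"
  by (induction m) (auto simp: singular_chain_singular_subdivision)

lemma subdivision_power_chain_map:
  "singular_chain p X c \<Longrightarrow>
    (singular_subdivision p ^^ m) (chain_map p g c) = chain_map p g ((singular_subdivision p ^^ m) c)"
  by (induction m) (auto simp: naturality_singular_subdivision[OF singular_chain_subdivision_power])

lemma chain_boundary_subdivision_power:
  "singular_chain p X c \<Longrightarrow>
    chain_boundary p ((singular_subdivision p ^^ m) c) = (singular_subdivision (p - Suc 0) ^^ m) (chain_boundary p c)"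
  by (induction m) (auto simp: chain_boundary_singular_subdivision[OF singular_chain_subdivision_power])

text \<open>The summands come from telescoping: a power of the subdivision minus the identity is the
  sum of (subdivision minus identity) applied to all lower powers.\<close>

definition iterated_homotopy :: "nat \<Rightarrow> nat \<Rightarrow> 'a chain \<Rightarrow> 'a chain" where
  "iterated_homotopy m p c = (\<Sum>i<m. subdivision_homotopy p ((singular_subdivision p ^^ i) c))"

lemma iterated_homotopy_0 [simp]: "iterated_homotopy m p 0 = 0"
  by (simp add: iterated_homotopy_def)

lemma iterated_homotopy_diff:
  "iterated_homotopy m p (a - b) = iterated_homotopy m p a - iterated_homotopy m p b"
  by (simp add: iterated_homotopy_def singular_subdivision_power_diff subdivision_homotopy_diff sum_subtractf)

lemma singular_chain_iterated_homotopy: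
  "singular_chain p X c \<Longrightarrow> singular_chain (Suc p) X (iterated_homotopy m p c)"
  unfolding iterated_homotopy_def
  by (intro singular_chain_sum singular_chain_subdivision_homotopy singular_chain_subdivision_power)

lemma iterated_homotopy_chain_map:
  "singular_chain p X c \<Longrightarrow> iterated_homotopy m p (chain_map p g c) = chain_map (Suc p) g (iterated_homotopy m p c)"
  by (simp add: iterated_homotopy_def subdivision_power_chain_map subdivision_homotopy_chain_map chain_map_sum)

lemma chain_boundary_iterated_homotopy:
  assumes "singular_chain p X c"
  shows "chain_boundary (Suc p) (iterated_homotopy m p c) =
    (singular_subdivision p ^^ m) c - c - iterated_homotopy m (p - Suc 0) (chain_boundary p c)"
proof (induction m)
  case (Suc m)
  have "chain_boundary (Suc p) (iterated_homotopy (Suc m) p c) =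
      chain_boundary (Suc p) (iterated_homotopy m p c) +
      chain_boundary (Suc p) (subdivision_homotopy p ((singular_subdivision p ^^ m) c))"
    by (simp add: iterated_homotopy_def chain_boundary_add)
  then show ?case
    using Suc chain_boundary_subdivision_homotopy[OF singular_chain_subdivision_power[OF assms, of m]]
      chain_boundary_subdivision_power[OF assms, of m]
    by (simp add: iterated_homotopy_def)
qed (simp add: iterated_homotopy_def)

section \<open>Chains subordinate to the cover\<close>

definition small_chain :: "nat \<Rightarrow> 'a topology \<Rightarrow> 'a set \<Rightarrow> 'a set \<Rightarrow> 'a chain \<Rightarrow> bool" where
  "small_chain p X U V c \<longleftrightarrow>
     Poly_Mapping.keys c \<subseteq> singular_simplex_set p (subtopology X U) \<union> singular_simplex_set p (subtopology X V)"

text \<open>Quantifying the last hypothesis over all spaces \<open>Y\<close> expresses that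
  \<open>h\<close> respects subspaces: a simplex in \<open>U\<close> is sent to a chain in
  \<open>U\<close>, and likewise for \<open>V\<close>.\<close>

lemma small_chain_image:
  assumes c: "small_chain p X U V c"
    and h: "h 0 = 0" "\<And>a b. h (a - b) = h a - h b"
    and Y: "\<And>Y c. singular_chain p Y c \<Longrightarrow> singular_chain q Y (h c)"
  shows "small_chain q X U V (h c)"
  using c unfolding small_chain_def
proof (induction rule: frag_induction)
  case (one f)
  then consider "singular_simplex p (subtopology X U) f" | "singular_simplex p (subtopology X V) f" by auto
  then show ?case
  proof cases
    case 1
    then have "singular_chain q (subtopology X U) (h (frag_of f))" by (intro Y) (simp add: singular_chain_of)
    then show ?thesis by (auto simp: singular_chain_def)
  next
    case 2
    then have "singular_chain q (subtopology X V) (h (frag_of f))" by (intro Y) (simp add: singular_chain_of)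
    then show ?thesis by (auto simp: singular_chain_def)
  qed
next
  case (diff a b)
  then show ?case using keys_diff[of "h a" "h b"] unfolding h(2) by blast
qed (simp add: h(1))

text \<open>The test runs over the pieces of the subdivided identity simplex rather than over the
  subdivided \<sigma>. These pieces form a finite set independent of \<sigma>, so in a family
  \<sigma>(-, t) only finitely many conditions on \<open>t\<close> arise, whatever cancels in the
  subdivision of a particular \<sigma>.\<close>

definition subordinate :: "'a set \<Rightarrow> 'a set \<Rightarrow> nat \<Rightarrow> ((nat \<Rightarrow> real) \<Rightarrow> 'a) \<Rightarrow> nat \<Rightarrow> bool" where
  "subordinate U V p \<sigma> m \<longleftrightarrow>
     (\<forall>\<tau>\<in>Poly_Mapping.keys ((singular_subdivision p ^^ m) (frag_of (identity_simplex p))).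
        (\<forall>x\<in>standard_simplex p. \<sigma> (\<tau> x) \<in> U) \<or> (\<forall>x\<in>standard_simplex p. \<sigma> (\<tau> x) \<in> V))"

text \<open>The least level is chosen because it depends measurably on the parameter of a family,
  see \<open>measurable_subdivision_level\<close>.\<close>

definition subdivision_level :: "'a set \<Rightarrow> 'a set \<Rightarrow> nat \<Rightarrow> ((nat \<Rightarrow> real) \<Rightarrow> 'a) \<Rightarrow> nat" where
  "subdivision_level U V p \<sigma> = (LEAST m. subordinate U V p \<sigma> m)"

lemma singular_simplex_identity: "singular_simplex p (standard_simplex_topology p) (identity_simplex p)"
  by (intro simplicial_imp_singular_simplex) simp

lemma singular_chain_identity: "singular_chain p (standard_simplex_topology p) (frag_of (identity_simplex p))"
  by (simp add: singular_chain_of singular_simplex_identity)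

lemma singular_chain_subdivided_identity:
  "singular_chain p (standard_simplex_topology p) ((singular_subdivision p ^^ m) (frag_of (identity_simplex p)))"
  by (intro singular_chain_subdivision_power singular_chain_identity)

lemma subordinate_exists:
  assumes \<sigma>: "singular_simplex p X \<sigma>" and UV: "openin X U" "openin X V" "U \<union> V = topspace X"
  shows "\<exists>m. subordinate U V p \<sigma> m"
proof -
  let ?K = "standard_simplex_topology p"
  have c: "continuous_map ?K X \<sigma>" using \<sigma> by (simp add: singular_simplex_def)
  define \<C> where "\<C> = {{x \<in> topspace ?K. \<sigma> x \<in> U}, {x \<in> topspace ?K. \<sigma> x \<in> V}}"
  have op: "openin ?K W" if "W \<in> \<C>" for W
    using that c UV unfolding \<C>_def by (auto simp: continuous_map_def)
  have cov: "topspace ?K \<subseteq> \<Union>\<C>"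
  proof
    fix x assume x: "x \<in> topspace ?K"
    then have "\<sigma> x \<in> U \<union> V" using c UV(3) by (auto simp: continuous_map_def)
    then show "x \<in> \<Union>\<C>" using x unfolding \<C>_def by blast
  qed
  from sufficient_iterated_singular_subdivision_exists[OF op cov singular_chain_identity]
  obtain n where n: "\<And>m f. \<lbrakk>n \<le> m; f \<in> Poly_Mapping.keys ((singular_subdivision p ^^ m) (frag_of (identity_simplex p)))\<rbrakk>
      \<Longrightarrow> \<exists>W\<in>\<C>. f \<in> standard_simplex p \<rightarrow> W"
    by metis
  have "subordinate U V p \<sigma> n"
    unfolding subordinate_def
  proof
    fix \<tau> assume "\<tau> \<in> Poly_Mapping.keys ((singular_subdivision p ^^ n) (frag_of (identity_simplex p)))"
    then obtain W where "W \<in> \<C>" "\<tau> \<in> standard_simplex p \<rightarrow> W" using n by blast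
    then show "(\<forall>x\<in>standard_simplex p. \<sigma> (\<tau> x) \<in> U) \<or> (\<forall>x\<in>standard_simplex p. \<sigma> (\<tau> x) \<in> V)"
      unfolding \<C>_def by auto
  qed
  then show ?thesis ..
qed

lemma small_chain_subordinate:
  assumes \<sigma>: "singular_simplex p X \<sigma>" and m: "subordinate U V p \<sigma> m"
  shows "small_chain p X U V ((singular_subdivision p ^^ m) (frag_of \<sigma>))"
proof -
  let ?c = "(singular_subdivision p ^^ m) (frag_of (identity_simplex p))"
  have c: "continuous_map (standard_simplex_topology p) X \<sigma>" using \<sigma> by (simp add: singular_simplex_def)
  have "(singular_subdivision p ^^ m) (frag_of \<sigma>) =
      (singular_subdivision p ^^ m) (chain_map p \<sigma> (frag_of (identity_simplex p)))"
    by (simp only: singular_simplex_chain_map_id[OF \<sigma>])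
  also have "\<dots> = chain_map p \<sigma> ?c"
    using singular_chain_identity by (rule subdivision_power_chain_map)
  finally have eq: "(singular_subdivision p ^^ m) (frag_of \<sigma>) = chain_map p \<sigma> ?c" .
  show ?thesis
    unfolding small_chain_def
  proof
    fix f assume "f \<in> Poly_Mapping.keys ((singular_subdivision p ^^ m) (frag_of \<sigma>))"
    then obtain \<tau> where \<tau>: "\<tau> \<in> Poly_Mapping.keys ?c" "f = simplex_map p \<sigma> \<tau>"
      using keys_frag_extend[of "frag_of \<circ> simplex_map p \<sigma>" ?c] unfolding eq chain_map_def by auto
    have "singular_simplex p (standard_simplex_topology p) \<tau>"
      using singular_chain_subdivided_identity \<tau>(1) by (auto simp: singular_chain_def)
    then have "singular_simplex p X f"
      unfolding \<tau>(2) using c by (rule singular_simplex_simplex_map)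
    moreover have "f ` standard_simplex p \<subseteq> U \<or> f ` standard_simplex p \<subseteq> V"
      using m \<tau> unfolding subordinate_def by (auto simp: simplex_map_def)
    ultimately show "f \<in> singular_simplex_set p (subtopology X U) \<union> singular_simplex_set p (subtopology X V)"
      by (auto simp: singular_simplex_subtopology)
  qed
qed

text \<open>Subdivision keeps small chains small, so smallness passes from the least level to every
  later one. Comparing several simplices at a common level relies on this.\<close>

lemma small_chain_level:
  assumes \<sigma>: "singular_simplex p X \<sigma>" and UV: "openin X U" "openin X V" "U \<union> V = topspace X"
    and m: "subdivision_level U V p \<sigma> \<le> m"
  shows "small_chain p X U V ((singular_subdivision p ^^ m) (frag_of \<sigma>))"
proof -
  let ?l = "subdivision_level U V p \<sigma>"
  have "subordinate U V p \<sigma> ?l"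
    unfolding subdivision_level_def using subordinate_exists[OF \<sigma> UV] by (rule LeastI_ex)
  then have "small_chain p X U V ((singular_subdivision p ^^ ?l) (frag_of \<sigma>))"
    using \<sigma> by (intro small_chain_subordinate)
  then have "small_chain p X U V ((singular_subdivision p ^^ (m - ?l)) ((singular_subdivision p ^^ ?l) (frag_of \<sigma>)))"
    by (rule small_chain_image) (auto simp: singular_subdivision_power_diff singular_chain_subdivision_power)
  then show ?thesis
    using m by (simp flip: funpow_add comp_apply[of "singular_subdivision p ^^ (m - ?l)"])
qed

section \<open>Measurable cochains\<close>

lemma carrier_cochain_group:
  "carrier (singular_cochain_group n X G) = (singular_simplex_set n X \<rightarrow>\<^sub>E carrier G)"
  by (simp add: singular_cochain_group_def)

lemma mult_cochain_group:
  "\<omega> \<otimes>\<^bsub>singular_cochain_group n X G\<^esub> \<eta> = (\<lambda>\<sigma>\<in>singular_simplex_set n X. \<omega> \<sigma> \<otimes>\<^bsub>G\<^esub> \<eta> \<sigma>)"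
  by (simp add: singular_cochain_group_def product_group_def)

lemma one_cochain_group: "\<one>\<^bsub>singular_cochain_group n X G\<^esub> = (\<lambda>\<sigma>\<in>singular_simplex_set n X. \<one>\<^bsub>G\<^esub>)"
  by (simp add: singular_cochain_group_def)

lemma simplex_section_singular:
  assumes "measurable_singular_simplex n T X \<sigma>" "t \<in> space T"
  shows "singular_simplex n (mt_topo X) (\<lambda>x\<in>standard_simplex n. \<sigma> (x, t))"
  unfolding singular_simplex_def
  using continuous_map_simplex_section[OF assms]
  by (auto intro: continuous_map_eq simp: topspace_standard_simplex)

lemma measurable_simplex_compose:
  assumes \<sigma>: "measurable_singular_simplex p T X \<sigma>"
    and \<tau>: "continuous_map (standard_simplex_topology n) (standard_simplex_topology p) \<tau>"
  shows "measurable_singular_simplex n T X (\<lambda>(x, t). \<sigma> (\<tau> x, t))"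
proof -
  let ?K = "standard_simplex_topology"
  have \<sigma>': "standard_borel_space T" "\<sigma> \<in> borel_of_topology (?K p) \<Otimes>\<^sub>M T \<rightarrow>\<^sub>M mt_meas X"
      "continuous_map (prod_topology (?K p) (discrete_topology (space T))) (mt_topo X) \<sigma>"
    using \<sigma> by (auto simp: measurable_singular_simplex_def mt_map_def mt_product_def)
  have "(\<lambda>z. (\<tau> (fst z), snd z)) \<in> borel_of_topology (?K n) \<Otimes>\<^sub>M T \<rightarrow>\<^sub>M borel_of_topology (?K p) \<Otimes>\<^sub>M T"
    by (intro measurable_Pair measurable_snd measurable_compose[OF measurable_fst continuous_map_imp_measurable[OF \<tau>]])
  from measurable_compose[OF this \<sigma>'(2)]
  have 1: "(\<lambda>z. \<sigma> (\<tau> (fst z), snd z)) \<in> borel_of_topology (?K n) \<Otimes>\<^sub>M T \<rightarrow>\<^sub>M mt_meas X" .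
  have "continuous_map (prod_topology (?K n) (discrete_topology (space T)))
      (prod_topology (?K p) (discrete_topology (space T))) (\<lambda>z. (\<tau> (fst z), snd z))"
    using continuous_map_compose[OF continuous_map_fst \<tau>]
    by (simp add: continuous_map_paired continuous_map_snd comp_def)
  from continuous_map_compose[OF this \<sigma>'(3)]
  have 2: "continuous_map (prod_topology (?K n) (discrete_topology (space T))) (mt_topo X) (\<lambda>z. \<sigma> (\<tau> (fst z), snd z))"
    by (simp add: comp_def)
  have "(\<lambda>(x, t). \<sigma> (\<tau> x, t)) = (\<lambda>z. \<sigma> (\<tau> (fst z), snd z))" by auto
  then show ?thesis
    using 1 2 \<sigma>'(1) by (simp add: measurable_singular_simplex_def mt_map_def mt_product_def)
qed

text \<open>At each level the condition is a finite conjunction over the pieces \<tau> of the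
  subdivided simplex. Each conjunct is measurable because the family composed with \<tau> is again a
  measurable simplex.\<close>

lemma measurable_subdivision_level:
  assumes \<sigma>: "measurable_singular_simplex p T X \<sigma>"
    and U: "openin (mt_topo X) U" "U \<in> sets (mt_meas X)" and V: "openin (mt_topo X) V" "V \<in> sets (mt_meas X)"
  shows "(\<lambda>t. subdivision_level U V p (\<lambda>x\<in>standard_simplex p. \<sigma> (x, t))) \<in> T \<rightarrow>\<^sub>M count_space UNIV"
  unfolding subdivision_level_def
proof (rule measurable_Least)
  fix m
  let ?keys = "Poly_Mapping.keys ((singular_subdivision p ^^ m) (frag_of (identity_simplex p)))"
  have \<tau>: "continuous_map (standard_simplex_topology p) (standard_simplex_topology p) \<tau>" if "\<tau> \<in> ?keys" for \<tau>
    using singular_chain_subdivided_identity[of p m] that by (auto simp: singular_chain_def singular_simplex_def)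
  have \<tau>K: "\<tau> x \<in> standard_simplex p" if "\<tau> \<in> ?keys" "x \<in> standard_simplex p" for \<tau> x
    using \<tau>[OF that(1)] that(2) by (auto simp: continuous_map_def topspace_standard_simplex Pi_iff)
  have one: "Measurable.pred T (\<lambda>t. \<forall>x\<in>standard_simplex p. \<sigma> (\<tau> x, t) \<in> W)"
    if "\<tau> \<in> ?keys" "openin (mt_topo X) W" "W \<in> sets (mt_meas X)" for \<tau> W
    using simplex_in_open_measurable[OF measurable_simplex_compose[OF \<sigma> \<tau>[OF that(1)]] that(2,3)]
    by (simp add: pred_def)
  have two: "{t \<in> space T. (\<forall>x\<in>standard_simplex p. \<sigma> (\<tau> x, t) \<in> U) \<or> (\<forall>x\<in>standard_simplex p. \<sigma> (\<tau> x, t) \<in> V)} \<in> sets T"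
    if "\<tau> \<in> ?keys" for \<tau>
    using one[OF that V] one[OF that U] unfolding pred_def by (rule sets.sets_Collect_disj)
  have "Measurable.pred T (\<lambda>t. \<forall>\<tau>\<in>?keys. (\<forall>x\<in>standard_simplex p. \<sigma> (\<tau> x, t) \<in> U) \<or> (\<forall>x\<in>standard_simplex p. \<sigma> (\<tau> x, t) \<in> V))"
    unfolding pred_def by (rule sets.sets_Collect_finite_All[OF two]) (assumption, rule finite_keys)
  moreover have "subordinate U V p (\<lambda>x\<in>standard_simplex p. \<sigma> (x, t)) m \<longleftrightarrow>
     (\<forall>\<tau>\<in>?keys. (\<forall>x\<in>standard_simplex p. \<sigma> (\<tau> x, t) \<in> U) \<or> (\<forall>x\<in>standard_simplex p. \<sigma> (\<tau> x, t) \<in> V))" for t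
    unfolding subordinate_def using \<tau>K by simp
  ultimately show "Measurable.pred T (\<lambda>t. subordinate U V p (\<lambda>x\<in>standard_simplex p. \<sigma> (x, t)) m)"
    by simp
qed

lemma measurable_congI:
  assumes "g \<in> M \<rightarrow>\<^sub>M N" "\<And>t. t \<in> space M \<Longrightarrow> f t = g t"
  shows "f \<in> M \<rightarrow>\<^sub>M N"
  using assms measurable_cong[of M f g N] by blast

section \<open>Coefficients, evaluation of measurable cochains, and the coboundary\<close>

text \<open>Serves both kinds of coefficients: a ring enters through
  \<open>add_monoid\<close>.\<close>

locale measurable_coefficients = comm_group G for G :: "('g, 'm) monoid_scheme" (structure) +
  fixes M :: "'g measure"
  assumes space_M: "space M = carrier G"
    and mult_measurable: "(\<lambda>(a, b). a \<otimes> b) \<in> M \<Otimes>\<^sub>M M \<rightarrow>\<^sub>M M"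
    and inv_measurable: "(\<lambda>a. inv a) \<in> M \<rightarrow>\<^sub>M M"
begin

lemma measurable_mult:
  assumes "f \<in> T \<rightarrow>\<^sub>M M" "g \<in> T \<rightarrow>\<^sub>M M"
  shows "(\<lambda>t. f t \<otimes> g t) \<in> T \<rightarrow>\<^sub>M M"
  using measurable_compose[OF measurable_Pair[OF assms] mult_measurable] by simp

lemma measurable_inv:
  assumes "f \<in> T \<rightarrow>\<^sub>M M"
  shows "(\<lambda>t. inv (f t)) \<in> T \<rightarrow>\<^sub>M M"
  using assms inv_measurable by (rule measurable_compose)

lemma measurable_one: "(\<lambda>t. \<one>) \<in> T \<rightarrow>\<^sub>M M"
  by (simp add: space_M)

lemma cochain_closed:
  "\<omega> \<in> carrier (singular_cochain_group n X G) \<Longrightarrow> singular_simplex n X \<sigma> \<Longrightarrow> \<omega> \<sigma> \<in> carrier G"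
  by (auto simp: carrier_cochain_group)

lemma cochain_Pi:
  "\<omega> \<in> carrier (singular_cochain_group n X G) \<Longrightarrow> singular_chain n X c \<Longrightarrow> \<omega> \<in> Poly_Mapping.keys c \<rightarrow> carrier G"
  by (auto simp: carrier_cochain_group singular_chain_def)

lemma cochain_eqI:
  assumes "\<omega> \<in> carrier (singular_cochain_group n X G)" "\<eta> \<in> carrier (singular_cochain_group n X G)"
    and "\<And>\<sigma>. singular_simplex n X \<sigma> \<Longrightarrow> \<omega> \<sigma> = \<eta> \<sigma>"
  shows "\<omega> = \<eta>"
  using assms unfolding carrier_cochain_group by (intro PiE_ext) auto

lemma measurable_cochains_carrier:
  "\<omega> \<in> measurable_cochains n X G M \<Longrightarrow> \<omega> \<in> carrier (singular_cochain_group n (mt_topo X) G)"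
  by (simp add: measurable_cochains_def)

lemma measurable_cochainsI:
  assumes "\<And>\<sigma>. singular_simplex n (mt_topo X) \<sigma> \<Longrightarrow> f \<sigma> \<in> carrier G"
    and "\<And>T \<sigma>. measurable_singular_simplex n T X \<sigma> \<Longrightarrow>
      (\<lambda>t. f (\<lambda>x\<in>standard_simplex n. \<sigma> (x, t))) \<in> T \<rightarrow>\<^sub>M M"
  shows "(\<lambda>\<sigma>\<in>singular_simplex_set n (mt_topo X). f \<sigma>) \<in> measurable_cochains n X G M"
proof -
  let ?f = "\<lambda>\<sigma>\<in>singular_simplex_set n (mt_topo X). f \<sigma>"
  have "(\<lambda>t. ?f (\<lambda>x\<in>standard_simplex n. \<sigma> (x, t))) \<in> T \<rightarrow>\<^sub>M M"
    if \<sigma>: "measurable_singular_simplex n T X \<sigma>" for T \<sigma>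
    using assms(2)[OF \<sigma>]
    by (rule measurable_congI) (intro restrict_apply' CollectI simplex_section_singular[OF \<sigma>])
  then show ?thesis using assms(1) by (auto simp: measurable_cochains_def carrier_cochain_group)
qed

text \<open>The chain \<open>c\<close> lives in the standard simplex and does not depend on
  \<open>t\<close>; only the map that pushes it forward does. By naturality the boundaries and
  subdivision homotopies of a family have this form, so their measurability is settled here once, by
  induction on \<open>c\<close>.\<close>

lemma chain_eval_measurable:
  assumes \<omega>: "\<omega> \<in> measurable_cochains n X G M" and \<sigma>: "measurable_singular_simplex p T X \<sigma>"
    and c: "singular_chain n (standard_simplex_topology p) c"
  shows "(\<lambda>t. chain_eval G \<omega> (chain_map n (\<lambda>x\<in>standard_simplex p. \<sigma> (x, t)) c)) \<in> T \<rightarrow>\<^sub>M M"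
proof -
  let ?s = "\<lambda>t. \<lambda>x\<in>standard_simplex p. \<sigma> (x, t)"
  have cl: "singular_chain n (mt_topo X) (chain_map n (?s t) a)"
    if "singular_chain n (standard_simplex_topology p) a" "t \<in> space T" for a t
    using that simplex_section_singular[OF \<sigma>] by (auto simp: singular_simplex_def intro: singular_chain_chain_map)
  note \<omega>Pi = cochain_Pi[OF measurable_cochains_carrier[OF \<omega>] cl]
  have "singular_chain n (standard_simplex_topology p) c \<and>
      (\<lambda>t. chain_eval G \<omega> (chain_map n (?s t) c)) \<in> T \<rightarrow>\<^sub>M M"
    using c unfolding singular_chain_def
  proof (induction rule: frag_induction)
    case (one \<tau>)
    then have \<tau>: "singular_simplex n (standard_simplex_topology p) \<tau>" by simp
    then have \<tau>c: "continuous_map (standard_simplex_topology n) (standard_simplex_topology p) \<tau>"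
      by (simp add: singular_simplex_def)
    have "(\<lambda>t. \<omega> (\<lambda>x\<in>standard_simplex n. \<sigma> (\<tau> x, t))) \<in> T \<rightarrow>\<^sub>M M"
      using measurable_simplex_compose[OF \<sigma> \<tau>c] \<omega> by (force simp: measurable_cochains_def)
    moreover have "chain_eval G \<omega> (chain_map n (?s t) (frag_of \<tau>)) = \<omega> (\<lambda>x\<in>standard_simplex n. \<sigma> (\<tau> x, t))"
      if t: "t \<in> space T" for t
    proof -
      have "simplex_map n (?s t) \<tau> = (\<lambda>x\<in>standard_simplex n. \<sigma> (\<tau> x, t))"
        using \<tau>c by (auto simp: simplex_map_def continuous_map_def topspace_standard_simplex Pi_iff)
      moreover have "\<omega> (simplex_map n (?s t) \<tau>) \<in> carrier G"
        using \<omega>Pi[of "frag_of \<tau>" t] \<tau> t by (simp add: singular_chain_of)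
      ultimately show ?thesis by simp
    qed
    ultimately have m: "(\<lambda>t. chain_eval G \<omega> (chain_map n (?s t) (frag_of \<tau>))) \<in> T \<rightarrow>\<^sub>M M"
      by (rule measurable_congI)
    have "Poly_Mapping.keys (frag_of \<tau>) \<subseteq> singular_simplex_set n (standard_simplex_topology p)"
      using \<tau> by simp
    then show ?case using m by (rule conjI)
  next
    case (diff a b)
    have "(\<lambda>t. chain_eval G \<omega> (chain_map n (?s t) a) \<otimes> inv (chain_eval G \<omega> (chain_map n (?s t) b))) \<in> T \<rightarrow>\<^sub>M M"
      by (intro measurable_mult measurable_inv conjunct2[OF diff(1)] conjunct2[OF diff(2)])
    moreover have "chain_eval G \<omega> (chain_map n (?s t) (a - b)) =
        chain_eval G \<omega> (chain_map n (?s t) a) \<otimes> inv (chain_eval G \<omega> (chain_map n (?s t) b))"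
      if "t \<in> space T" for t
    proof -
      have "\<omega> \<in> Poly_Mapping.keys (chain_map n (?s t) a) \<union> Poly_Mapping.keys (chain_map n (?s t) b) \<rightarrow> carrier G"
        using \<omega>Pi[of a t] \<omega>Pi[of b t] conjunct1[OF diff(1)] conjunct1[OF diff(2)] that
        unfolding singular_chain_def by blast
      then show ?thesis by (simp only: chain_map_diff chain_eval_diff)
    qed
    ultimately have m: "(\<lambda>t. chain_eval G \<omega> (chain_map n (?s t) (a - b))) \<in> T \<rightarrow>\<^sub>M M"
      by (rule measurable_congI)
    have "Poly_Mapping.keys (a - b) \<subseteq> singular_simplex_set n (standard_simplex_topology p)"
      using conjunct1[OF diff(1)] conjunct1[OF diff(2)] keys_diff[of a b] by blast
    then show ?case using m by (rule conjI)
  qed (simp add: measurable_one)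
  then show ?thesis ..
qed

lemma chain_eval_linear:
  fixes c :: "'b chain"
  assumes c: "singular_chain n X c" and \<omega>: "\<omega> \<in> carrier (singular_cochain_group q Y G)"
    and h: "h 0 = 0" "\<And>a b. h (a - b) = h a - h b"
      "\<And>c. singular_chain n X c \<Longrightarrow> singular_chain q Y (h c)"
  shows "chain_eval G \<omega> (h c) = chain_eval G (\<lambda>\<sigma>. chain_eval G \<omega> (h (frag_of \<sigma>))) c"
proof (rule chain_eval_unique[symmetric, where h = "\<lambda>c. chain_eval G \<omega> (h c)"])
  show "Poly_Mapping.keys c \<subseteq> singular_simplex_set n X" using c by (simp add: singular_chain_def)
  have cl: "\<omega> \<in> Poly_Mapping.keys (h a) \<rightarrow> carrier G" if "singular_chain n X a" for a
    using h(3)[OF that] by (rule cochain_Pi[OF \<omega>])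
  then show "(\<lambda>\<sigma>. chain_eval G \<omega> (h (frag_of \<sigma>))) \<in> singular_simplex_set n X \<rightarrow> carrier G"
    by (auto simp: singular_chain_of intro: chain_eval_closed)
  fix a b :: "'b chain"
  assume "Poly_Mapping.keys a \<subseteq> singular_simplex_set n X" "Poly_Mapping.keys b \<subseteq> singular_simplex_set n X"
  then have "\<omega> \<in> Poly_Mapping.keys (h a) \<union> Poly_Mapping.keys (h b) \<rightarrow> carrier G"
    using cl[of a] cl[of b] by (auto simp: singular_chain_def)
  then show "chain_eval G \<omega> (h (a - b)) = chain_eval G \<omega> (h a) \<otimes> inv chain_eval G \<omega> (h b)"
    by (simp add: h(2) chain_eval_diff)
qed (simp_all add: h(1))

text \<open>Identities between chains transpose to cochains once the alternating product of the
  definition is an evaluation on a boundary.\<close>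

lemma coboundary_eq:
  assumes \<omega>: "\<omega> \<in> carrier (singular_cochain_group n X G)"
  shows "coboundary n X G \<omega> =
    (\<lambda>\<sigma>\<in>singular_simplex_set (Suc n) X. chain_eval G \<omega> (chain_boundary (Suc n) (frag_of \<sigma>)))"
  unfolding coboundary_def
proof (rule restrict_ext)
  fix \<sigma> assume "\<sigma> \<in> singular_simplex_set (Suc n) X"
  then have face: "singular_simplex n X (singular_face (Suc n) k \<sigma>)" if "k \<le> Suc n" for k
    using singular_simplex_singular_face[of "Suc n" X \<sigma> k] that by simp
  have keys: "Poly_Mapping.keys (frag_cmul ((- 1) ^ k) (frag_of (singular_face (Suc n) k \<sigma>))) \<subseteq> singular_simplex_set n X"
    if "k \<in> {..Suc n}" for k
    using face[of k] that by (auto split: if_splits)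
  have "chain_eval G \<omega> (frag_cmul ((- 1) ^ k) (frag_of (singular_face (Suc n) k \<sigma>))) =
      (if even k then \<omega> (singular_face (Suc n) k \<sigma>) else inv \<omega> (singular_face (Suc n) k \<sigma>))"
    if "k \<in> {..Suc n}" for k
  proof -
    have "\<omega> (singular_face (Suc n) k \<sigma>) \<in> carrier G" using face[of k] that cochain_closed[OF \<omega>] by simp
    then show ?thesis by (cases "even k") (simp_all add: chain_eval_minus)
  qed
  then have "(\<Otimes>k\<in>{..Suc n}. chain_eval G \<omega> (frag_cmul ((- 1) ^ k) (frag_of (singular_face (Suc n) k \<sigma>)))) =
     (\<Otimes>k\<in>{..Suc n}. if even k then \<omega> (singular_face (Suc n) k \<sigma>) else inv \<omega> (singular_face (Suc n) k \<sigma>))"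
    using face cochain_closed[OF \<omega>] by (intro finprod_cong') auto
  moreover have "chain_eval G \<omega> (chain_boundary (Suc n) (frag_of \<sigma>)) =
      (\<Otimes>k\<in>{..Suc n}. chain_eval G \<omega> (frag_cmul ((- 1) ^ k) (frag_of (singular_face (Suc n) k \<sigma>))))"
    using keys \<omega> unfolding chain_boundary_of
    by (simp del: sum.atMost_Suc, intro chain_eval_sum[where S = "singular_simplex_set n X"])
       (auto simp: carrier_cochain_group simp del: keys_cmul)
  ultimately show "(\<Otimes>k\<in>{..Suc n}. if even k then \<omega> (singular_face (Suc n) k \<sigma>) else inv \<omega> (singular_face (Suc n) k \<sigma>)) =
      chain_eval G \<omega> (chain_boundary (Suc n) (frag_of \<sigma>))" by simp
qed

lemma coboundary_closed:
  assumes \<omega>: "\<omega> \<in> carrier (singular_cochain_group n X G)"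
  shows "coboundary n X G \<omega> \<in> carrier (singular_cochain_group (Suc n) X G)"
proof -
  have "chain_eval G \<omega> (chain_boundary (Suc n) (frag_of \<sigma>)) \<in> carrier G" if "singular_simplex (Suc n) X \<sigma>" for \<sigma>
    using that
    by (intro chain_eval_closed cochain_Pi[OF \<omega>] singular_chain_boundary_alt) (simp add: singular_chain_of)
  then show ?thesis unfolding coboundary_eq[OF \<omega>] by (simp add: carrier_cochain_group)
qed

lemma chain_eval_coboundary:
  assumes \<omega>: "\<omega> \<in> carrier (singular_cochain_group n X G)" and c: "singular_chain (Suc n) X c"
  shows "chain_eval G (coboundary n X G \<omega>) c = chain_eval G \<omega> (chain_boundary (Suc n) c)"
proof -
  have "chain_eval G (coboundary n X G \<omega>) c =
      chain_eval G (\<lambda>\<sigma>. chain_eval G \<omega> (chain_boundary (Suc n) (frag_of \<sigma>))) c"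
    using c cochain_Pi[OF coboundary_closed[OF \<omega>] c]
    by (intro chain_eval_cong) (auto simp: coboundary_eq[OF \<omega>] singular_chain_def)
  also have "\<dots> = chain_eval G \<omega> (chain_boundary (Suc n) c)"
    using c \<omega>
    by (intro chain_eval_linear[symmetric, of "Suc n" X c \<omega> n X "chain_boundary (Suc n)"])
       (auto simp: chain_boundary_diff singular_chain_boundary_alt)
  finally show ?thesis .
qed

lemma coboundary_coboundary:
  assumes \<omega>: "\<omega> \<in> carrier (singular_cochain_group n X G)"
  shows "coboundary (Suc n) X G (coboundary n X G \<omega>) = \<one>\<^bsub>singular_cochain_group (Suc (Suc n)) X G\<^esub>"
  unfolding coboundary_eq[OF coboundary_closed[OF \<omega>]] one_cochain_group
proof (rule restrict_ext)
  fix \<sigma> assume "\<sigma> \<in> singular_simplex_set (Suc (Suc n)) X"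
  then have \<sigma>: "singular_chain (Suc (Suc n)) X (frag_of \<sigma>)" by (simp add: singular_chain_of)
  then have "chain_boundary (Suc n) (chain_boundary (Suc (Suc n)) (frag_of \<sigma>)) = 0"
    using chain_boundary_boundary by fastforce
  then show "chain_eval G (coboundary n X G \<omega>) (chain_boundary (Suc (Suc n)) (frag_of \<sigma>)) = \<one>"
    using chain_eval_coboundary[OF \<omega> singular_chain_boundary_alt[OF \<sigma>]] by simp
qed

lemma coboundary_measurable:
  assumes \<omega>: "\<omega> \<in> measurable_cochains n X G M"
  shows "coboundary n (mt_topo X) G \<omega> \<in> measurable_cochains (Suc n) X G M"
  unfolding coboundary_eq[OF measurable_cochains_carrier[OF \<omega>]]
proof (rule measurable_cochainsI)
  fix \<sigma> assume "singular_simplex (Suc n) (mt_topo X) \<sigma>"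
  then show "chain_eval G \<omega> (chain_boundary (Suc n) (frag_of \<sigma>)) \<in> carrier G"
    by (intro chain_eval_closed cochain_Pi[OF measurable_cochains_carrier[OF \<omega>]] singular_chain_boundary_alt)
       (simp add: singular_chain_of)
next
  fix T \<sigma> assume \<sigma>: "measurable_singular_simplex (Suc n) T X \<sigma>"
  let ?s = "\<lambda>t. \<lambda>x\<in>standard_simplex (Suc n). \<sigma> (x, t)" and ?i = "frag_of (identity_simplex (Suc n))"
  note i = singular_chain_identity[of "Suc n"]
  have eq: "chain_boundary (Suc n) (frag_of (?s t)) = chain_map n (?s t) (chain_boundary (Suc n) ?i)"
    if "t \<in> space T" for t
    using chain_boundary_chain_map[OF i, of "?s t"] singular_simplex_chain_map_id[OF simplex_section_singular[OF \<sigma> that]]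
    by simp
  from chain_eval_measurable[OF \<omega> \<sigma> singular_chain_boundary_alt[OF i]]
  show "(\<lambda>t. chain_eval G \<omega> (chain_boundary (Suc n) (frag_of (?s t)))) \<in> T \<rightarrow>\<^sub>M M"
    by (rule measurable_congI) (rule arg_cong[OF eq])
qed

end

lemma small_chain_sum:
  assumes "\<And>i. i \<in> I \<Longrightarrow> small_chain p X U V (c i)"
  shows "small_chain p X U V (\<Sum>i\<in>I. c i)"
  using assms keys_sum[of c I] unfolding small_chain_def by blast

lemma measurable_simplex_subspace:
  assumes \<sigma>: "measurable_singular_simplex n T X \<sigma>"
    and V: "\<And>x t. x \<in> standard_simplex n \<Longrightarrow> t \<in> space T \<Longrightarrow> \<sigma> (x, t) \<in> V"
  shows "measurable_singular_simplex n T (mt_subspace X V) \<sigma>"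
proof -
  let ?K = "standard_simplex_topology n"
  have \<sigma>': "standard_borel_space T" "\<sigma> \<in> borel_of_topology ?K \<Otimes>\<^sub>M T \<rightarrow>\<^sub>M mt_meas X"
      "continuous_map (prod_topology ?K (discrete_topology (space T))) (mt_topo X) \<sigma>"
    using \<sigma> by (auto simp: measurable_singular_simplex_def mt_map_def mt_product_def)
  have "\<sigma> \<in> borel_of_topology ?K \<Otimes>\<^sub>M T \<rightarrow>\<^sub>M restrict_space (mt_meas X) V"
    using \<sigma>'(2) V
    by (intro measurable_restrict_space2) (auto simp: space_pair_measure topspace_standard_simplex)
  moreover have "continuous_map (prod_topology ?K (discrete_topology (space T))) (subtopology (mt_topo X) V) \<sigma>"
    using \<sigma>'(3) V by (auto simp: continuous_map_in_subtopology topspace_standard_simplex)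
  ultimately show ?thesis
    using \<sigma>'(1) by (simp add: measurable_singular_simplex_def mt_map_def mt_product_def mt_subspace_def)
qed

lemma measurable_simplex_ambient:
  assumes \<sigma>: "measurable_singular_simplex n T (mt_subspace X V) \<sigma>"
  shows "measurable_singular_simplex n T X \<sigma>"
proof -
  let ?K = "standard_simplex_topology n"
  have \<sigma>': "standard_borel_space T" "\<sigma> \<in> borel_of_topology ?K \<Otimes>\<^sub>M T \<rightarrow>\<^sub>M restrict_space (mt_meas X) V"
      "continuous_map (prod_topology ?K (discrete_topology (space T))) (subtopology (mt_topo X) V) \<sigma>"
    using \<sigma> by (auto simp: measurable_singular_simplex_def mt_map_def mt_product_def mt_subspace_def)
  have "\<sigma> \<in> borel_of_topology ?K \<Otimes>\<^sub>M T \<rightarrow>\<^sub>M mt_meas X"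
    using \<sigma>'(2) by (simp add: measurable_restrict_space2_iff)
  then show ?thesis
    using \<sigma>'(1,3) by (simp add: measurable_singular_simplex_def mt_map_def mt_product_def continuous_map_in_subtopology)
qed

section \<open>The relative measurable cochain complex\<close>

context measurable_coefficients
begin

lemma cochain_group_group: "group (singular_cochain_group n X G)"
  unfolding singular_cochain_group_def by simp

lemma cochain_group_comm_group: "comm_group (singular_cochain_group n X G)"
proof (rule group.group_comm_groupI[OF cochain_group_group])
  fix \<omega> \<eta>
  assume "\<omega> \<in> carrier (singular_cochain_group n X G)" "\<eta> \<in> carrier (singular_cochain_group n X G)"
  then have "\<omega> \<sigma> \<otimes> \<eta> \<sigma> = \<eta> \<sigma> \<otimes> \<omega> \<sigma>" if "\<sigma> \<in> singular_simplex_set n X" for \<sigma>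
    using that by (intro m_comm) (auto simp: carrier_cochain_group)
  then show "\<omega> \<otimes>\<^bsub>singular_cochain_group n X G\<^esub> \<eta> = \<eta> \<otimes>\<^bsub>singular_cochain_group n X G\<^esub> \<omega>"
    unfolding mult_cochain_group by (rule restrict_ext)
qed

lemma inv_cochain_group:
  "\<omega> \<in> carrier (singular_cochain_group n X G) \<Longrightarrow>
    inv\<^bsub>singular_cochain_group n X G\<^esub> \<omega> = (\<lambda>\<sigma>\<in>singular_simplex_set n X. inv (\<omega> \<sigma>))"
  unfolding singular_cochain_group_def by (simp add: carrier_cochain_group)

lemma measurable_cochainD:
  "\<omega> \<in> measurable_cochains n X G M \<Longrightarrow> measurable_singular_simplex n T X \<sigma> \<Longrightarrow>
    (\<lambda>t. \<omega> (\<lambda>x\<in>standard_simplex n. \<sigma> (x, t))) \<in> T \<rightarrow>\<^sub>M M"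
  unfolding measurable_cochains_def by blast

lemma measurable_cochain_closed:
  "\<omega> \<in> measurable_cochains n X G M \<Longrightarrow> singular_simplex n (mt_topo X) \<sigma> \<Longrightarrow> \<omega> \<sigma> \<in> carrier G"
  using cochain_closed[OF measurable_cochains_carrier] .

lemma subgroup_rel_measurable_cochains:
  "subgroup (rel_measurable_cochains n X U G M) (singular_cochain_group n (mt_topo X) G)"
proof (rule group.subgroupI[OF cochain_group_group])
  let ?C = "singular_cochain_group n (mt_topo X) G" and ?R = "rel_measurable_cochains n X U G M"
  have sub: "singular_simplex n (mt_topo X) \<sigma>" if "singular_simplex n (subtopology (mt_topo X) U) \<sigma>" for \<sigma>
    using that by (simp add: singular_simplex_subtopology)
  show "?R \<subseteq> carrier ?C"
    using measurable_cochains_carrier by (auto simp: rel_measurable_cochains_def)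
  have "\<one>\<^bsub>?C\<^esub> \<in> ?R"
    unfolding one_cochain_group rel_measurable_cochains_def
    using sub by (auto intro!: measurable_cochainsI measurable_one)
  then show "?R \<noteq> {}" by blast
  fix \<omega> assume \<omega>: "\<omega> \<in> ?R"
  then have \<omega>m: "\<omega> \<in> measurable_cochains n X G M" by (simp add: rel_measurable_cochains_def)
  have "(\<lambda>\<sigma>\<in>singular_simplex_set n (mt_topo X). inv (\<omega> \<sigma>)) \<in> measurable_cochains n X G M"
    by (intro measurable_cochainsI inv_closed measurable_inv measurable_cochain_closed[OF \<omega>m] measurable_cochainD[OF \<omega>m])
  then show "inv\<^bsub>?C\<^esub> \<omega> \<in> ?R"
    using \<omega> sub unfolding inv_cochain_group[OF measurable_cochains_carrier[OF \<omega>m]] rel_measurable_cochains_def by auto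
  fix \<eta> assume \<eta>: "\<eta> \<in> ?R"
  then have \<eta>m: "\<eta> \<in> measurable_cochains n X G M" by (simp add: rel_measurable_cochains_def)
  have "(\<lambda>\<sigma>\<in>singular_simplex_set n (mt_topo X). \<omega> \<sigma> \<otimes> \<eta> \<sigma>) \<in> measurable_cochains n X G M"
    by (intro measurable_cochainsI m_closed measurable_mult measurable_cochain_closed[OF \<omega>m] measurable_cochainD[OF \<omega>m]
        measurable_cochain_closed[OF \<eta>m] measurable_cochainD[OF \<eta>m])
  then show "\<omega> \<otimes>\<^bsub>?C\<^esub> \<eta> \<in> ?R"
    using \<omega> \<eta> sub unfolding mult_cochain_group rel_measurable_cochains_def by auto
qed

lemma coboundary_hom:
  "coboundary n X G \<in> hom (singular_cochain_group n X G) (singular_cochain_group (Suc n) X G)"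
proof (rule homI)
  fix \<omega> \<eta>
  assume \<omega>: "\<omega> \<in> carrier (singular_cochain_group n X G)" and \<eta>: "\<eta> \<in> carrier (singular_cochain_group n X G)"
  have \<omega>\<eta>: "\<omega> \<otimes>\<^bsub>singular_cochain_group n X G\<^esub> \<eta> \<in> carrier (singular_cochain_group n X G)"
    using \<omega> \<eta> monoid.m_closed[OF group.is_monoid[OF cochain_group_group]] by blast
  have "chain_eval G (\<omega> \<otimes>\<^bsub>singular_cochain_group n X G\<^esub> \<eta>) (chain_boundary (Suc n) (frag_of \<sigma>)) =
      chain_eval G \<omega> (chain_boundary (Suc n) (frag_of \<sigma>)) \<otimes> chain_eval G \<eta> (chain_boundary (Suc n) (frag_of \<sigma>))"
    if \<sigma>: "singular_simplex (Suc n) X \<sigma>" for \<sigma>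
  proof -
    let ?c = "chain_boundary (Suc n) (frag_of \<sigma>)"
    have c: "singular_chain n X ?c" using \<sigma> by (intro singular_chain_boundary_alt) (simp add: singular_chain_of)
    have "chain_eval G (\<omega> \<otimes>\<^bsub>singular_cochain_group n X G\<^esub> \<eta>) ?c = chain_eval G (\<lambda>\<sigma>. \<omega> \<sigma> \<otimes> \<eta> \<sigma>) ?c"
      using cochain_Pi[OF \<omega>\<eta> c] c by (intro chain_eval_cong) (auto simp: mult_cochain_group singular_chain_def)
    also have "\<dots> = chain_eval G \<omega> ?c \<otimes> chain_eval G \<eta> ?c"
      using cochain_Pi[OF \<omega> c] cochain_Pi[OF \<eta> c] by (rule chain_eval_mult)
    finally show ?thesis .
  qed
  then show "coboundary n X G (\<omega> \<otimes>\<^bsub>singular_cochain_group n X G\<^esub> \<eta>) =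
      coboundary n X G \<omega> \<otimes>\<^bsub>singular_cochain_group (Suc n) X G\<^esub> coboundary n X G \<eta>"
    unfolding coboundary_eq[OF \<omega>] coboundary_eq[OF \<eta>] coboundary_eq[OF \<omega>\<eta>]
      mult_cochain_group[where n = "Suc n"]
    by (intro restrict_ext) simp
qed (rule coboundary_closed)

lemma coboundary_group_hom:
  "group_hom (singular_cochain_group n X G) (singular_cochain_group (Suc n) X G) (coboundary n X G)"
  by (simp add: group_hom_def group_hom_axioms_def cochain_group_group coboundary_hom)

lemma coboundary_rel_measurable:
  assumes \<omega>: "\<omega> \<in> rel_measurable_cochains n X U G M"
  shows "coboundary n (mt_topo X) G \<omega> \<in> rel_measurable_cochains (Suc n) X U G M"
proof -
  have \<omega>m: "\<omega> \<in> measurable_cochains n X G M" using \<omega> by (simp add: rel_measurable_cochains_def)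
  have "coboundary n (mt_topo X) G \<omega> \<sigma> = \<one>" if \<sigma>: "singular_simplex (Suc n) (subtopology (mt_topo X) U) \<sigma>" for \<sigma>
  proof -
    have "singular_chain n (subtopology (mt_topo X) U) (chain_boundary (Suc n) (frag_of \<sigma>))"
      using \<sigma> by (intro singular_chain_boundary_alt) (simp add: singular_chain_of)
    then have "chain_eval G \<omega> (chain_boundary (Suc n) (frag_of \<sigma>)) = \<one>"
      using \<omega> by (intro chain_eval_one) (auto simp: rel_measurable_cochains_def singular_chain_def)
    then show ?thesis
      using \<sigma> by (simp add: coboundary_eq[OF measurable_cochains_carrier[OF \<omega>m]] singular_simplex_subtopology)
  qed
  then show ?thesis using coboundary_measurable[OF \<omega>m] by (simp add: rel_measurable_cochains_def)
qed

lemma subgroup_rel_measurable_cocycles: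
  "subgroup (rel_measurable_cocycles n X U G M) (singular_cochain_group n (mt_topo X) G)"
proof -
  let ?k = "kernel (singular_cochain_group n (mt_topo X) G) (singular_cochain_group (Suc n) (mt_topo X) G)
      (coboundary n (mt_topo X) G)"
  have "rel_measurable_cocycles n X U G M = rel_measurable_cochains n X U G M \<inter> ?k"
    using subgroup.subset[OF subgroup_rel_measurable_cochains[of n X U]]
    by (auto simp: rel_measurable_cocycles_def kernel_def)
  then show ?thesis
    using group.subgroups_Inter_pair[OF cochain_group_group subgroup_rel_measurable_cochains group_hom.subgroup_kernel[OF coboundary_group_hom]]
    by simp
qed

lemma subgroup_rel_measurable_coboundaries:
  "subgroup (rel_measurable_coboundaries n X U G M) (singular_cochain_group n (mt_topo X) G)"
proof (cases n)
  case 0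
  then show ?thesis
    using group.triv_subgroup[OF cochain_group_group] by (simp add: rel_measurable_coboundaries_def)
next
  case (Suc m)
  then show ?thesis
    using group_hom.subgroup_img_is_subgroup[OF coboundary_group_hom subgroup_rel_measurable_cochains]
    by (simp add: rel_measurable_coboundaries_def)
qed

lemma rel_measurable_coboundaries_subset:
  "rel_measurable_coboundaries n X U G M \<subseteq> rel_measurable_cocycles n X U G M"
proof (cases n)
  case 0
  then show ?thesis
    using subgroup.one_closed[OF subgroup_rel_measurable_cocycles] by (simp add: rel_measurable_coboundaries_def)
next
  case (Suc m)
  have "coboundary m (mt_topo X) G \<omega> \<in> rel_measurable_cocycles (Suc m) X U G M"
    if \<omega>: "\<omega> \<in> rel_measurable_cochains m X U G M" for \<omega>
    using coboundary_rel_measurable[OF \<omega>] coboundary_coboundary[OF subgroup.mem_carrier[OF subgroup_rel_measurable_cochains \<omega>]]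
    by (simp add: rel_measurable_cocycles_def)
  then show ?thesis using Suc by (auto simp: rel_measurable_coboundaries_def)
qed

end

section \<open>Contraction of the kernel of restriction\<close>

locale measurable_excision = measurable_coefficients G M
  for G :: "('g, 'm) monoid_scheme" (structure) and M :: "'g measure" +
  fixes X :: "'a mt_space" and U V :: "'a set"
  assumes U: "openin (mt_topo X) U" "U \<in> sets (mt_meas X)"
    and V: "openin (mt_topo X) V" "V \<in> sets (mt_meas X)"
    and UV: "U \<union> V = topspace (mt_topo X)"
begin

text \<open>This is the kernel of the restriction to \<open>V\<close> on relative cochains, by
  \<open>restriction_one_imp_vanishing\<close> and \<open>vanishing_restriction\<close>.\<close>

definition vanishing_cochains :: "nat \<Rightarrow> (((nat \<Rightarrow> real) \<Rightarrow> 'a) \<Rightarrow> 'g) set" where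
  "vanishing_cochains n = rel_measurable_cochains n X U G M \<inter> rel_measurable_cochains n X V G M"

text \<open>The transpose of the iterated homotopy, taken at the level of each simplex separately.
  The inverse compensates the sign of the boundary term in the homotopy formula, so that for a
  cocycle in the kernel the coboundary of the result is \<omega> and not its inverse.\<close>

definition contraction :: "nat \<Rightarrow> (((nat \<Rightarrow> real) \<Rightarrow> 'a) \<Rightarrow> 'g) \<Rightarrow> ((nat \<Rightarrow> real) \<Rightarrow> 'a) \<Rightarrow> 'g" where
  "contraction p \<omega> = (\<lambda>\<sigma>\<in>singular_simplex_set p (mt_topo X).
     inv (chain_eval G \<omega> (iterated_homotopy (subdivision_level U V p \<sigma>) p (frag_of \<sigma>))))"

lemma vanishing_measurable: "\<omega> \<in> vanishing_cochains n \<Longrightarrow> \<omega> \<in> measurable_cochains n X G M"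
  by (simp add: vanishing_cochains_def rel_measurable_cochains_def)

lemma vanishing_carrier: "\<omega> \<in> vanishing_cochains n \<Longrightarrow> \<omega> \<in> carrier (singular_cochain_group n (mt_topo X) G)"
  using measurable_cochains_carrier[OF vanishing_measurable] .

lemma chain_eval_small:
  assumes "\<omega> \<in> vanishing_cochains n" "small_chain n (mt_topo X) U V c"
  shows "chain_eval G \<omega> c = \<one>"
  using assms by (intro chain_eval_one) (auto simp: vanishing_cochains_def rel_measurable_cochains_def small_chain_def)

text \<open>The homotopy stays inside any subspace that contains the simplex, so neutrality on
  \<open>U\<close> and on \<open>V\<close> is inherited. Measurability is where the level as a
  function of the parameter matters.\<close>

lemma contraction_vanishing:
  assumes \<omega>: "\<omega> \<in> vanishing_cochains (Suc p)"
  shows "contraction p \<omega> \<in> vanishing_cochains p"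
proof -
  note \<omega>c = vanishing_carrier[OF \<omega>] and \<omega>m = vanishing_measurable[OF \<omega>]
  let ?h = "\<lambda>\<sigma>. iterated_homotopy (subdivision_level U V p \<sigma>) p (frag_of \<sigma>)"
  have h: "singular_chain (Suc p) Y (?h \<sigma>)" if "singular_simplex p Y \<sigma>" for Y \<sigma>
    using that by (intro singular_chain_iterated_homotopy) (simp add: singular_chain_of)
  have "contraction p \<omega> \<in> measurable_cochains p X G M"
    unfolding contraction_def
  proof (rule measurable_cochainsI)
    fix \<sigma> assume "singular_simplex p (mt_topo X) \<sigma>"
    then show "inv (chain_eval G \<omega> (?h \<sigma>)) \<in> carrier G"
      by (intro inv_closed chain_eval_closed cochain_Pi[OF \<omega>c] h)
  next
    fix T \<sigma> assume \<sigma>: "measurable_singular_simplex p T X \<sigma>"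
    let ?s = "\<lambda>t. \<lambda>x\<in>standard_simplex p. \<sigma> (x, t)"
    let ?c = "\<lambda>m. iterated_homotopy m p (frag_of (identity_simplex p))"
    have c: "singular_chain (Suc p) (standard_simplex_topology p) (?c m)" for m
      by (intro singular_chain_iterated_homotopy singular_chain_identity)
    \<comment> \<open>The level takes countably many values and depends measurably on
      \<open>t\<close>, and for each fixed level the evaluation is measurable; the functions are
      glued along the level sets.\<close>
    have m: "(\<lambda>t. inv (chain_eval G \<omega> (chain_map (Suc p) (?s t) (?c (subdivision_level U V p (?s t)))))) \<in> T \<rightarrow>\<^sub>M M"
      by (rule measurable_compose_countable[OF _ measurable_subdivision_level[OF \<sigma> U V],
            where f = "\<lambda>m t. inv (chain_eval G \<omega> (chain_map (Suc p) (?s t) (?c m)))"])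
         (rule measurable_inv[OF chain_eval_measurable[OF \<omega>m \<sigma> c]])
    have eq: "iterated_homotopy m p (frag_of (?s t)) = chain_map (Suc p) (?s t) (?c m)"
      if "t \<in> space T" for t m
    proof -
      have "frag_of (?s t) = chain_map p (?s t) (frag_of (identity_simplex p))"
        using simplex_section_singular[OF \<sigma> that] by (rule singular_simplex_chain_map_id[symmetric])
      then show ?thesis by (simp only: iterated_homotopy_chain_map[OF singular_chain_identity])
    qed
    show "(\<lambda>t. inv (chain_eval G \<omega> (?h (?s t)))) \<in> T \<rightarrow>\<^sub>M M"
      using m by (rule measurable_congI) (simp only: eq)
  qed
  moreover have "contraction p \<omega> \<sigma> = \<one>"
    if \<sigma>: "singular_simplex p (subtopology (mt_topo X) W) \<sigma>" and W: "W \<in> {U, V}" for W \<sigma>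
  proof -
    have "chain_eval G \<omega> (?h \<sigma>) = \<one>"
      using h[OF \<sigma>] W \<omega>
      by (intro chain_eval_one) (auto simp: vanishing_cochains_def rel_measurable_cochains_def singular_chain_def)
    then show ?thesis using \<sigma> by (simp add: contraction_def singular_simplex_subtopology)
  qed
  ultimately show ?thesis by (simp add: vanishing_cochains_def rel_measurable_cochains_def)
qed

text \<open>The summands of the homotopy beyond the level of \<sigma> are small chains, on which
  \<omega> is neutral.\<close>

lemma chain_eval_iterated_homotopy:
  assumes \<omega>: "\<omega> \<in> vanishing_cochains (Suc p)" and \<sigma>: "singular_simplex p (mt_topo X) \<sigma>"
    and m: "subdivision_level U V p \<sigma> \<le> m"
  shows "chain_eval G \<omega> (iterated_homotopy m p (frag_of \<sigma>)) = inv (contraction p \<omega> \<sigma>)"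
proof -
  let ?l = "subdivision_level U V p \<sigma>"
  let ?d = "\<Sum>i\<in>{?l..<m}. subdivision_homotopy p ((singular_subdivision p ^^ i) (frag_of \<sigma>))"
  have \<sigma>c: "singular_chain p (mt_topo X) (frag_of \<sigma>)" using \<sigma> by (simp add: singular_chain_of)
  have "small_chain (Suc p) (mt_topo X) U V (subdivision_homotopy p ((singular_subdivision p ^^ i) (frag_of \<sigma>)))"
    if "?l \<le> i" for i
    using small_chain_level[OF \<sigma> U(1) V(1) UV that]
    by (rule small_chain_image) (auto simp: subdivision_homotopy_diff singular_chain_subdivision_homotopy)
  then have d: "chain_eval G \<omega> ?d = \<one>"
    by (intro chain_eval_small[OF \<omega>] small_chain_sum) auto
  have "{..<m} = {..<?l} \<union> {?l..<m}" "{..<?l} \<inter> {?l..<m} = {}" using m by auto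
  then have split: "iterated_homotopy m p (frag_of \<sigma>) = iterated_homotopy ?l p (frag_of \<sigma>) + ?d"
    unfolding iterated_homotopy_def by (simp add: sum.union_disjoint)
  have l: "\<omega> \<in> Poly_Mapping.keys (iterated_homotopy ?l p (frag_of \<sigma>)) \<rightarrow> carrier G"
    by (intro cochain_Pi[OF vanishing_carrier[OF \<omega>]] singular_chain_iterated_homotopy \<sigma>c)
  have "\<omega> \<in> Poly_Mapping.keys ?d \<rightarrow> carrier G"
    by (intro cochain_Pi[OF vanishing_carrier[OF \<omega>]] singular_chain_sum singular_chain_subdivision_homotopy
        singular_chain_subdivision_power \<sigma>c)
  then have "\<omega> \<in> Poly_Mapping.keys (iterated_homotopy ?l p (frag_of \<sigma>)) \<union> Poly_Mapping.keys ?d \<rightarrow> carrier G"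
    using l by auto
  then have "chain_eval G \<omega> (iterated_homotopy m p (frag_of \<sigma>)) =
      chain_eval G \<omega> (iterated_homotopy ?l p (frag_of \<sigma>))"
    unfolding split using l d by (simp add: chain_eval_add)
  then show ?thesis using \<sigma> l by (simp add: contraction_def)
qed

text \<open>Evaluate a cocycle on the boundary formula of the iterated homotopy, subdividing so often
  that \<open>\<sigma>\<close> becomes small.\<close>

lemma vanishing_cocycle_eq:
  assumes \<omega>: "\<omega> \<in> vanishing_cochains n" and cocycle: "coboundary n (mt_topo X) G \<omega> = \<one>\<^bsub>singular_cochain_group (Suc n) (mt_topo X) G\<^esub>"
    and \<sigma>: "singular_simplex n (mt_topo X) \<sigma>" and m: "subdivision_level U V n \<sigma> \<le> m"
  shows "\<omega> \<sigma> = inv (chain_eval G \<omega> (iterated_homotopy m (n - Suc 0) (chain_boundary n (frag_of \<sigma>))))"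
proof -
  note \<omega>c = vanishing_carrier[OF \<omega>]
  have \<sigma>c: "singular_chain n (mt_topo X) (frag_of \<sigma>)" using \<sigma> by (simp add: singular_chain_of)
  let ?D = "iterated_homotopy m n (frag_of \<sigma>)" and ?S = "(singular_subdivision n ^^ m) (frag_of \<sigma>)"
  let ?E = "iterated_homotopy m (n - Suc 0) (chain_boundary n (frag_of \<sigma>))"
  have D: "singular_chain (Suc n) (mt_topo X) ?D" by (intro singular_chain_iterated_homotopy \<sigma>c)
  have E: "singular_chain n (mt_topo X) ?E"
  proof (cases n)
    case 0
    then show ?thesis by (simp add: chain_boundary_def)
  next
    case (Suc k)
    then show ?thesis
      using singular_chain_iterated_homotopy[OF singular_chain_boundary_alt, of k "mt_topo X" "frag_of \<sigma>" m] \<sigma>c by simp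
  qed
  have S: "singular_chain n (mt_topo X) ?S" by (intro singular_chain_subdivision_power \<sigma>c)
  have Pi: "\<omega> \<in> Poly_Mapping.keys a \<rightarrow> carrier G" if "singular_chain n (mt_topo X) a" for a
    using that by (rule cochain_Pi[OF \<omega>c])
  have Pi2: "\<omega> \<in> Poly_Mapping.keys a \<union> Poly_Mapping.keys b \<rightarrow> carrier G"
    if "singular_chain n (mt_topo X) a" "singular_chain n (mt_topo X) b" for a b
    using Pi[OF that(1)] Pi[OF that(2)] by auto
  have \<omega>\<sigma>: "\<omega> \<sigma> \<in> carrier G" using \<sigma> by (rule cochain_closed[OF \<omega>c])
  have e: "chain_eval G \<omega> ?E \<in> carrier G" using Pi[OF E] by simp
  have "\<one> = chain_eval G (coboundary n (mt_topo X) G \<omega>) ?D"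
    unfolding cocycle one_cochain_group using D by (intro chain_eval_one[symmetric]) (auto simp: singular_chain_def)
  also have "\<dots> = chain_eval G \<omega> (chain_boundary (Suc n) ?D)"
    using \<omega>c D by (rule chain_eval_coboundary)
  also have "chain_boundary (Suc n) ?D = ?S - frag_of \<sigma> - ?E"
    using \<sigma>c by (rule chain_boundary_iterated_homotopy)
  also have "chain_eval G \<omega> (?S - frag_of \<sigma> - ?E) =
      chain_eval G \<omega> ?S \<otimes> inv (chain_eval G \<omega> (frag_of \<sigma>)) \<otimes> inv (chain_eval G \<omega> ?E)"
    using Pi2[OF singular_chain_diff[OF S \<sigma>c] E] Pi2[OF S \<sigma>c] by (simp only: chain_eval_diff)
  also have "chain_eval G \<omega> ?S = \<one>"
    by (intro chain_eval_small[OF \<omega>] small_chain_level \<sigma> U(1) V(1) UV m)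
  finally have "\<one> = inv (\<omega> \<sigma>) \<otimes> inv (chain_eval G \<omega> ?E)" using \<omega>\<sigma> by simp
  then have "\<one> = inv (\<omega> \<sigma> \<otimes> chain_eval G \<omega> ?E)" using \<omega>\<sigma> e by (simp add: inv_mult)
  then have "\<omega> \<sigma> \<otimes> chain_eval G \<omega> ?E = \<one>" using \<omega>\<sigma> e by (metis inv_eq_1_iff m_closed)
  then show ?thesis using \<omega>\<sigma> e by (simp add: inv_equality inv_solve_right)
qed

text \<open>Degree 0 has no boundary term, so the formula of \<open>vanishing_cocycle_eq\<close>
  degenerates to a neutral value. This matches the convention that coboundaries in degree 0 are
  trivial.\<close>

lemma vanishing_cocycle_0:
  assumes \<omega>: "\<omega> \<in> vanishing_cochains 0" and cocycle: "coboundary 0 (mt_topo X) G \<omega> = \<one>\<^bsub>singular_cochain_group 1 (mt_topo X) G\<^esub>"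
  shows "\<omega> = \<one>\<^bsub>singular_cochain_group 0 (mt_topo X) G\<^esub>"
proof (rule cochain_eqI[OF vanishing_carrier[OF \<omega>]])
  show "\<one>\<^bsub>singular_cochain_group 0 (mt_topo X) G\<^esub> \<in> carrier (singular_cochain_group 0 (mt_topo X) G)"
    by (intro monoid.one_closed group.is_monoid cochain_group_group)
  fix \<sigma> assume \<sigma>: "singular_simplex 0 (mt_topo X) \<sigma>"
  then show "\<omega> \<sigma> = \<one>\<^bsub>singular_cochain_group 0 (mt_topo X) G\<^esub> \<sigma>"
    using vanishing_cocycle_eq[OF \<omega> _ \<sigma> order_refl] cocycle by (simp add: one_cochain_group chain_boundary_def)
qed

text \<open>At a level common to \<sigma> and its faces, the boundary term of
  \<open>vanishing_cocycle_eq\<close> is the contraction evaluated on the boundary of \<sigma>, up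
  to two inverses that cancel.\<close>

lemma vanishing_cocycle_Suc:
  assumes \<omega>: "\<omega> \<in> vanishing_cochains (Suc p)"
    and cocycle: "coboundary (Suc p) (mt_topo X) G \<omega> = \<one>\<^bsub>singular_cochain_group (Suc (Suc p)) (mt_topo X) G\<^esub>"
  shows "coboundary p (mt_topo X) G (contraction p \<omega>) = \<omega>"
proof (rule cochain_eqI[OF coboundary_closed vanishing_carrier[OF \<omega>]])
  show K: "contraction p \<omega> \<in> carrier (singular_cochain_group p (mt_topo X) G)"
    by (rule vanishing_carrier[OF contraction_vanishing[OF \<omega>]])
  fix \<sigma> assume \<sigma>: "singular_simplex (Suc p) (mt_topo X) \<sigma>"
  let ?b = "chain_boundary (Suc p) (frag_of \<sigma>)"
  have b: "singular_chain p (mt_topo X) ?b"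
    using \<sigma> by (intro singular_chain_boundary_alt) (simp add: singular_chain_of)
  \<comment> \<open>The bound at \<sigma> makes \<open>vanishing_cocycle_eq\<close> applicable, the
    bounds at the faces \<open>chain_eval_iterated_homotopy\<close>.\<close>
  obtain m where m: "\<And>l. l \<in> insert (subdivision_level U V (Suc p) \<sigma>) (subdivision_level U V p ` Poly_Mapping.keys ?b) \<Longrightarrow> l \<le> m"
    using finite_nat_set_iff_bounded_le[of "insert (subdivision_level U V (Suc p) \<sigma>) (subdivision_level U V p ` Poly_Mapping.keys ?b)"]
    by auto
  have KPi: "contraction p \<omega> \<in> Poly_Mapping.keys ?b \<rightarrow> carrier G" using K b by (rule cochain_Pi)
  have inv_hom: "(\<lambda>a. inv a) \<in> hom G G" by (rule homI) (auto simp: inv_mult)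
  have "chain_eval G \<omega> (iterated_homotopy m p ?b) =
      chain_eval G (\<lambda>\<tau>. chain_eval G \<omega> (iterated_homotopy m p (frag_of \<tau>))) ?b"
    using b vanishing_carrier[OF \<omega>]
    by (rule chain_eval_linear) (simp_all add: iterated_homotopy_diff singular_chain_iterated_homotopy)
  also have "\<dots> = chain_eval G (\<lambda>\<tau>. inv (contraction p \<omega> \<tau>)) ?b"
  proof (rule chain_eval_cong[symmetric])
    show "(\<lambda>\<tau>. inv (contraction p \<omega> \<tau>)) \<in> Poly_Mapping.keys ?b \<rightarrow> carrier G" using KPi by auto
    fix \<tau> assume "\<tau> \<in> Poly_Mapping.keys ?b"
    then show "inv (contraction p \<omega> \<tau>) = chain_eval G \<omega> (iterated_homotopy m p (frag_of \<tau>))"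
      using m b by (intro chain_eval_iterated_homotopy[OF \<omega>, symmetric]) (auto simp: singular_chain_def)
  qed
  also have "\<dots> = inv (chain_eval G (contraction p \<omega>) ?b)"
    using inv_hom KPi by (rule chain_eval_hom)
  finally have "\<omega> \<sigma> = inv (inv (chain_eval G (contraction p \<omega>) ?b))"
    using vanishing_cocycle_eq[OF \<omega> cocycle \<sigma>, of m] m by simp
  then show "coboundary p (mt_topo X) G (contraction p \<omega>) \<sigma> = \<omega> \<sigma>"
    using \<sigma> KPi by (simp add: coboundary_eq[OF K])
qed

end

section \<open>Maps induced on subquotients\<close>

text \<open>Two members of a coset of \<open>B\<close> differ by an element of \<open>B\<close>,
  whose image lies in \<open>B'\<close>. The set of image cosets is therefore a singleton, as
  \<open>the_elem\<close> requires.\<close>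

lemma the_elem_coset_image:
  assumes C: "group C" and D: "group D" and B: "subgroup B C" and B': "subgroup B' D"
    and \<phi>: "\<phi> \<in> hom C D" "\<phi> ` B \<subseteq> B'" and a: "a \<in> carrier C"
  shows "the_elem ((\<lambda>x. B' #>\<^bsub>D\<^esub> \<phi> x) ` (B #>\<^bsub>C\<^esub> a)) = B' #>\<^bsub>D\<^esub> \<phi> a"
proof -
  have "B' #>\<^bsub>D\<^esub> \<phi> (b \<otimes>\<^bsub>C\<^esub> a) = B' #>\<^bsub>D\<^esub> \<phi> a" if b: "b \<in> B" for b
  proof -
    have b': "\<phi> b \<in> B'" "b \<in> carrier C" using \<phi>(2) b subgroup.mem_carrier[OF B] by auto
    have c: "\<phi> b \<in> carrier D" "\<phi> a \<in> carrier D" using \<phi>(1) b' a by (auto simp: hom_def)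
    have "B' #>\<^bsub>D\<^esub> \<phi> (b \<otimes>\<^bsub>C\<^esub> a) = (B' #>\<^bsub>D\<^esub> \<phi> b) #>\<^bsub>D\<^esub> \<phi> a"
      using group.coset_mult_assoc[OF D subgroup.subset[OF B'] c] hom_mult[OF \<phi>(1) b'(2) a] by simp
    also have "B' #>\<^bsub>D\<^esub> \<phi> b = B'"
      using group.coset_join2[OF D c(1) B' b'(1)] .
    finally show ?thesis .
  qed
  moreover have "a \<in> B #>\<^bsub>C\<^esub> a" using group.rcos_self[OF C a B] .
  ultimately have "(\<lambda>x. B' #>\<^bsub>D\<^esub> \<phi> x) ` (B #>\<^bsub>C\<^esub> a) = {B' #>\<^bsub>D\<^esub> \<phi> a}"
    by (auto simp: r_coset_def)
  then show ?thesis by simp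
qed

text \<open>The first isomorphism theorem for the map from \<open>Z\<close> onto \<open>Z'\<close>
  modulo \<open>B'\<close>, whose kernel is \<open>B\<close>. The induced map in
  \<open>FactGroup_iso_set\<close> already has the shape of
  \<open>cohomology_pullback\<close>.\<close>

lemma subquotient_iso:
  assumes C: "comm_group C" and D: "comm_group D"
    and sub: "subgroup Z C" "subgroup B C" "B \<subseteq> Z" "subgroup Z' D" "subgroup B' D" "B' \<subseteq> Z'"
    and \<phi>: "\<phi> \<in> hom C D" "\<phi> ` Z = Z'" "\<And>a. a \<in> Z \<Longrightarrow> \<phi> a \<in> B' \<longleftrightarrow> a \<in> B"
  shows "(\<lambda>c. the_elem ((\<lambda>a. B' #>\<^bsub>D\<^esub> \<phi> a) ` c)) \<in> iso (C\<lparr>carrier := Z\<rparr> Mod B) (D\<lparr>carrier := Z'\<rparr> Mod B')"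
proof -
  let ?A = "C\<lparr>carrier := Z\<rparr>" and ?A' = "D\<lparr>carrier := Z'\<rparr>"
  let ?q = "\<lambda>a. B' #>\<^bsub>D\<^esub> \<phi> a"
  have gC: "group C" and gD: "group D" using C D by (simp_all add: comm_group_def)
  interpret A': comm_group ?A'
    using subgroup.subgroup_is_group[OF sub(4) gD]
    by (rule group.group_comm_groupI)
       (simp add: comm_monoid.m_comm[OF comm_group.axioms(1)[OF D]] subgroup.mem_carrier[OF sub(4)])
  have gA: "group ?A" using subgroup.subgroup_is_group[OF sub(1) gC] .
  have nB': "B' \<lhd> ?A'"
    using A'.normal_iff_subgroup group.subgroup_incl[OF gD sub(5,4,6)] by blast
  interpret N: normal B' ?A' by (rule nB')
  \<comment> \<open>Cosets depend on the multiplication only, which a change of carrier leaves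
    alone.\<close>
  have cos: "B' #>\<^bsub>?A'\<^esub> x = B' #>\<^bsub>D\<^esub> x" for x by (simp add: r_coset_def)
  have "\<phi> \<in> hom ?A ?A'" using \<phi>(1,2) subgroup.subset[OF sub(1)] by (auto simp: hom_def)
  from hom_compose[OF this N.r_coset_hom_Mod]
  have q: "?q \<in> hom ?A (?A' Mod B')" by (simp add: comp_def cos)
  interpret q: group_hom ?A "?A' Mod B'" ?q
    using gA N.factorgroup_is_group q by (simp add: group_hom_def group_hom_axioms_def)
  have "?q a = B' \<longleftrightarrow> a \<in> B" if a: "a \<in> Z" for a
  proof -
    have c: "\<phi> a \<in> carrier D" using \<phi>(2) a subgroup.subset[OF sub(4)] by auto
    have "?q a = B' \<longleftrightarrow> \<phi> a \<in> B'"
      using group.coset_join1[OF gD _ c sub(5)] group.coset_join2[OF gD c sub(5)] by blast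
    then show ?thesis using \<phi>(3)[OF a] by simp
  qed
  then have "kernel ?A (?A' Mod B') ?q = B"
    using sub(3) by (auto simp: kernel_def FactGroup_def)
  moreover have "?q ` carrier ?A = carrier (?A' Mod B')"
  proof -
    have "carrier (?A' Mod B') = (\<lambda>b. B' #>\<^bsub>D\<^esub> b) ` Z'" by (auto simp: FactGroup_def RCOSETS_def cos)
    then show ?thesis using \<phi>(2) by (auto simp: image_image)
  qed
  ultimately show ?thesis using q.FactGroup_iso_set by simp
qed

text \<open>The parameter space carries the discrete topology, so a map of parameters is
  automatically continuous and measurability is all that has to be asked of
  \<open>r\<close>.\<close>

lemma measurable_simplex_reparametrize:
  assumes \<sigma>: "measurable_singular_simplex n T X \<sigma>" and r: "r \<in> T \<rightarrow>\<^sub>M T"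
  shows "measurable_singular_simplex n T X (\<lambda>(x, t). \<sigma> (x, r t))"
proof -
  let ?K = "standard_simplex_topology n"
  have \<sigma>': "standard_borel_space T" "\<sigma> \<in> borel_of_topology ?K \<Otimes>\<^sub>M T \<rightarrow>\<^sub>M mt_meas X"
      "continuous_map (prod_topology ?K (discrete_topology (space T))) (mt_topo X) \<sigma>"
    using \<sigma> by (auto simp: measurable_singular_simplex_def mt_map_def mt_product_def)
  have "(\<lambda>z. (fst z, r (snd z))) \<in> borel_of_topology ?K \<Otimes>\<^sub>M T \<rightarrow>\<^sub>M borel_of_topology ?K \<Otimes>\<^sub>M T"
    by (intro measurable_Pair measurable_fst measurable_compose[OF measurable_snd r])
  from measurable_compose[OF this \<sigma>'(2)]
  have 1: "(\<lambda>z. \<sigma> (fst z, r (snd z))) \<in> borel_of_topology ?K \<Otimes>\<^sub>M T \<rightarrow>\<^sub>M mt_meas X" .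
  have "continuous_map (discrete_topology (space T)) (discrete_topology (space T)) r"
    using measurable_space[OF r] by auto
  from continuous_map_compose[OF continuous_map_snd this]
  have "continuous_map (prod_topology ?K (discrete_topology (space T)))
      (prod_topology ?K (discrete_topology (space T))) (\<lambda>z. (fst z, r (snd z)))"
    by (simp add: continuous_map_paired continuous_map_fst comp_def)
  from continuous_map_compose[OF this \<sigma>'(3)]
  have 2: "continuous_map (prod_topology ?K (discrete_topology (space T))) (mt_topo X) (\<lambda>z. \<sigma> (fst z, r (snd z)))"
    by (simp add: comp_def)
  have "(\<lambda>(x, t). \<sigma> (x, r t)) = (\<lambda>z. \<sigma> (fst z, r (snd z)))" by auto
  then show ?thesis
    using 1 2 \<sigma>'(1) by (simp add: measurable_singular_simplex_def mt_map_def mt_product_def)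
qed

lemma mt_topo_subspace [simp]: "mt_topo (mt_subspace X V) = subtopology (mt_topo X) V"
  by (simp add: mt_subspace_def)

section \<open>Restriction to \<open>V\<close> and extension from \<open>V\<close>\<close>

context measurable_excision
begin

abbreviation restriction :: "nat \<Rightarrow> (((nat \<Rightarrow> real) \<Rightarrow> 'a) \<Rightarrow> 'g) \<Rightarrow> ((nat \<Rightarrow> real) \<Rightarrow> 'a) \<Rightarrow> 'g" where
  "restriction n \<equiv> cochain_pullback n (subtopology (mt_topo X) V) id"

definition extension_by_one :: "nat \<Rightarrow> (((nat \<Rightarrow> real) \<Rightarrow> 'a) \<Rightarrow> 'g) \<Rightarrow> ((nat \<Rightarrow> real) \<Rightarrow> 'a) \<Rightarrow> 'g" where
  "extension_by_one n \<eta> = (\<lambda>\<sigma>\<in>singular_simplex_set n (mt_topo X).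
     if \<sigma> ` standard_simplex n \<subseteq> V then \<eta> \<sigma> else \<one>)"

lemma restriction_eq: "restriction n \<omega> = (\<lambda>\<sigma>\<in>singular_simplex_set n (subtopology (mt_topo X) V). \<omega> \<sigma>)"
  unfolding cochain_pullback_def
  by (rule restrict_ext) (metis id_apply mem_Collect_eq simplex_map_id_gen)

lemma restriction_apply: "singular_simplex n (subtopology (mt_topo X) V) \<sigma> \<Longrightarrow> restriction n \<omega> \<sigma> = \<omega> \<sigma>"
  by (simp add: restriction_eq)

lemma restriction_hom:
  "restriction n \<in> hom (singular_cochain_group n (mt_topo X) G) (singular_cochain_group n (subtopology (mt_topo X) V) G)"
proof (rule homI)
  fix \<omega> assume "\<omega> \<in> carrier (singular_cochain_group n (mt_topo X) G)"
  then show "restriction n \<omega> \<in> carrier (singular_cochain_group n (subtopology (mt_topo X) V) G)"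
    by (auto simp: restriction_eq carrier_cochain_group singular_simplex_subtopology)
next
  fix \<omega> \<eta>
  show "restriction n (\<omega> \<otimes>\<^bsub>singular_cochain_group n (mt_topo X) G\<^esub> \<eta>) =
      restriction n \<omega> \<otimes>\<^bsub>singular_cochain_group n (subtopology (mt_topo X) V) G\<^esub> restriction n \<eta>"
    unfolding restriction_eq mult_cochain_group
    by (rule restrict_ext) (simp add: singular_simplex_subtopology)
qed

lemma restriction_group_hom:
  "group_hom (singular_cochain_group n (mt_topo X) G) (singular_cochain_group n (subtopology (mt_topo X) V) G) (restriction n)"
  by (simp add: group_hom_def group_hom_axioms_def cochain_group_group restriction_hom)

lemma restriction_coboundary:
  assumes \<omega>: "\<omega> \<in> carrier (singular_cochain_group n (mt_topo X) G)"
  shows "restriction (Suc n) (coboundary n (mt_topo X) G \<omega>) =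
    coboundary n (subtopology (mt_topo X) V) G (restriction n \<omega>)"
proof -
  have r: "restriction n \<omega> \<in> carrier (singular_cochain_group n (subtopology (mt_topo X) V) G)"
    using restriction_hom \<omega> by (rule hom_in_carrier)
  show ?thesis
    unfolding restriction_eq[of "Suc n"] coboundary_eq[OF r]
  proof (rule restrict_ext)
    fix \<sigma> assume "\<sigma> \<in> singular_simplex_set (Suc n) (subtopology (mt_topo X) V)"
    then have \<sigma>: "singular_simplex (Suc n) (subtopology (mt_topo X) V) \<sigma>" by simp
    let ?c = "chain_boundary (Suc n) (frag_of \<sigma>)"
    have c: "singular_chain n (subtopology (mt_topo X) V) ?c"
      using \<sigma> by (intro singular_chain_boundary_alt) (simp add: singular_chain_of)
    have "chain_eval G (restriction n \<omega>) ?c = chain_eval G \<omega> ?c"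
      using cochain_Pi[OF r c] c by (intro chain_eval_cong) (auto simp: singular_chain_def restriction_apply)
    then show "coboundary n (mt_topo X) G \<omega> \<sigma> = chain_eval G (restriction n \<omega>) ?c"
      using \<sigma> by (simp add: coboundary_eq[OF \<omega>] singular_simplex_subtopology)
  qed
qed

lemma restriction_rel_measurable:
  assumes \<omega>: "\<omega> \<in> rel_measurable_cochains n X U G M"
  shows "restriction n \<omega> \<in> rel_measurable_cochains n (mt_subspace X V) (U \<inter> V) G M"
proof -
  have \<omega>m: "\<omega> \<in> measurable_cochains n X G M" using \<omega> by (simp add: rel_measurable_cochains_def)
  have "(\<lambda>\<sigma>\<in>singular_simplex_set n (mt_topo (mt_subspace X V)). \<omega> \<sigma>) \<in> measurable_cochains n (mt_subspace X V) G M"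
  proof (rule measurable_cochainsI)
    fix \<sigma> assume "singular_simplex n (mt_topo (mt_subspace X V)) \<sigma>"
    then show "\<omega> \<sigma> \<in> carrier G"
      by (intro measurable_cochain_closed[OF \<omega>m]) (simp add: singular_simplex_subtopology)
  next
    fix T \<sigma> assume "measurable_singular_simplex n T (mt_subspace X V) \<sigma>"
    then show "(\<lambda>t. \<omega> (\<lambda>x\<in>standard_simplex n. \<sigma> (x, t))) \<in> T \<rightarrow>\<^sub>M M"
      by (rule measurable_cochainD[OF \<omega>m measurable_simplex_ambient])
  qed
  then have "restriction n \<omega> \<in> measurable_cochains n (mt_subspace X V) G M"
    by (simp add: restriction_eq)
  then show ?thesis
    using \<omega> by (auto simp: rel_measurable_cochains_def restriction_eq singular_simplex_subtopology)
qed

text \<open>For a family in \<open>X\<close> the parameters whose simplex lies in \<open>V\<close>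
  form a measurable set \<open>T'\<close>, but \<eta> can be tested only on families that stay in
  \<open>V\<close> for every parameter. So the family is altered outside \<open>T'\<close>, where
  the extension ignores it. On simplices in \<open>U\<close> the extension is neutral, as those that
  also lie in \<open>V\<close> lie in \<open>U \<inter> V\<close>.\<close>

lemma extension_rel_measurable:
  assumes \<eta>: "\<eta> \<in> rel_measurable_cochains n (mt_subspace X V) (U \<inter> V) G M"
  shows "extension_by_one n \<eta> \<in> rel_measurable_cochains n X U G M"
proof -
  have \<eta>m: "\<eta> \<in> measurable_cochains n (mt_subspace X V) G M" using \<eta> by (simp add: rel_measurable_cochains_def)
  have "extension_by_one n \<eta> \<in> measurable_cochains n X G M"
    unfolding extension_by_one_def
  proof (rule measurable_cochainsI)
    fix \<sigma> assume "singular_simplex n (mt_topo X) \<sigma>"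
    then show "(if \<sigma> ` standard_simplex n \<subseteq> V then \<eta> \<sigma> else \<one>) \<in> carrier G"
      using measurable_cochain_closed[OF \<eta>m, of \<sigma>] by (simp add: singular_simplex_subtopology)
  next
    fix T \<sigma> assume \<sigma>: "measurable_singular_simplex n T X \<sigma>"
    let ?s = "\<lambda>t. \<lambda>x\<in>standard_simplex n. \<sigma> (x, t)"
    define T' where "T' = {t \<in> space T. \<forall>x\<in>standard_simplex n. \<sigma> (x, t) \<in> V}"
    have T': "T' \<in> sets T" unfolding T'_def using \<sigma> V by (rule simplex_in_open_measurable)
    have inV: "?s t ` standard_simplex n \<subseteq> V \<longleftrightarrow> t \<in> T'" if "t \<in> space T" for t
      using that by (auto simp: T'_def)
    show "(\<lambda>t. if ?s t ` standard_simplex n \<subseteq> V then \<eta> (?s t) else \<one>) \<in> T \<rightarrow>\<^sub>M M"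
    proof (cases "T' = {}")
      \<comment> \<open>There is no parameter to redirect to, but then the extension is constantly
        neutral on the family.\<close>
      case True
      show ?thesis
        using measurable_one by (rule measurable_congI) (simp only: inV True empty_iff if_False)
    next
      case False
      then obtain t0 where t0: "t0 \<in> T'" by blast
      \<comment> \<open>The parameters outside \<open>T'\<close> are redirected to \<open>t0\<close> to get a measurable simplex in \<open>V\<close>.\<close>
      define r where "r t = (if t \<in> T' then t else t0)" for t
      have rT': "r t \<in> T'" for t using t0 by (simp add: r_def)
      have "t0 \<in> space T" using t0 by (simp add: T'_def)
      then have r: "r \<in> T \<rightarrow>\<^sub>M T"
        unfolding r_def using T' by (intro measurable_If_set) auto
      have "measurable_singular_simplex n T (mt_subspace X V) (\<lambda>(x, t). \<sigma> (x, r t))"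
        using measurable_simplex_reparametrize[OF \<sigma> r]
        by (rule measurable_simplex_subspace) (use rT' in \<open>auto simp: T'_def\<close>)
      from measurable_cochainD[OF \<eta>m this]
      have "(\<lambda>t. \<eta> (?s (r t))) \<in> T \<rightarrow>\<^sub>M M" by simp
      then have "(\<lambda>t. if t \<in> T' then \<eta> (?s (r t)) else \<one>) \<in> T \<rightarrow>\<^sub>M M"
        using T' by (intro measurable_If_set measurable_one) auto
      then show ?thesis
        by (rule measurable_congI) (simp only: inV r_def if_True cong: if_cong)
    qed
  qed
  moreover have "extension_by_one n \<eta> \<sigma> = \<one>" if "singular_simplex n (subtopology (mt_topo X) U) \<sigma>" for \<sigma>
    using that \<eta> by (auto simp: extension_by_one_def rel_measurable_cochains_def singular_simplex_subtopology)
  ultimately show ?thesis by (simp add: rel_measurable_cochains_def)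
qed

lemma restriction_extension:
  assumes \<eta>: "\<eta> \<in> carrier (singular_cochain_group n (subtopology (mt_topo X) V) G)"
  shows "restriction n (extension_by_one n \<eta>) = \<eta>"
proof
  fix \<sigma>
  show "restriction n (extension_by_one n \<eta>) \<sigma> = \<eta> \<sigma>"
    using \<eta> by (cases "singular_simplex n (subtopology (mt_topo X) V) \<sigma>")
      (auto simp: restriction_eq extension_by_one_def singular_simplex_subtopology carrier_cochain_group PiE_def extensional_def)
qed

lemma restriction_one_imp_vanishing:
  assumes \<omega>: "\<omega> \<in> rel_measurable_cochains n X U G M"
    and one: "restriction n \<omega> = \<one>\<^bsub>singular_cochain_group n (subtopology (mt_topo X) V) G\<^esub>"
  shows "\<omega> \<in> vanishing_cochains n"
proof -
  have "\<omega> \<sigma> = \<one>" if \<sigma>: "singular_simplex n (subtopology (mt_topo X) V) \<sigma>" for \<sigma>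
    using fun_cong[OF one, of \<sigma>] \<sigma> by (simp add: restriction_apply one_cochain_group)
  then show ?thesis using \<omega> by (simp add: vanishing_cochains_def rel_measurable_cochains_def)
qed

lemma vanishing_restriction:
  assumes "\<omega> \<in> vanishing_cochains n"
  shows "restriction n \<omega> = \<one>\<^bsub>singular_cochain_group n (subtopology (mt_topo X) V) G\<^esub>"
  unfolding restriction_eq one_cochain_group
  using assms by (intro restrict_ext) (auto simp: vanishing_cochains_def rel_measurable_cochains_def)

lemma rel_carrier:
  "\<omega> \<in> rel_measurable_cochains n Y W G M \<Longrightarrow> \<omega> \<in> carrier (singular_cochain_group n (mt_topo Y) G)"
  by (rule subgroup.mem_carrier[OF subgroup_rel_measurable_cochains])

lemma restriction_cocycles:
  assumes \<omega>: "\<omega> \<in> rel_measurable_cocycles n X U G M"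
  shows "restriction n \<omega> \<in> rel_measurable_cocycles n (mt_subspace X V) (U \<inter> V) G M"
proof -
  have rel: "\<omega> \<in> rel_measurable_cochains n X U G M"
    and cocycle: "coboundary n (mt_topo X) G \<omega> = \<one>\<^bsub>singular_cochain_group (Suc n) (mt_topo X) G\<^esub>"
    using \<omega> by (simp_all add: rel_measurable_cocycles_def)
  show ?thesis
    using restriction_rel_measurable[OF rel] restriction_coboundary[OF rel_carrier[OF rel]]
      group_hom.hom_one[OF restriction_group_hom]
    by (simp add: rel_measurable_cocycles_def cocycle)
qed

text \<open>The coboundary \<zeta> of the extended \<eta> restricts to the coboundary of \<eta>,
  which is neutral, so \<zeta> lies in the kernel. There it is the coboundary of some \<nu>, and
  dividing the extension by \<nu> gives a cocycle with the same restriction.\<close>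

lemma restriction_cocycles_surj:
  assumes \<eta>: "\<eta> \<in> rel_measurable_cocycles n (mt_subspace X V) (U \<inter> V) G M"
  shows "\<exists>\<omega> \<in> rel_measurable_cocycles n X U G M. restriction n \<omega> = \<eta>"
proof -
  let ?C = "\<lambda>n. singular_cochain_group n (mt_topo X) G"
  interpret d: group_hom "?C n" "?C (Suc n)" "coboundary n (mt_topo X) G" by (rule coboundary_group_hom)
  interpret r: group_hom "?C n" "singular_cochain_group n (subtopology (mt_topo X) V) G" "restriction n"
    by (rule restriction_group_hom)
  have \<eta>r: "\<eta> \<in> rel_measurable_cochains n (mt_subspace X V) (U \<inter> V) G M"
    and cocycle: "coboundary n (subtopology (mt_topo X) V) G \<eta> = \<one>\<^bsub>singular_cochain_group (Suc n) (subtopology (mt_topo X) V) G\<^esub>"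
    using \<eta> by (simp_all add: rel_measurable_cocycles_def)
  have \<eta>c: "\<eta> \<in> carrier (singular_cochain_group n (subtopology (mt_topo X) V) G)"
    using rel_carrier[OF \<eta>r] by simp
  define \<omega>0 where "\<omega>0 = extension_by_one n \<eta>"
  define \<zeta> where "\<zeta> = coboundary n (mt_topo X) G \<omega>0"
  have \<omega>0: "\<omega>0 \<in> rel_measurable_cochains n X U G M"
    unfolding \<omega>0_def using \<eta>r by (rule extension_rel_measurable)
  note \<omega>0c = rel_carrier[OF \<omega>0]
  have r\<omega>0: "restriction n \<omega>0 = \<eta>" unfolding \<omega>0_def using \<eta>c by (rule restriction_extension)
  have \<zeta>: "\<zeta> \<in> vanishing_cochains (Suc n)"
    unfolding \<zeta>_def using coboundary_rel_measurable[OF \<omega>0]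
    by (rule restriction_one_imp_vanishing) (simp add: restriction_coboundary[OF \<omega>0c] r\<omega>0 cocycle)
  define \<nu> where "\<nu> = contraction n \<zeta>"
  have \<nu>: "\<nu> \<in> vanishing_cochains n" unfolding \<nu>_def using \<zeta> by (rule contraction_vanishing)
  note \<nu>c = vanishing_carrier[OF \<nu>]
  have d\<nu>: "coboundary n (mt_topo X) G \<nu> = \<zeta>"
    unfolding \<nu>_def using \<zeta> by (rule vanishing_cocycle_Suc) (simp add: \<zeta>_def coboundary_coboundary[OF \<omega>0c])
  define \<omega> where "\<omega> = \<omega>0 \<otimes>\<^bsub>?C n\<^esub> inv\<^bsub>?C n\<^esub> \<nu>"
  have "\<nu> \<in> rel_measurable_cochains n X U G M" using \<nu> by (simp add: vanishing_cochains_def)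
  then have "\<omega> \<in> rel_measurable_cochains n X U G M"
    unfolding \<omega>_def using \<omega>0 subgroup_rel_measurable_cochains
    by (meson subgroup.m_closed subgroup.m_inv_closed)
  moreover have "coboundary n (mt_topo X) G \<omega> = \<one>\<^bsub>?C (Suc n)\<^esub>"
  proof -
    have "coboundary n (mt_topo X) G \<omega> = \<zeta> \<otimes>\<^bsub>?C (Suc n)\<^esub> inv\<^bsub>?C (Suc n)\<^esub> \<zeta>"
      unfolding \<omega>_def using \<omega>0c \<nu>c by (simp add: d\<nu> \<zeta>_def[symmetric])
    also have "\<dots> = \<one>\<^bsub>?C (Suc n)\<^esub>"
      using vanishing_carrier[OF \<zeta>] by (rule d.H.r_inv)
    finally show ?thesis .
  qed
  moreover have "restriction n \<omega> = \<eta>"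
  proof -
    have "restriction n \<omega> = restriction n \<omega>0 \<otimes>\<^bsub>singular_cochain_group n (subtopology (mt_topo X) V) G\<^esub>
        inv\<^bsub>singular_cochain_group n (subtopology (mt_topo X) V) G\<^esub> restriction n \<nu>"
      unfolding \<omega>_def using \<omega>0c \<nu>c by simp
    then show ?thesis using \<eta>c by (simp add: r\<omega>0 vanishing_restriction[OF \<nu>])
  qed
  ultimately show ?thesis by (auto simp: rel_measurable_cocycles_def)
qed

lemma restriction_coboundaries:
  assumes "\<omega> \<in> rel_measurable_coboundaries n X U G M"
  shows "restriction n \<omega> \<in> rel_measurable_coboundaries n (mt_subspace X V) (U \<inter> V) G M"
proof (cases n)
  case 0
  then show ?thesis
    using assms group_hom.hom_one[OF restriction_group_hom] by (simp add: rel_measurable_coboundaries_def)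
next
  case (Suc m)
  then obtain \<xi> where "\<xi> \<in> rel_measurable_cochains m X U G M" "\<omega> = coboundary m (mt_topo X) G \<xi>"
    using assms by (auto simp: rel_measurable_coboundaries_def)
  then show ?thesis
    using Suc restriction_coboundary[OF rel_carrier] restriction_rel_measurable
    by (auto simp: rel_measurable_coboundaries_def)
qed

text \<open>If the restriction is the coboundary of \<xi>, then \<omega> divided by the coboundary
  of the extended \<xi> is a cocycle in the kernel, hence a coboundary; multiplying back shows the
  same for \<omega>. Degree 0 is separate, as its coboundaries are trivial by definition.\<close>

lemma restriction_coboundary_imp_coboundary:
  assumes \<omega>: "\<omega> \<in> rel_measurable_cocycles n X U G M"
    and r\<omega>: "restriction n \<omega> \<in> rel_measurable_coboundaries n (mt_subspace X V) (U \<inter> V) G M"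
  shows "\<omega> \<in> rel_measurable_coboundaries n X U G M"
proof -
  let ?C = "\<lambda>n. singular_cochain_group n (mt_topo X) G"
  have rel: "\<omega> \<in> rel_measurable_cochains n X U G M"
    and cocycle: "coboundary n (mt_topo X) G \<omega> = \<one>\<^bsub>?C (Suc n)\<^esub>"
    using \<omega> by (simp_all add: rel_measurable_cocycles_def)
  show ?thesis
  proof (cases n)
    case 0
    then have "restriction 0 \<omega> = \<one>\<^bsub>singular_cochain_group 0 (subtopology (mt_topo X) V) G\<^esub>"
      using r\<omega> by (simp add: rel_measurable_coboundaries_def)
    then have "\<omega> \<in> vanishing_cochains 0"
      using restriction_one_imp_vanishing rel 0 by blast
    then have "\<omega> = \<one>\<^bsub>?C 0\<^esub>"
      by (rule vanishing_cocycle_0) (use cocycle 0 in simp)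
    then show ?thesis using 0 by (simp add: rel_measurable_coboundaries_def)
  next
    case (Suc m)
    interpret d: group_hom "?C m" "?C n" "coboundary m (mt_topo X) G"
      unfolding Suc by (rule coboundary_group_hom)
    interpret d': group_hom "?C n" "?C (Suc n)" "coboundary n (mt_topo X) G"
      by (rule coboundary_group_hom)
    interpret r: group_hom "?C n" "singular_cochain_group n (subtopology (mt_topo X) V) G" "restriction n"
      by (rule restriction_group_hom)
    obtain \<xi> where \<xi>: "\<xi> \<in> rel_measurable_cochains m (mt_subspace X V) (U \<inter> V) G M"
      and r\<omega>\<xi>: "restriction n \<omega> = coboundary m (subtopology (mt_topo X) V) G \<xi>"
      using r\<omega> Suc by (auto simp: rel_measurable_coboundaries_def)
    have \<xi>c: "\<xi> \<in> carrier (singular_cochain_group m (subtopology (mt_topo X) V) G)"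
      using rel_carrier[OF \<xi>] by simp
    let ?e = "extension_by_one m \<xi>"
    have e: "?e \<in> rel_measurable_cochains m X U G M" using \<xi> by (rule extension_rel_measurable)
    note ec = rel_carrier[OF e] and \<omega>c = rel_carrier[OF rel]
    have de: "coboundary m (mt_topo X) G ?e \<in> rel_measurable_cochains n X U G M"
      using coboundary_rel_measurable[OF e] Suc by simp
    note dec = rel_carrier[OF de]
    define \<zeta> where "\<zeta> = \<omega> \<otimes>\<^bsub>?C n\<^esub> inv\<^bsub>?C n\<^esub> coboundary m (mt_topo X) G ?e"
    have \<zeta>rel: "\<zeta> \<in> rel_measurable_cochains n X U G M"
      unfolding \<zeta>_def using rel de subgroup_rel_measurable_cochains
      by (meson subgroup.m_closed subgroup.m_inv_closed)
    have "restriction n (coboundary m (mt_topo X) G ?e) = restriction n \<omega>"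
      using restriction_coboundary[OF ec] restriction_extension[OF \<xi>c] r\<omega>\<xi> Suc by simp
    then have "restriction n \<zeta> = \<one>\<^bsub>singular_cochain_group n (subtopology (mt_topo X) V) G\<^esub>"
      unfolding \<zeta>_def using \<omega>c dec r.hom_closed[OF \<omega>c] by simp
    with \<zeta>rel have \<zeta>: "\<zeta> \<in> vanishing_cochains n" by (rule restriction_one_imp_vanishing)
    have "coboundary n (mt_topo X) G (coboundary m (mt_topo X) G ?e) = \<one>\<^bsub>?C (Suc n)\<^esub>"
      using coboundary_coboundary[OF ec] Suc by simp
    then have "coboundary n (mt_topo X) G \<zeta> = \<one>\<^bsub>?C (Suc n)\<^esub>"
      unfolding \<zeta>_def using \<omega>c dec cocycle by simp
    then have \<nu>: "coboundary m (mt_topo X) G (contraction m \<zeta>) = \<zeta>"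
      using vanishing_cocycle_Suc \<zeta> Suc by simp
    have K: "contraction m \<zeta> \<in> vanishing_cochains m"
      using \<zeta> Suc by (simp add: contraction_vanishing)
    have "\<omega> = \<zeta> \<otimes>\<^bsub>?C n\<^esub> coboundary m (mt_topo X) G ?e"
      unfolding \<zeta>_def using \<omega>c dec by (simp add: d.H.m_assoc)
    also have "\<dots> = coboundary m (mt_topo X) G (contraction m \<zeta> \<otimes>\<^bsub>?C m\<^esub> ?e)"
      using d.hom_mult[OF vanishing_carrier[OF K] ec] \<nu> by simp
    finally have "\<omega> = coboundary m (mt_topo X) G (contraction m \<zeta> \<otimes>\<^bsub>?C m\<^esub> ?e)" .
    moreover have "contraction m \<zeta> \<otimes>\<^bsub>?C m\<^esub> ?e \<in> rel_measurable_cochains m X U G M"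
      using K e subgroup.m_closed[OF subgroup_rel_measurable_cochains] by (auto simp: vanishing_cochains_def)
    ultimately show ?thesis using Suc by (simp add: rel_measurable_coboundaries_def)
  qed
qed

lemma cohomology_pullback_eq:
  "cohomology_pullback n (mt_subspace X V) (U \<inter> V) G M id c =
    the_elem ((\<lambda>\<omega>. rel_measurable_coboundaries n (mt_subspace X V) (U \<inter> V) G M
      #>\<^bsub>singular_cochain_group n (subtopology (mt_topo X) V) G\<^esub> restriction n \<omega>) ` c)"
  by (simp add: cohomology_pullback_def cohomology_class_def)

lemma subgroup_cocycles_subspace:
  "subgroup (rel_measurable_cocycles n (mt_subspace X V) W G M) (singular_cochain_group n (subtopology (mt_topo X) V) G)"
  using subgroup_rel_measurable_cocycles[of n "mt_subspace X V"] by simp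

lemma subgroup_coboundaries_subspace:
  "subgroup (rel_measurable_coboundaries n (mt_subspace X V) W G M) (singular_cochain_group n (subtopology (mt_topo X) V) G)"
  using subgroup_rel_measurable_coboundaries[of n "mt_subspace X V"] by simp

theorem excision_iso:
  "cohomology_pullback n (mt_subspace X V) (U \<inter> V) G M id \<in>
     iso (rel_measurable_cohomology n X U G M) (rel_measurable_cohomology n (mt_subspace X V) (U \<inter> V) G M)"
  unfolding rel_measurable_cohomology_def mt_topo_subspace
    ext[of "cohomology_pullback n (mt_subspace X V) (U \<inter> V) G M id", OF cohomology_pullback_eq]
proof (rule subquotient_iso[OF cochain_group_comm_group cochain_group_comm_group subgroup_rel_measurable_cocycles
      subgroup_rel_measurable_coboundaries rel_measurable_coboundaries_subset subgroup_cocycles_subspace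
      subgroup_coboundaries_subspace rel_measurable_coboundaries_subset restriction_hom])
  show "restriction n ` rel_measurable_cocycles n X U G M =
      rel_measurable_cocycles n (mt_subspace X V) (U \<inter> V) G M"
    using restriction_cocycles restriction_cocycles_surj by (auto simp: image_iff) metis
  show "restriction n \<omega> \<in> rel_measurable_coboundaries n (mt_subspace X V) (U \<inter> V) G M \<longleftrightarrow>
      \<omega> \<in> rel_measurable_coboundaries n X U G M" if "\<omega> \<in> rel_measurable_cocycles n X U G M" for \<omega>
    using that restriction_coboundaries restriction_coboundary_imp_coboundary by blast
qed

end

section \<open>Scalar actions on cohomology\<close>

context measurable_coefficients
begin

text \<open>For a ring of coefficients, \<open>e\<close> will be a left or right multiplication.\<close>

definition cochain_scale :: "('g \<Rightarrow> 'g) \<Rightarrow> nat \<Rightarrow> 'a topology \<Rightarrow> (((nat \<Rightarrow> real) \<Rightarrow> 'a) \<Rightarrow> 'g) \<Rightarrow> ((nat \<Rightarrow> real) \<Rightarrow> 'a) \<Rightarrow> 'g" where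
  "cochain_scale e n X \<omega> = (\<lambda>\<sigma>\<in>singular_simplex_set n X. e (\<omega> \<sigma>))"

lemma cochain_scale_hom:
  assumes e: "e \<in> hom G G"
  shows "cochain_scale e n X \<in> hom (singular_cochain_group n X G) (singular_cochain_group n X G)"
proof (rule homI)
  fix \<omega> assume \<omega>: "\<omega> \<in> carrier (singular_cochain_group n X G)"
  then show "cochain_scale e n X \<omega> \<in> carrier (singular_cochain_group n X G)"
    using hom_in_carrier[OF e] by (auto simp: cochain_scale_def carrier_cochain_group)
  fix \<eta> assume \<eta>: "\<eta> \<in> carrier (singular_cochain_group n X G)"
  show "cochain_scale e n X (\<omega> \<otimes>\<^bsub>singular_cochain_group n X G\<^esub> \<eta>) =
      cochain_scale e n X \<omega> \<otimes>\<^bsub>singular_cochain_group n X G\<^esub> cochain_scale e n X \<eta>"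
    unfolding mult_cochain_group cochain_scale_def
    using cochain_closed[OF \<omega>] cochain_closed[OF \<eta>]
    by (intro restrict_ext) (simp add: hom_mult[OF e])
qed

lemma coboundary_scale:
  assumes e: "e \<in> hom G G" and \<omega>: "\<omega> \<in> carrier (singular_cochain_group n X G)"
  shows "coboundary n X G (cochain_scale e n X \<omega>) = cochain_scale e (Suc n) X (coboundary n X G \<omega>)"
proof -
  have s: "cochain_scale e n X \<omega> \<in> carrier (singular_cochain_group n X G)"
    using cochain_scale_hom[OF e] \<omega> by (rule hom_in_carrier)
  show ?thesis
    unfolding coboundary_eq[OF s] cochain_scale_def[of e "Suc n"]
  proof (rule restrict_ext)
    fix \<sigma> assume "\<sigma> \<in> singular_simplex_set (Suc n) X"
    then have \<sigma>: "singular_simplex (Suc n) X \<sigma>" by simp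
    let ?c = "chain_boundary (Suc n) (frag_of \<sigma>)"
    have c: "singular_chain n X ?c" using \<sigma> by (intro singular_chain_boundary_alt) (simp add: singular_chain_of)
    have "chain_eval G (cochain_scale e n X \<omega>) ?c = chain_eval G (\<lambda>\<tau>. e (\<omega> \<tau>)) ?c"
      using cochain_Pi[OF s c] c by (intro chain_eval_cong) (auto simp: cochain_scale_def singular_chain_def)
    also have "\<dots> = e (chain_eval G \<omega> ?c)"
      using e cochain_Pi[OF \<omega> c] by (rule chain_eval_hom)
    finally show "chain_eval G (cochain_scale e n X \<omega>) ?c = e (coboundary n X G \<omega> \<sigma>)"
      using \<sigma> by (simp add: coboundary_eq[OF \<omega>])
  qed
qed

lemma scale_rel_measurable:
  assumes e: "e \<in> hom G G" "e \<in> M \<rightarrow>\<^sub>M M" and \<omega>: "\<omega> \<in> rel_measurable_cochains n X U G M"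
  shows "cochain_scale e n (mt_topo X) \<omega> \<in> rel_measurable_cochains n X U G M"
proof -
  have \<omega>m: "\<omega> \<in> measurable_cochains n X G M" using \<omega> by (simp add: rel_measurable_cochains_def)
  have "cochain_scale e n (mt_topo X) \<omega> \<in> measurable_cochains n X G M"
    unfolding cochain_scale_def
  proof (rule measurable_cochainsI)
    fix \<sigma> assume "singular_simplex n (mt_topo X) \<sigma>"
    then show "e (\<omega> \<sigma>) \<in> carrier G"
      using hom_in_carrier[OF e(1)] measurable_cochain_closed[OF \<omega>m] by blast
  next
    fix T \<sigma> assume "measurable_singular_simplex n T X \<sigma>"
    from measurable_compose[OF measurable_cochainD[OF \<omega>m this] e(2)]
    show "(\<lambda>t. e (\<omega> (\<lambda>x\<in>standard_simplex n. \<sigma> (x, t)))) \<in> T \<rightarrow>\<^sub>M M" .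
  qed
  moreover have "e \<one> = \<one>" using hom_one[OF e(1)] is_group by blast
  ultimately show ?thesis
    using \<omega> by (auto simp: rel_measurable_cochains_def cochain_scale_def singular_simplex_subtopology)
qed

lemma scale_coboundaries:
  assumes e: "e \<in> hom G G" "e \<in> M \<rightarrow>\<^sub>M M" and \<omega>: "\<omega> \<in> rel_measurable_coboundaries n X U G M"
  shows "cochain_scale e n (mt_topo X) \<omega> \<in> rel_measurable_coboundaries n X U G M"
proof (cases n)
  case 0
  have "group_hom (singular_cochain_group n (mt_topo X) G) (singular_cochain_group n (mt_topo X) G)
      (cochain_scale e n (mt_topo X))"
    by (simp add: group_hom_def group_hom_axioms_def cochain_group_group cochain_scale_hom[OF e(1)])
  from group_hom.hom_one[OF this] show ?thesis
    using \<omega> 0 by (simp add: rel_measurable_coboundaries_def)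
next
  case (Suc m)
  then obtain \<xi> where \<xi>: "\<xi> \<in> rel_measurable_cochains m X U G M" "\<omega> = coboundary m (mt_topo X) G \<xi>"
    using \<omega> by (auto simp: rel_measurable_coboundaries_def)
  have "cochain_scale e n (mt_topo X) \<omega> = coboundary m (mt_topo X) G (cochain_scale e m (mt_topo X) \<xi>)"
    using coboundary_scale[OF e(1) subgroup.mem_carrier[OF subgroup_rel_measurable_cochains \<xi>(1)]] \<xi>(2) Suc
    by simp
  then show ?thesis
    using Suc scale_rel_measurable[OF e \<xi>(1)] by (simp add: rel_measurable_coboundaries_def)
qed

definition cohomology_scale ::
    "('g \<Rightarrow> 'g) \<Rightarrow> nat \<Rightarrow> 'a mt_space \<Rightarrow> 'a set \<Rightarrow> (((nat \<Rightarrow> real) \<Rightarrow> 'a) \<Rightarrow> 'g) set \<Rightarrow> (((nat \<Rightarrow> real) \<Rightarrow> 'a) \<Rightarrow> 'g) set" where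
  "cohomology_scale e n X U c =
     the_elem ((\<lambda>\<omega>. cohomology_class n X U G M (cochain_scale e n (mt_topo X) \<omega>)) ` c)"

lemma cohomology_scale_class:
  assumes e: "e \<in> hom G G" "e \<in> M \<rightarrow>\<^sub>M M" and \<omega>: "\<omega> \<in> carrier (singular_cochain_group n (mt_topo X) G)"
  shows "cohomology_scale e n X U (cohomology_class n X U G M \<omega>) =
    cohomology_class n X U G M (cochain_scale e n (mt_topo X) \<omega>)"
  unfolding cohomology_scale_def cohomology_class_def
  using scale_coboundaries[OF e]
  by (intro the_elem_coset_image[OF cochain_group_group cochain_group_group subgroup_rel_measurable_coboundaries
        subgroup_rel_measurable_coboundaries cochain_scale_hom[OF e(1)] _ \<omega>]) blast

end

context measurable_excision
begin

lemma cohomology_pullback_class: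
  assumes \<omega>: "\<omega> \<in> carrier (singular_cochain_group n (mt_topo X) G)"
  shows "cohomology_pullback n (mt_subspace X V) (U \<inter> V) G M id (cohomology_class n X U G M \<omega>) =
    cohomology_class n (mt_subspace X V) (U \<inter> V) G M (restriction n \<omega>)"
  unfolding cohomology_pullback_eq cohomology_class_def mt_topo_subspace
  using restriction_coboundaries
  by (intro the_elem_coset_image[OF cochain_group_group cochain_group_group subgroup_rel_measurable_coboundaries
        subgroup_coboundaries_subspace restriction_hom _ \<omega>]) blast

text \<open>Restriction and pointwise application of \<open>e\<close> commute on cochains, and both
  induced maps can be computed on any representative of a class.\<close>

lemma cohomology_pullback_scale:
  assumes e: "e \<in> hom G G" "e \<in> M \<rightarrow>\<^sub>M M" and c: "c \<in> carrier (rel_measurable_cohomology n X U G M)"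
  shows "cohomology_pullback n (mt_subspace X V) (U \<inter> V) G M id (cohomology_scale e n X U c) =
    cohomology_scale e n (mt_subspace X V) (U \<inter> V) (cohomology_pullback n (mt_subspace X V) (U \<inter> V) G M id c)"
proof -
  obtain \<omega> where "\<omega> \<in> rel_measurable_cocycles n X U G M" and c: "c = cohomology_class n X U G M \<omega>"
    using c by (auto simp: rel_measurable_cohomology_def FactGroup_def RCOSETS_def cohomology_class_def r_coset_def)
  then have \<omega>: "\<omega> \<in> carrier (singular_cochain_group n (mt_topo X) G)"
    using subgroup.mem_carrier[OF subgroup_rel_measurable_cocycles] by blast
  have e\<omega>: "cochain_scale e n (mt_topo X) \<omega> \<in> carrier (singular_cochain_group n (mt_topo X) G)"
    using cochain_scale_hom[OF e(1)] \<omega> by (rule hom_in_carrier)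
  have r\<omega>: "restriction n \<omega> \<in> carrier (singular_cochain_group n (mt_topo (mt_subspace X V)) G)"
    using hom_in_carrier[OF restriction_hom \<omega>] by simp
  have "restriction n (cochain_scale e n (mt_topo X) \<omega>) =
      cochain_scale e n (mt_topo (mt_subspace X V)) (restriction n \<omega>)"
    unfolding restriction_eq cochain_scale_def mt_topo_subspace
    by (rule restrict_ext) (simp add: singular_simplex_subtopology)
  then show ?thesis
    unfolding c
    by (simp only: cohomology_scale_class[OF e \<omega>] cohomology_scale_class[OF e r\<omega>]
        cohomology_pullback_class[OF \<omega>] cohomology_pullback_class[OF e\<omega>])
qed

end

section \<open>Excision for group and ring coefficients\<close>

lemma standard_comm_group_coefficients:
  "standard_comm_group G M \<Longrightarrow> measurable_coefficients G M"
  by (simp add: standard_comm_group_def measurable_coefficients_def measurable_coefficients_axioms_def)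

lemma standard_ring_coefficients:
  assumes "standard_ring R M"
  shows "measurable_coefficients (add_monoid R) M"
proof -
  have R: "ring R" using assms by (simp add: standard_ring_def)
  then have "comm_group (add_monoid R)"
    by (intro abelian_group.a_comm_group ring.is_abelian_group)
  then show ?thesis
    using assms
    by (simp add: standard_ring_def measurable_coefficients_def measurable_coefficients_axioms_def a_inv_def)
qed

lemma measurable_excisionI:
  assumes "measurable_coefficients G M"
    and "openin (mt_topo X) U" "U \<in> sets (mt_meas X)" "openin (mt_topo X) V" "V \<in> sets (mt_meas X)"
    and "U \<union> V = topspace (mt_topo X)"
  shows "measurable_excision G M X U V"
  using assms by (simp add: measurable_excision_def measurable_excision_axioms_def)

text \<open>Multiplication by a fixed scalar is additive by distributivity and measurable as a
  section of the measurable multiplication, so both scalar actions are instances of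
  \<open>cohomology_scale\<close>.\<close>

lemma excision_ring_iso:
  fixes X :: "'a mt_space"
  assumes R: "standard_ring R M"
    and UV: "openin (mt_topo X) U" "U \<in> sets (mt_meas X)" "openin (mt_topo X) V" "V \<in> sets (mt_meas X)"
      "U \<union> V = topspace (mt_topo X)"
  shows "cohomology_pullback n (mt_subspace X V) (U \<inter> V) (add_monoid R) M id \<in>
     ring_coefficient_iso n X U (mt_subspace X V) (U \<inter> V) R M"
proof -
  interpret measurable_excision "add_monoid R" M X U V
    by (rule measurable_excisionI[OF standard_ring_coefficients[OF R] UV])
  have ring: "ring R" and sp: "space M = carrier R"
    and mult: "(\<lambda>(a, b). a \<otimes>\<^bsub>R\<^esub> b) \<in> M \<Otimes>\<^sub>M M \<rightarrow>\<^sub>M M"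
    using R by (auto simp: standard_ring_def)
  have l: "(\<lambda>a. r \<otimes>\<^bsub>R\<^esub> a) \<in> hom (add_monoid R) (add_monoid R)" "(\<lambda>a. r \<otimes>\<^bsub>R\<^esub> a) \<in> M \<rightarrow>\<^sub>M M"
    if r: "r \<in> carrier R" for r
  proof -
    show "(\<lambda>a. r \<otimes>\<^bsub>R\<^esub> a) \<in> hom (add_monoid R) (add_monoid R)"
      using r ring by (auto simp: hom_def ring.ring_simprules)
    have "(\<lambda>a. (r, a)) \<in> M \<rightarrow>\<^sub>M M \<Otimes>\<^sub>M M" using r sp by (intro measurable_Pair) auto
    from measurable_compose[OF this mult] show "(\<lambda>a. r \<otimes>\<^bsub>R\<^esub> a) \<in> M \<rightarrow>\<^sub>M M" by simp
  qed
  have r: "(\<lambda>a. a \<otimes>\<^bsub>R\<^esub> r) \<in> hom (add_monoid R) (add_monoid R)" "(\<lambda>a. a \<otimes>\<^bsub>R\<^esub> r) \<in> M \<rightarrow>\<^sub>M M"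
    if r: "r \<in> carrier R" for r
  proof -
    show "(\<lambda>a. a \<otimes>\<^bsub>R\<^esub> r) \<in> hom (add_monoid R) (add_monoid R)"
      using r ring by (auto simp: hom_def ring.ring_simprules)
    have "(\<lambda>a. (a, r)) \<in> M \<rightarrow>\<^sub>M M \<Otimes>\<^sub>M M" using r sp by (intro measurable_Pair) auto
    from measurable_compose[OF this mult] show "(\<lambda>a. a \<otimes>\<^bsub>R\<^esub> r) \<in> M \<rightarrow>\<^sub>M M" by simp
  qed
  have scale: "cohomology_lscale n Y W R M s c = cohomology_scale (\<lambda>a. s \<otimes>\<^bsub>R\<^esub> a) n Y W c"
    "cohomology_rscale n Y W R M s c = cohomology_scale (\<lambda>a. a \<otimes>\<^bsub>R\<^esub> s) n Y W c"
    for Y :: "'a mt_space" and W s c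
    by (simp_all add: cohomology_lscale_def cohomology_rscale_def cohomology_scale_def cochain_scale_def)
  show ?thesis
    unfolding ring_coefficient_iso_def scale
    using excision_iso cohomology_pullback_scale[OF l] cohomology_pullback_scale[OF r] by blast
qed

theorem theorem2p12:
  fixes F :: "'a mt_space"
    and G :: "('g, 'm) monoid_scheme" and MG :: "'g measure"
    and R :: "('r, 'k) ring_scheme" and MR :: "'r measure"
  assumes "measurable_lamination F"
    and "\<exists>A. regular_measurable_atlas F A"
  shows
    "(standard_comm_group G MG \<longrightarrow>
       (\<forall>U V. openin (mt_topo F) U \<and> U \<in> sets (mt_meas F) \<and>
          openin (mt_topo F) V \<and> V \<in> sets (mt_meas F) \<and> U \<union> V = topspace (mt_topo F) \<longrightarrow>
          (\<forall>n. cohomology_pullback n (mt_subspace F V) (U \<inter> V) G MG id \<in>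
             iso (rel_measurable_cohomology n F U G MG)
                 (rel_measurable_cohomology n (mt_subspace F V) (U \<inter> V) G MG))) \<and>
       (\<forall>U Z. openin (mt_topo F) U \<and> U \<in> sets (mt_meas F) \<and>
          closedin (mt_topo F) Z \<and> Z \<in> sets (mt_meas F) \<and> Z \<subseteq> U \<longrightarrow>
          (\<forall>n. cohomology_pullback n (mt_subspace F (topspace (mt_topo F) - Z)) (U - Z) G MG id \<in>
             iso (rel_measurable_cohomology n F U G MG)
                 (rel_measurable_cohomology n (mt_subspace F (topspace (mt_topo F) - Z)) (U - Z) G MG))))
     \<and>
     (standard_ring R MR \<longrightarrow>
       (\<forall>U V. openin (mt_topo F) U \<and> U \<in> sets (mt_meas F) \<and>
          openin (mt_topo F) V \<and> V \<in> sets (mt_meas F) \<and> U \<union> V = topspace (mt_topo F) \<longrightarrow>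
          (\<forall>n. cohomology_pullback n (mt_subspace F V) (U \<inter> V) (add_monoid R) MR id \<in>
             ring_coefficient_iso n F U (mt_subspace F V) (U \<inter> V) R MR)) \<and>
       (\<forall>U Z. openin (mt_topo F) U \<and> U \<in> sets (mt_meas F) \<and>
          closedin (mt_topo F) Z \<and> Z \<in> sets (mt_meas F) \<and> Z \<subseteq> U \<longrightarrow>
          (\<forall>n. cohomology_pullback n (mt_subspace F (topspace (mt_topo F) - Z)) (U - Z) (add_monoid R) MR id \<in>
             ring_coefficient_iso n F U (mt_subspace F (topspace (mt_topo F) - Z)) (U - Z) R MR)))"
proof -
  have space: "space (mt_meas F) = topspace (mt_topo F)"
    using assms(1) by (simp add: measurable_lamination_def mt_space_def)
  \<comment> \<open>The form with \<open>Z\<close> is the form with \<open>V\<close> the complement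
    of \<open>Z\<close>. Measurability of this complement uses that the \<sigma>-algebra and the
    topology have the same underlying set.\<close>
  have complement: "openin (mt_topo F) (topspace (mt_topo F) - Z)" "topspace (mt_topo F) - Z \<in> sets (mt_meas F)"
      "U \<union> (topspace (mt_topo F) - Z) = topspace (mt_topo F)" "U \<inter> (topspace (mt_topo F) - Z) = U - Z"
    if "openin (mt_topo F) U" "closedin (mt_topo F) Z" "Z \<in> sets (mt_meas F)" "Z \<subseteq> U" for U Z
  proof -
    show "openin (mt_topo F) (topspace (mt_topo F) - Z)" using that(2) by blast
    show "topspace (mt_topo F) - Z \<in> sets (mt_meas F)"
      using that(3) by (simp flip: space)
    show "U \<union> (topspace (mt_topo F) - Z) = topspace (mt_topo F)" "U \<inter> (topspace (mt_topo F) - Z) = U - Z"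
      using openin_subset[OF that(1)] that(4) by auto
  qed
  have group: "cohomology_pullback n (mt_subspace F V) (U \<inter> V) G MG id \<in>
      iso (rel_measurable_cohomology n F U G MG) (rel_measurable_cohomology n (mt_subspace F V) (U \<inter> V) G MG)"
    if "standard_comm_group G MG" "openin (mt_topo F) U" "U \<in> sets (mt_meas F)" "openin (mt_topo F) V"
      "V \<in> sets (mt_meas F)" "U \<union> V = topspace (mt_topo F)" for U V n
    using measurable_excision.excision_iso[OF measurable_excisionI[OF standard_comm_group_coefficients]] that by blast
  show ?thesis
  proof (intro conjI impI allI; elim conjE)
    fix U V n
    assume "standard_comm_group G MG" "openin (mt_topo F) U" "U \<in> sets (mt_meas F)" "openin (mt_topo F) V"
      "V \<in> sets (mt_meas F)" "U \<union> V = topspace (mt_topo F)"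
    then show "cohomology_pullback n (mt_subspace F V) (U \<inter> V) G MG id \<in>
        iso (rel_measurable_cohomology n F U G MG) (rel_measurable_cohomology n (mt_subspace F V) (U \<inter> V) G MG)"
      by (rule group)
  next
    fix U Z n
    assume "standard_comm_group G MG" and Z: "openin (mt_topo F) U" "U \<in> sets (mt_meas F)" "closedin (mt_topo F) Z"
      "Z \<in> sets (mt_meas F)" "Z \<subseteq> U"
    then show "cohomology_pullback n (mt_subspace F (topspace (mt_topo F) - Z)) (U - Z) G MG id \<in>
        iso (rel_measurable_cohomology n F U G MG)
          (rel_measurable_cohomology n (mt_subspace F (topspace (mt_topo F) - Z)) (U - Z) G MG)"
      using group[of U "topspace (mt_topo F) - Z" n] complement[of U Z] by simp
  next
    fix U V n
    assume "standard_ring R MR" "openin (mt_topo F) U" "U \<in> sets (mt_meas F)" "openin (mt_topo F) V"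
      "V \<in> sets (mt_meas F)" "U \<union> V = topspace (mt_topo F)"
    then show "cohomology_pullback n (mt_subspace F V) (U \<inter> V) (add_monoid R) MR id \<in>
        ring_coefficient_iso n F U (mt_subspace F V) (U \<inter> V) R MR"
      by (rule excision_ring_iso)
  next
    fix U Z n
    assume "standard_ring R MR" and Z: "openin (mt_topo F) U" "U \<in> sets (mt_meas F)" "closedin (mt_topo F) Z"
      "Z \<in> sets (mt_meas F)" "Z \<subseteq> U"
    then show "cohomology_pullback n (mt_subspace F (topspace (mt_topo F) - Z)) (U - Z) (add_monoid R) MR id \<in>
        ring_coefficient_iso n F U (mt_subspace F (topspace (mt_topo F) - Z)) (U - Z) R MR"
      using excision_ring_iso[of R MR F U "topspace (mt_topo F) - Z" n] complement[of U Z] by simp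
  qed
qed

end
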